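(* Consider the D1Q2 boundary-value scheme of the context, and assume either ($s_2\in(0,2)$ and $0<|\mathscr{C}|\leq1$) or ($s_2=2$ and $0<|\mathscr{C}|<1$). Then, with the classification labels of the context: (A) For $\mathscr{C}<0$ and $s_2\in(0,2)$: bounce-back MU-L; anti-bounce-back MU-L; two-steps anti-bounce-back SS; extrapolation with $\sigma=1$ SS; extrapolation with $2\leq\sigma\leq4$ SS; kinetic Dirichlet SS. For $\mathscr{C}<0$ and $s_2=2$: bounce-back MU-E; anti-bounce-back MU-E; two-steps anti-bounce-back SSOO; extrapolation $\sigma=1$ SSOO; extrapolation $2\leq\sigma\leq4$ MU-E; kinetic Dirichlet SS. For $\mathscr{C}>0$ and $s_2\in(0,2]$: bounce-back SS; anti-bounce-back SS; two-steps anti-bounce-back SS; extrapolation $\sigma=1$ MU-E; extrapolation $2\leq\sigma\leq4$ MU-E; kinetic Dirichlet SS. (B) For the specific parameters: with $\mathscr{C}=-\tfrac12$, $s_2=\tfrac32$: extrapolated equilibrium $\sigma=1$ SS, extrapolated equilibrium $\sigma=3$ SS, future SS, invented GR-L. With $\mathscr{C}=-\tfrac12$, $s_2=2$: extrapolated equilibrium $\sigma=1$ SS, extrapolated equilibrium $\sigma=3$ GR-L, future SS, invented GR-L. With $\mathscr{C}=\tfrac12$ and $s_2\in\{\tfrac32,2\}$: extrapolated equilibrium $\sigma=1$ MU-E, extrapolated equilibrium $\sigma=3$ GR-L, future MU-E, invented GR-L.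
   Context: Grid: $x_j=j\Delta x$, $j\in\mathbb{N}$ (ghost point $j=-1$), $t^n=n\Delta t$ with $\Delta t=\Delta x/\lambda$, $\lambda>0$; Courant number $\mathscr{C}=V/\lambda\neq0$ (the transport velocity is $V$; $\mathscr{C}<0$: outflow boundary, $\mathscr{C}>0$: inflow boundary). Unknowns $f_{1,j}^n,f_{2,j}^n$ (velocities $c_1=1$, $c_2=-1$), moments $m_1=f_1+f_2$, $m_2=f_1-f_2$. Relaxation at every $j\in\mathbb{N}$: $m_1^\star=m_1$, $m_2^\star=(1-s_2)m_2+s_2\mathscr{C}m_1$, and $f_1^\star=(m_1+m_2^\star)/2$, $f_2^\star=(m_1-m_2^\star)/2$. Transport: $f^{n+1}_{1,j}=f^{n\star}_{1,j-1}$, $f^{n+1}_{2,j}=f^{n\star}_{2,j+1}$ for $j\in\mathbb{N}$. Zero initial data. The ghost value $f^{n\star}_{1,-1}$ is given by one of the boundary conditions ($g^n_{1,-1}\in\mathbb{R}$ is a source): bounce-back: $f^{n\star}_{1,-1}=f^{n\star}_{2,0}+g^n_{1,-1}$; anti-bounce-back: $f^{n\star}_{1,-1}=-f^{n\star}_{2,0}+g^n_{1,-1}$; two-steps anti-bounce-back: $f^{n\star}_{1,-1}=-f^{n\star}_{2,1}+g^n_{1,-1}$; extrapolation of order $\sigma\geq1$: $f^{n\star}_{1,-1}=\sum_{j=0}^{\sigma-1}(-1)^j\binom{\sigma}{j+1}f^{n\star}_{1,j}+g^n_{1,-1}$; kinetic Dirichlet: $f^{n\star}_{1,-1}=g^n_{1,-1}$;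 extrapolated equilibrium of order $\sigma\geq1$: $f^{n\star}_{1,-1}=\tfrac12(1+\mathscr{C})\sum_{j=0}^{\sigma-1}(-1)^j\binom{\sigma}{j+1}(f^{n\star}_{1,j}+f^{n\star}_{2,j})+g^n_{1,-1}$; future: $f^{n\star}_{1,-1}=\tfrac12(1+\mathscr{C})(f^{n\star}_{1,0}+f^{n\star}_{2,2})+g^n_{1,-1}$; invented: $f^{n\star}_{1,-1}=f^{n\star}_{1,0}+2f^{n\star}_{2,0}+g^n_{1,-1}$. Strong stability (SS estimate): there is $C>0$ such that for all $\alpha>0$, all sources $(g^n_{1,-1})_n$ and all $\Delta x>0$: $\frac{\alpha}{1+\alpha\Delta t}\sum_{n,j\in\mathbb{N}}\Delta t\Delta x\,e^{-2\alpha n\Delta t}|m^n_j|^2\leq C\sum_{n\in\mathbb{N}}\Delta t\,e^{-2\alpha n\Delta t}(g^n_{1,-1})^2$, with $m^n_j=(m^n_{1,j},m^n_{2,j})$. Strong stability on the observed output (SSOO estimate): the same with $|m^n_j|^2$ replaced by $(m^n_{1,j})^2$. Classification labels: SS = the SS estimate holds (hence also SSOO). SSOO = the SSOO estimate holds but the SS estimate does not. MU-L / MU-E / GR-L = neither estimate holds; "MU" (mildly unstable) means the instability is produced by a critical mode $(z,\kappa)$ (time factor $z$, space factor $\kappa$, i.e. a pair solving both $\det(zI-\hat E(\kappa))=0$ for the bulk and the corresponding determinant for the boundary scheme, with $\kappa$ the limit of the stable spatial root) with $|z|=1$, and "GR" (Godunov–Ryabenkii) means $|z|>1$; suffix "L"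 means $|\kappa|<1$ (instability localized at the boundary), "E" means $|\kappa|=1$ (instability extended in space). *)

theory Defs
  imports "HOL-Analysis.Analysis" "HOL-Library.Extended_Nonnegative_Real"
begin

datatype bc =
    BounceBack
  | AntiBounceBack
  | TwoStepsAntiBounceBack
  | Extrapolation nat
  | KineticDirichlet
  | ExtrapolatedEquilibrium nat
  | Future
  | Invented

text \<open>Relaxation (collision) at one node: state (f1,f2) to (f1*,f2*); s2 relaxation rate,
  C Courant number.  Generic over the scalar field (real for the scheme, complex for modes).\<close>
definition relax :: "real \<Rightarrow> real \<Rightarrow> 'a::real_field \<times> 'a \<Rightarrow> 'a \<times> 'a" where
  "relax s2 C f =
     (let m1 = fst f + snd f;
          m2 = fst f - snd f;
          m2s = (1 - of_real s2) * m2 + of_real s2 * of_real C * m1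
      in ((m1 + m2s) / 2, (m1 - m2s) / 2))"

text \<open>Ghost value f1*_{-1} computed from the post-collision states fs j = (f1*_j, f2*_j), j in N
  (source term excluded).\<close>
fun ghost :: "bc \<Rightarrow> real \<Rightarrow> (nat \<Rightarrow> 'a::real_field \<times> 'a) \<Rightarrow> 'a" where
  "ghost BounceBack C fs = snd (fs 0)"
| "ghost AntiBounceBack C fs = - snd (fs 0)"
| "ghost TwoStepsAntiBounceBack C fs = - snd (fs 1)"
| "ghost (Extrapolation \<sigma>) C fs =
     (\<Sum>j<\<sigma>. (-1) ^ j * of_nat (\<sigma> choose (j + 1)) * fst (fs j))"
| "ghost KineticDirichlet C fs = 0"
| "ghost (ExtrapolatedEquilibrium \<sigma>) C fs =
     of_real ((1 + C) / 2) *
       (\<Sum>j<\<sigma>. (-1) ^ j * of_nat (\<sigma> choose (j + 1)) * (fst (fs j) + snd (fs j)))"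
| "ghost Future C fs = of_real ((1 + C) / 2) * (fst (fs 0) + snd (fs 2))"
| "ghost Invented C fs = fst (fs 0) + 2 * snd (fs 0)"

text \<open>One time step: F j = (f1^n_j, f2^n_j) for j in N; gn = g^n_{1,-1} the source.
  Collision everywhere, then transport f1^{n+1}_j = f1*_{j-1}, f2^{n+1}_j = f2*_{j+1},
  with f1*_{-1} given by the boundary condition.\<close>
definition step :: "real \<Rightarrow> real \<Rightarrow> bc \<Rightarrow> 'a::real_field \<Rightarrow> (nat \<Rightarrow> 'a \<times> 'a) \<Rightarrow> nat \<Rightarrow> 'a \<times> 'a" where
  "step s2 C b gn F j =
     (let fs = (\<lambda>k. relax s2 C (F k))
      in (if j = 0 then ghost b C fs + gn else fst (fs (j - 1)), snd (fs (Suc j))))"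

primrec sol :: "real \<Rightarrow> real \<Rightarrow> bc \<Rightarrow> (nat \<Rightarrow> real) \<Rightarrow> nat \<Rightarrow> nat \<Rightarrow> real \<times> real" where
  "sol s2 C b g 0 = (\<lambda>j. (0, 0))"
| "sol s2 C b g (Suc n) = step s2 C b (g n) (sol s2 C b g n)"

definition mom1 :: "real \<times> real \<Rightarrow> real" where "mom1 f = fst f + snd f"
definition mom2 :: "real \<times> real \<Rightarrow> real" where "mom2 f = fst f - snd f"

text \<open>Generic weighted estimate, with pointwise quantity q (|m|^2 or m1^2).
  Sums are taken in ennreal (nonnegative terms, possibly infinite).\<close>
definition stab_estimate :: "(real \<times> real \<Rightarrow> real) \<Rightarrow> real \<Rightarrow> real \<Rightarrow> bc \<Rightarrow> real \<Rightarrow> bool" where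
  "stab_estimate q s2 C b lam \<longleftrightarrow>
     (\<exists>K>0. \<forall>\<alpha>>0. \<forall>g::nat \<Rightarrow> real. \<forall>dx>0.
        (let dt = dx / lam in
          ennreal (\<alpha> / (1 + \<alpha> * dt)) *
            (\<Sum>n. \<Sum>j. ennreal (dt * dx * exp (- 2 * \<alpha> * real n * dt) * q (sol s2 C b g n j)))
          \<le> ennreal K * (\<Sum>n. ennreal (dt * exp (- 2 * \<alpha> * real n * dt) * (g n)\<^sup>2))))"

definition SS_est :: "real \<Rightarrow> real \<Rightarrow> bc \<Rightarrow> real \<Rightarrow> bool" where
  "SS_est = stab_estimate (\<lambda>f. (mom1 f)\<^sup>2 + (mom2 f)\<^sup>2)"

definition SSOO_est :: "real \<Rightarrow> real \<Rightarrow> bc \<Rightarrow> real \<Rightarrow> bool" where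
  "SSOO_est = stab_estimate (\<lambda>f. (mom1 f)\<^sup>2)"

text \<open>Bulk characteristic equation det(zI - E(kappa)) = 0 with E(kappa) = diag(1/kappa, kappa) K,
  written (row 1 multiplied by kappa) as existence of phi \<noteq> 0 with
  z kappa phi1 = (K phi)_1 and z phi2 = kappa (K phi)_2.\<close>
definition bulk_char :: "real \<Rightarrow> real \<Rightarrow> complex \<Rightarrow> complex \<Rightarrow> bool" where
  "bulk_char s2 C z \<kappa> \<longleftrightarrow>
     (\<exists>\<phi>::complex \<times> complex. \<phi> \<noteq> (0, 0) \<and>
        z * \<kappa> * fst \<phi> = fst (relax s2 C \<phi>) \<and> z * snd \<phi> = \<kappa> * snd (relax s2 C \<phi>))"

definition stable_root_or_limit :: "real \<Rightarrow> real \<Rightarrow> complex \<Rightarrow> complex \<Rightarrow> bool" where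
  "stable_root_or_limit s2 C z \<kappa> \<longleftrightarrow>
     (norm z > 1 \<and> norm \<kappa> < 1 \<and> bulk_char s2 C z \<kappa>) \<or>
     (norm z = 1 \<and> (\<exists>zs ks. (\<forall>k. norm (zs k) > 1 \<and> norm (ks k) < 1 \<and> bulk_char s2 C (zs k) (ks k))
                        \<and> zs \<longlonglongrightarrow> z \<and> ks \<longlonglongrightarrow> \<kappa>))"

text \<open>Critical mode: the boundary (Kreiss-Lopatinskii) determinant vanishes, i.e. there is
  phi \<noteq> 0 such that f^n_j = z^n kappa^j phi solves the homogeneous scheme (bulk and boundary).\<close>
definition critical_mode :: "real \<Rightarrow> real \<Rightarrow> bc \<Rightarrow> complex \<Rightarrow> complex \<Rightarrow> bool" where
  "critical_mode s2 C b z \<kappa> \<longleftrightarrow>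
     stable_root_or_limit s2 C z \<kappa> \<and>
     (\<exists>\<phi>::complex \<times> complex. \<phi> \<noteq> (0, 0) \<and>
        (let F = (\<lambda>n j. (z ^ n * \<kappa> ^ j * fst \<phi>, z ^ n * \<kappa> ^ j * snd \<phi>))
         in \<forall>n j. F (Suc n) j = step s2 C b 0 (F n) j))"

datatype label = L_SS | L_SSOO | L_MU_L | L_MU_E | L_GR_L

fun has_label :: "real \<Rightarrow> real \<Rightarrow> real \<Rightarrow> bc \<Rightarrow> label \<Rightarrow> bool" where
  "has_label lam s2 C b L_SS \<longleftrightarrow> SS_est s2 C b lam"
| "has_label lam s2 C b L_SSOO \<longleftrightarrow> SSOO_est s2 C b lam \<and> \<not> SS_est s2 C b lam"
| "has_label lam s2 C b L_MU_L \<longleftrightarrow> \<not> SS_est s2 C b lam \<and> \<not> SSOO_est s2 C b lam \<and>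
     \<not> (\<exists>z \<kappa>. critical_mode s2 C b z \<kappa> \<and> norm z > 1) \<and>
     (\<exists>z \<kappa>. critical_mode s2 C b z \<kappa> \<and> norm z = 1 \<and> norm \<kappa> < 1)"
| "has_label lam s2 C b L_MU_E \<longleftrightarrow> \<not> SS_est s2 C b lam \<and> \<not> SSOO_est s2 C b lam \<and>
     \<not> (\<exists>z \<kappa>. critical_mode s2 C b z \<kappa> \<and> norm z > 1) \<and>
     (\<exists>z \<kappa>. critical_mode s2 C b z \<kappa> \<and> norm z = 1 \<and> norm \<kappa> = 1)"
| "has_label lam s2 C b L_GR_L \<longleftrightarrow> \<not> SS_est s2 C b lam \<and> \<not> SSOO_est s2 C b lam \<and>
     (\<exists>z \<kappa>. critical_mode s2 C b z \<kappa> \<and> norm z > 1 \<and> norm \<kappa> < 1)"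

end

theory Submission
  imports Defs "HOL-Complex_Analysis.Complex_Analysis" "HOL-Computational_Algebra.Fundamental_Theorem_Algebra"
begin

text \<open>
  With \<open>x = 1/z\<close> the bulk scheme has, for every \<open>x\<close> in the unit disc, exactly one stable mode, with
  \<open>f\<^sub>2\<close> equal to \<open>k w\<close> times \<open>f\<^sub>1\<close>: its spatial factor \<open>k\<close> and \<open>w\<close> are holomorphic in \<open>x\<close>, and the
  relaxation energy gives \<open>cmod k \<le> cmod x\<close>. The generating function of \<open>f\<^sub>1 + u f\<^sub>2\<close> at cell \<open>j\<close> is that of the
  source times \<open>x k\<^sup>j (1 + u k w) / (1 - \<beta>(k, w))\<close>, where \<open>\<beta>\<close> is the symbol of the boundary condition;
  \<open>u = 1\<close> gives \<open>m\<^sub>1\<close> and \<open>u = -1\<close> gives \<open>m\<^sub>2\<close>. By Parseval on circles the estimate for a moment follows as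
  soon as \<open>(1 + u k w) / (1 - \<beta>)\<close> is bounded on the disc. Conversely, sources \<open>(\<plusminus> 1)\<^sup>n\<close> show that an estimate
  bounds this quotient, up to explicit weights, along the radii towards \<open>x = 1\<close> and \<open>x = -1\<close>.
  Critical modes are the zeros of \<open>1 - \<beta>\<close> on the closed disc; the classification is read off their location
  and the order of vanishing of \<open>1 + u k w\<close> and \<open>1 - \<beta>\<close> there.
\<close>

section \<open>Modes of the bulk scheme\<close>

text \<open>Bounds have to be uniform up to the unit circle, where the branch can lose regularity:
  the discriminant of its equation may vanish there (for \<open>s = 2\<close> its zeros lie on the
  circle). So there is no compactness argument on the closed disc. Lower bounds for
  \<open>1 - bsym\<close> are algebraic inequalities in the open disc, drawn from the energy bound
  on \<open>w\<close> and from the quadratics for \<open>k\<close> and \<open>w\<close>; the circle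
  is approached only radially. The energy has weights \<open>1 - C\<close> and \<open>1 + C\<close>.
  At \<open>|C| = 1\<close> one of them vanishes, and explicit formulas for the branch replace it.
  For \<open>s = 2\<close> collisions conserve the energy, spatial factors reach modulus 1, and
  numerator and denominator of the transfer function can vanish together. There the rates in
  \<open>1 - |x|\<close> decide, including that of \<open>1 - |k|^2\<close>, the reciprocal of the
  sum over cells.\<close>

definition ca :: "real \<Rightarrow> real \<Rightarrow> real" where "ca s C = 1 - s * (1 - C) / 2"
definition cb :: "real \<Rightarrow> real \<Rightarrow> real" where "cb s C = s * (1 + C) / 2"
definition cc :: "real \<Rightarrow> real \<Rightarrow> real" where "cc s C = s * (1 - C) / 2"
definition cd :: "real \<Rightarrow> real \<Rightarrow> real" where "cd s C = 1 - s * (1 + C) / 2"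

lemmas coef_defs = ca_def cb_def cc_def cd_def

text \<open>The coefficients are the entries of the collision matrix. Its columns sum to 1 because
  \<open>m1\<close> is conserved, and its determinant is \<open>1 - s\<close>; these two facts carry
  most of the later algebra.\<close>

lemma relax_eq:
  "relax s C (f :: 'a::real_field \<times> 'a) =
     (of_real (ca s C) * fst f + of_real (cb s C) * snd f,
      of_real (cc s C) * fst f + of_real (cd s C) * snd f)"
  by (simp add: relax_def coef_defs Let_def field_simps)

text \<open>For ghost value 1 the mode has post-collision states
  \<open>(k ^ (j + 1), k ^ j * w)\<close>, up to the time factor. Hence \<open>w\<close> is the
  reflection coefficient of the half space. Neither equation divides by \<open>x\<close> or
  \<open>k\<close>, so \<open>x = 0\<close> and \<open>k = 0\<close> are regular points.\<close>

definition branch :: "real \<Rightarrow> real \<Rightarrow> complex \<Rightarrow> complex \<Rightarrow> complex \<Rightarrow> bool" where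
  "branch s C x k w \<longleftrightarrow>
     k = x * (of_real (ca s C) + of_real (cb s C) * (k * w)) \<and>
     w = x * (of_real (cc s C) + of_real (cd s C) * (k * w))"

lemma branch_minus: "branch s C x k w \<Longrightarrow> branch s C (- x) (- k) (- w)"
  by (auto simp: branch_def)

text \<open>The weights are, up to a common factor, the reciprocals of the equilibrium
  \<open>(1 + C, 1 - C)\<close>. In this norm the collision keeps the equilibrium part and
  multiplies its orthogonal complement by \<open>1 - s\<close>. The loss is a multiple of the
  squared nonequilibrium \<open>(1 - C) - (1 + C) p\<close> of the state \<open>(1, p)\<close>, and
  it vanishes for \<open>s = 2\<close>.\<close>

lemma relax_energy:
  fixes p :: complex
  assumes "0 \<le> s" "s \<le> 2"
  shows "(1 - C) * (cmod (of_real (ca s C) + of_real (cb s C) * p))\<^sup>2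
       + (1 + C) * (cmod (of_real (cc s C) + of_real (cd s C) * p))\<^sup>2
       \<le> (1 - C) + (1 + C) * (cmod p)\<^sup>2"
proof -
  define u v where "u = Re p" and "v = Im p"
  have "(1 - C) + (1 + C) * (cmod p)\<^sup>2 -
      ((1 - C) * (cmod (of_real (ca s C) + of_real (cb s C) * p))\<^sup>2
       + (1 + C) * (cmod (of_real (cc s C) + of_real (cd s C) * p))\<^sup>2)
     = s * (2 - s) / 2 * (((1 - C) - (1 + C) * u)\<^sup>2 + ((1 + C) * v)\<^sup>2)"
    unfolding cmod_power2 coef_defs u_def v_def
    by (simp add: field_simps power2_eq_square)
  moreover have "s * (2 - s) / 2 * (((1 - C) - (1 + C) * u)\<^sup>2 + ((1 + C) * v)\<^sup>2) \<ge> 0"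
    using assms by (intro mult_nonneg_nonneg) auto
  ultimately show ?thesis by linarith
qed

lemma branch_energy:
  assumes "0 \<le> s" "s \<le> 2" and br: "branch s C x k w"
  shows "(1 - C) * (cmod k)\<^sup>2 + (1 + C) * (cmod w)\<^sup>2
       \<le> (cmod x)\<^sup>2 * ((1 - C) + (1 + C) * (cmod (k * w))\<^sup>2)"
proof -
  let ?A = "cmod (of_real (ca s C) + of_real (cb s C) * (k * w))"
  let ?B = "cmod (of_real (cc s C) + of_real (cd s C) * (k * w))"
  have "cmod k = cmod x * ?A" "cmod w = cmod x * ?B"
    using br unfolding branch_def by (metis norm_mult)+
  then have "(1 - C) * (cmod k)\<^sup>2 + (1 + C) * (cmod w)\<^sup>2
     = (cmod x)\<^sup>2 * ((1 - C) * ?A\<^sup>2 + (1 + C) * ?B\<^sup>2)"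
    by (simp add: power_mult_distrib algebra_simps)
  also have "\<dots> \<le> (cmod x)\<^sup>2 * ((1 - C) + (1 + C) * (cmod (k * w))\<^sup>2)"
    by (intro mult_left_mono relax_energy assms) auto
  finally show ?thesis .
qed

lemma abs_cd_le: assumes "0 < s" "s \<le> 2" "\<bar>C\<bar> \<le> 1" shows "\<bar>cd s C\<bar> \<le> 1"
proof -
  have "s * (1 + C) \<le> 2 * 2" "0 \<le> s * (1 + C)"
    using assms by (intro mult_mono mult_nonneg_nonneg; simp)+
  then show ?thesis unfolding cd_def by auto
qed

text \<open>At \<open>C = 1\<close> the energy does not see \<open>k\<close>, but
  \<open>cc = 0\<close> means that nothing is reflected and the branch is explicit.\<close>

lemma branch_C1:
  assumes "0 < s" "s \<le> 2" "C = 1" "branch s C x k w" "cmod (x * k) < 1"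
  shows "w = 0" "k = x"
proof -
  have "cmod (x * of_real (cd s C) * k) < 1"
  proof -
    have "cmod (x * of_real (cd s C) * k) = cmod (x * k) * \<bar>cd s C\<bar>" by (simp add: norm_mult)
    also have "\<dots> \<le> cmod (x * k) * 1" using abs_cd_le[of s C] assms by (intro mult_left_mono) auto
    finally show ?thesis using assms by simp
  qed
  then have "x * of_real (cd s C) * k \<noteq> 1" by auto
  moreover have "w * (1 - x * of_real (cd s C) * k) = 0"
    using assms(3,4) unfolding branch_def cc_def by (simp add: algebra_simps)
  ultimately show "w = 0" by auto
  then show "k = x" using assms(3,4) unfolding branch_def ca_def by simp
qed

text \<open>\<open>branch_energy\<close> rearranges to
  \<open>(1 + C) |w|^2 (1 - |x k|^2) \<le> (1 - C) (|x|^2 - |k|^2)\<close>. The hypothesis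
  \<open>|x k| < 1\<close> makes the left side nonnegative. For \<open>|x| < 1\<close> it is weaker
  than the conclusion \<open>|k| \<le> |x|\<close>, and this gap drives the continuity argument in
  \<open>branch_exists\<close>.\<close>

lemma branch_bounds:
  assumes s: "0 < s" "s \<le> 2" and C: "\<bar>C\<bar> \<le> 1" and br: "branch s C x k w"
    and x: "cmod x \<le> 1" and xk: "cmod (x * k) < 1"
  shows branch_k_le: "cmod k \<le> cmod x"
    and branch_w_le: "(1 + C) * (cmod w)\<^sup>2 \<le> (1 - C) * (cmod x)\<^sup>2"
proof -
  have E: "(1 + C) * (cmod w)\<^sup>2 * (1 - (cmod (x * k))\<^sup>2) \<le> (1 - C) * ((cmod x)\<^sup>2 - (cmod k)\<^sup>2)"
    using branch_energy[OF _ s(2) br] s by (simp add: norm_mult power_mult_distrib algebra_simps)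
  have q: "(cmod (x * k))\<^sup>2 < 1" using xk by (simp add: power_less_one_iff abs_square_less_1)
  show k: "cmod k \<le> cmod x"
  proof (cases "C = 1")
    case True then show ?thesis using branch_C1[OF s True br xk] by simp
  next
    case False
    have "0 \<le> (1 + C) * (cmod w)\<^sup>2 * (1 - (cmod (x * k))\<^sup>2)" using q C by auto
    then have "0 \<le> (1 - C) * ((cmod x)\<^sup>2 - (cmod k)\<^sup>2)" using E by linarith
    then have "0 \<le> (cmod x)\<^sup>2 - (cmod k)\<^sup>2" using False C by (auto simp: zero_le_mult_iff)
    then show ?thesis using power2_le_imp_le[of "cmod k" "cmod x"] by auto
  qed
  define X K where "X = (cmod x)\<^sup>2" and "K = (cmod k)\<^sup>2"
  have XK: "0 \<le> X" "X \<le> 1" "0 \<le> K" "X * K < 1"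
    using q x by (auto simp: X_def K_def norm_mult power_mult_distrib power_le_one)
  \<comment> \<open>Produces the factor \<open>1 - X * K\<close> on the right as well, so that it
    cancels.\<close>
  have "(X * X) * K \<le> 1 * K" using XK by (intro mult_right_mono mult_le_one) auto
  then have "X - K \<le> X * (1 - X * K)" by (simp add: algebra_simps)
  then have "(1 - C) * (X - K) \<le> (1 - C) * (X * (1 - X * K))"
    using C by (intro mult_left_mono) auto
  with E have "(1 + C) * (cmod w)\<^sup>2 * (1 - X * K) \<le> (1 - C) * X * (1 - X * K)"
    by (simp add: X_def K_def norm_mult power_mult_distrib mult.assoc)
  then show "(1 + C) * (cmod w)\<^sup>2 \<le> (1 - C) * (cmod x)\<^sup>2"
    using XK by (simp add: X_def)
qed

text \<open>The factor \<open>1 + C\<close> inside \<open>cb\<close> gives a bound that keeps its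
  meaning at \<open>C = -1\<close>. It makes the denominator \<open>1 - x cb w\<close> of
  \<open>branch_k_bw\<close> nonzero in the open disc.\<close>

lemma branch_bw_le:
  assumes s: "0 < s" "s \<le> 2" and C: "\<bar>C\<bar> \<le> 1" and br: "branch s C x k w"
    and x: "cmod x \<le> 1" and xk: "cmod (x * k) < 1"
  shows "(cmod (of_real (cb s C) * w))\<^sup>2 \<le> (s / 2)\<^sup>2 * (1 - C\<^sup>2) * (cmod x)\<^sup>2"
proof -
  have "\<bar>cb s C\<bar> = s / 2 * (1 + C)" using s C by (simp add: cb_def)
  then have "(cmod (of_real (cb s C) * w))\<^sup>2 = (s / 2)\<^sup>2 * (1 + C) * ((1 + C) * (cmod w)\<^sup>2)"
    by (simp only: norm_mult norm_of_real) (simp only: power2_eq_square mult_ac)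
  also have "\<dots> \<le> (s / 2)\<^sup>2 * (1 + C) * ((1 - C) * (cmod x)\<^sup>2)"
    using C by (intro mult_left_mono branch_w_le[OF assms]) auto
  finally show ?thesis by (simp add: algebra_simps power2_eq_square)
qed

lemma branch_bw_less_1:
  assumes s: "0 < s" "s \<le> 2" and C: "\<bar>C\<bar> \<le> 1" and br: "branch s C x k w"
    and x: "cmod x < 1" and xk: "cmod (x * k) < 1"
  shows "cmod (of_real (cb s C) * w) < 1"
proof -
  have "(cmod (of_real (cb s C) * w))\<^sup>2 \<le> (s / 2)\<^sup>2 * (1 - C\<^sup>2) * (cmod x)\<^sup>2"
    using branch_bw_le[OF s C br _ xk] x by simp
  also have "\<dots> \<le> 1 * (cmod x)\<^sup>2"
    using s C by (intro mult_right_mono mult_le_one power_le_one) (auto simp: abs_square_le_1)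
  also have "\<dots> < 1" using x by (simp add: abs_square_less_1)
  finally show ?thesis by (simp add: abs_square_less_1)
qed

text \<open>The first two formulas recover one unknown from the other. Eliminating between them,
  with the determinant \<open>1 - s\<close>, leaves one quadratic for each unknown.\<close>

lemma branch_quadratics:
  assumes "branch s C x k w"
  shows branch_k_bw: "k * (1 - x * (of_real (cb s C) * w)) = x * of_real (ca s C)"
    and branch_w_dk: "w * (1 - x * (of_real (cd s C) * k)) = x * of_real (cc s C)"
    and branch_w_quad: "w * (1 + of_real (s - 1) * x\<^sup>2) = x * of_real (cb s C) * w\<^sup>2 + x * of_real (cc s C)"
    and branch_k_quad: "k * (1 + of_real (1 - s) * x\<^sup>2) = x * of_real (cd s C) * k\<^sup>2 + x * of_real (ca s C)"
proof -
  define A B c D where "A = complex_of_real (ca s C)" and "B = complex_of_real (cb s C)"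
    and "c = complex_of_real (cc s C)" and "D = complex_of_real (cd s C)"
  note abcd = A_def B_def c_def D_def
  have e: "k = x * (A + B * (k * w))" "w = x * (c + D * (k * w))"
    using assms by (auto simp: branch_def abcd)
  have det: "of_real (s - 1) = B * c - A * D" "of_real (1 - s) = A * D - B * c"
    unfolding abcd coef_defs by (simp_all add: algebra_simps flip: of_real_mult of_real_diff) (simp_all add: field_simps)
  show kw: "k * (1 - x * (of_real (cb s C) * w)) = x * of_real (ca s C)"
    using e(1) unfolding abcd[symmetric] by algebra
  show wk: "w * (1 - x * (of_real (cd s C) * k)) = x * of_real (cc s C)"
    using e(2) unfolding abcd[symmetric] by algebra
  show "w * (1 + of_real (s - 1) * x\<^sup>2) = x * of_real (cb s C) * w\<^sup>2 + x * of_real (cc s C)"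
    using kw wk unfolding det abcd[symmetric] by algebra
  show "k * (1 + of_real (1 - s) * x\<^sup>2) = x * of_real (cd s C) * k\<^sup>2 + x * of_real (ca s C)"
    using kw wk unfolding det abcd[symmetric] by algebra
qed

text \<open>By Vieta two different values of \<open>w\<close> have product \<open>cc / cb\<close>,
  of modulus \<open>(1 - C) / (1 + C)\<close>. The energy bound on both makes their product strictly
  smaller when \<open>|x| < 1\<close>.\<close>

lemma branch_unique:
  assumes s: "0 < s" "s \<le> 2" and C: "\<bar>C\<bar> < 1" and x: "cmod x < 1"
    and br1: "branch s C x k1 w1" and br2: "branch s C x k2 w2"
    and k: "cmod k1 < 1" "cmod k2 < 1"
  shows "k1 = k2" "w1 = w2"
proof -
  define B where "B = complex_of_real (cb s C)"
  have xk: "cmod (x * k1) < 1" "cmod (x * k2) < 1"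
    using mult_strict_mono[of "cmod x" 1 "cmod k1" 1] mult_strict_mono[of "cmod x" 1 "cmod k2" 1] k x
    by (auto simp: norm_mult)
  have bnd: "(1 + C) * (cmod w)\<^sup>2 \<le> (1 - C) * (cmod x)\<^sup>2"
    if "branch s C x k w" "cmod (x * k) < 1" for k w
    using branch_w_le[OF s _ that(1) _ that(2)] C x by simp
  show w: "w1 = w2"
  proof (rule ccontr)
    assume ne: "w1 \<noteq> w2"
    then have "x \<noteq> 0" using br1 br2 by (auto simp: branch_def)
    have "x * B * (w1 * w2) * (w1 - w2) = x * of_real (cc s C) * (w1 - w2)"
      using branch_w_quad[OF br1] branch_w_quad[OF br2] unfolding B_def by algebra
    then have "B * (w1 * w2) = of_real (cc s C)" using ne \<open>x \<noteq> 0\<close> by simp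
    then have "cmod B * (cmod w1 * cmod w2) = cmod (of_real (cc s C))" by (metis norm_mult)
    moreover have "cmod B = s / 2 * (1 + C)" "cmod (of_real (cc s C)) = s / 2 * (1 - C)"
      using s C by (simp_all add: B_def cb_def cc_def del: of_real_mult of_real_divide)
    ultimately have "s / 2 * ((1 + C) * (cmod w1 * cmod w2)) = s / 2 * (1 - C)" by simp
    then have "(1 + C) * (cmod w1 * cmod w2) = 1 - C" using s unfolding mult_cancel_left by simp
    then have "((1 + C) * (cmod w1)\<^sup>2) * ((1 + C) * (cmod w2)\<^sup>2) = (1 - C)\<^sup>2"
      by (metis (no_types, lifting) mult.commute mult.left_commute power2_eq_square)
    moreover have "((1 + C) * (cmod w1)\<^sup>2) * ((1 + C) * (cmod w2)\<^sup>2)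
        \<le> ((1 - C) * (cmod x)\<^sup>2) * ((1 - C) * (cmod x)\<^sup>2)"
      by (rule mult_mono) (use bnd[OF br1 xk(1)] bnd[OF br2 xk(2)] C in auto)
    moreover have "((1 - C) * (cmod x)\<^sup>2) * ((1 - C) * (cmod x)\<^sup>2) < (1 - C)\<^sup>2"
    proof -
      have "(cmod x)\<^sup>2 < 1" using x by (simp add: abs_square_less_1)
      then have "(cmod x)\<^sup>2 * (cmod x)\<^sup>2 < 1" using mult_strict_mono[of "(cmod x)\<^sup>2" 1 "(cmod x)\<^sup>2" 1] by simp
      then have "(1 - C)\<^sup>2 * ((cmod x)\<^sup>2 * (cmod x)\<^sup>2) < (1 - C)\<^sup>2 * 1"
        using C by (intro mult_strict_left_mono) auto
      then show ?thesis by (simp add: power2_eq_square mult_ac)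
    qed
    ultimately show False by linarith
  qed
  have "cmod (x * (B * w1)) < 1"
    using branch_bw_less_1[OF s _ br1 x xk(1)] x C mult_strict_mono[of "cmod x" 1 "cmod (B * w1)" 1]
    by (simp add: norm_mult B_def)
  then have "1 - x * (B * w1) \<noteq> 0" by auto
  moreover have "k1 * (1 - x * (B * w1)) = k2 * (1 - x * (B * w1))"
    using branch_k_bw[OF br1] branch_k_bw[OF br2] w by (simp add: B_def)
  ultimately show "k1 = k2" by simp
qed

text \<open>A nonreal root has a conjugate partner, and their product \<open>1 / q^2\<close> puts
  both at modulus at least 1. For real \<open>t\<close> the bound on \<open>T\<close> leaves at
  least \<open>(1 - |t|) (1 - q^2 |t|) > 0\<close>.\<close>

lemma bulk_discriminant_nonzero:
  fixes t :: complex and T q :: real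
  assumes T: "\<bar>T\<bar> \<le> 1 + q\<^sup>2" and q: "\<bar>q\<bar> \<le> 1" and t: "cmod t < 1"
  shows "1 - of_real T * t + of_real (q\<^sup>2) * t\<^sup>2 \<noteq> 0"
proof
  assume eq: "1 - of_real T * t + of_real (q\<^sup>2) * t\<^sup>2 = 0"
  then have t0: "t \<noteq> 0" by auto
  have q2: "q\<^sup>2 \<le> 1" using q by (simp add: abs_square_le_1)
  have n: "(Re t)\<^sup>2 + (Im t)\<^sup>2 < 1" using t by (metis cmod_power2 abs_square_less_1 abs_norm_cancel)
  have re: "1 - T * Re t + q\<^sup>2 * ((Re t)\<^sup>2 - (Im t)\<^sup>2) = 0"
    and im: "- T * Im t + q\<^sup>2 * (2 * Re t * Im t) = 0"
    using arg_cong[OF eq, of Re] arg_cong[OF eq, of Im] by (simp_all add: power2_eq_square)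
  show False
  proof (cases "Im t = 0")
    case True
    have r: "\<bar>Re t\<bar> < 1" using n True by (simp add: abs_square_less_1)
    have "T * Re t \<le> (1 + q\<^sup>2) * \<bar>Re t\<bar>"
      using mult_right_mono[OF T, of "\<bar>Re t\<bar>"] by (metis abs_ge_self abs_ge_zero abs_mult order_trans)
    moreover have "0 < (1 - \<bar>Re t\<bar>) * (1 - q\<^sup>2 * \<bar>Re t\<bar>)"
    proof (intro mult_pos_pos)
      have "q\<^sup>2 * \<bar>Re t\<bar> \<le> 1 * \<bar>Re t\<bar>" using q2 by (intro mult_right_mono) auto
      then show "0 < 1 - q\<^sup>2 * \<bar>Re t\<bar>" using r by simp
    qed (use r in simp)
    moreover have "(1 - \<bar>Re t\<bar>) * (1 - q\<^sup>2 * \<bar>Re t\<bar>) = 1 - (1 + q\<^sup>2) * \<bar>Re t\<bar> + q\<^sup>2 * (Re t)\<^sup>2"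
      by (simp add: algebra_simps power2_eq_square flip: abs_mult)
    ultimately show False using re True by simp
  next
    case False
    then have "T = 2 * q\<^sup>2 * Re t" using im by (simp add: field_simps)
    then have "q\<^sup>2 * ((Re t)\<^sup>2 + (Im t)\<^sup>2) = 1" using re by (simp add: algebra_simps power2_eq_square)
    moreover have "q\<^sup>2 * ((Re t)\<^sup>2 + (Im t)\<^sup>2) \<le> 1 * ((Re t)\<^sup>2 + (Im t)\<^sup>2)"
      using q2 by (intro mult_right_mono) auto
    ultimately show False using n by simp
  qed
qed

text \<open>The product \<open>p = k w\<close> solves \<open>p = x\<^sup>2 (a + b p) (c + d p)\<close>, whose discriminant has no zero
  in the disc; the root vanishing at \<open>x = 0\<close> is therefore holomorphic.\<close>

lemma branch_exists:
  assumes s: "0 < s" "s \<le> 2" and C: "\<bar>C\<bar> \<le> 1" and sC: "C = 1 \<Longrightarrow> s < 2"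
  obtains kf wf where "kf holomorphic_on ball 0 1" "wf holomorphic_on ball 0 1"
    "\<And>x. cmod x < 1 \<Longrightarrow> branch s C x (kf x) (wf x)"
    "\<And>x. cmod x < 1 \<Longrightarrow> cmod (kf x) \<le> cmod x"
proof -
  define a b c d where "a = complex_of_real (ca s C)" and "b = complex_of_real (cb s C)"
    and "c = complex_of_real (cc s C)" and "d = complex_of_real (cd s C)"
  note abcd = a_def b_def c_def d_def
  define q where "q = 1 - s"
  have q: "\<bar>q\<bar> \<le> 1" using s by (auto simp: q_def)
  have det: "a * d - b * c = of_real q"
    unfolding abcd coef_defs q_def by (simp flip: of_real_mult of_real_diff) (simp add: field_simps)
  \<comment> \<open>With \<open>t = x\<^sup>2\<close>, the quadratic for \<open>p\<close> has
    discriminant \<open>(1 - t (a d + b c))^2 - 4 t^2 a b c d = 1 - T t + q^2 t^2\<close>.\<close>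
  define T where "T = 2 * (ca s C * cd s C + cb s C * cc s C)"
  have T: "\<bar>T\<bar> \<le> 1 + q\<^sup>2"
  proof -
    have "1 + q\<^sup>2 - T = (s * C)\<^sup>2" "1 + q\<^sup>2 + T = (2 - s)\<^sup>2 + s\<^sup>2 * (1 - C\<^sup>2)"
      unfolding T_def q_def coef_defs by (simp_all add: field_simps power2_eq_square)
    moreover have "0 \<le> s\<^sup>2 * (1 - C\<^sup>2)" using C by (auto simp: abs_square_le_1)
    ultimately show ?thesis by (smt (verit) zero_le_power2)
  qed
  have Tc: "of_real T = 2 * (a * d + b * c)" unfolding T_def abcd by simp
  have x2: "cmod (x\<^sup>2) < 1" if "cmod x < 1" for x
    using that by (simp add: norm_power abs_square_less_1)
  have "\<exists>p. p holomorphic_on ball 0 1 \<and> p 0 = 0 \<and>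
     (\<forall>x. cmod x < 1 \<longrightarrow> p x = x\<^sup>2 * (a + b * p x) * (c + d * p x))"
  \<comment> \<open>In the degenerate case either \<open>b d = 0\<close> and the equation is linear,
    or \<open>a c = 0\<close> and \<open>p = 0\<close> solves it; one quotient covers both.\<close>
  proof (cases "a * b * c * d = 0")
    case True
    define N where "N = (\<lambda>x::complex. 1 - x\<^sup>2 * (a * d + b * c))"
    have ad: "a * d = 0 \<or> b * c = 0" using True by auto
    have small: "cmod (a * d + b * c) \<le> 1"
      using ad det q by (metis add.right_neutral add_0 diff_0 diff_zero norm_minus_cancel norm_of_real)
    have N0: "N x \<noteq> 0" if "cmod x < 1" for x
    proof
      assume "N x = 0"
      then have "cmod (x\<^sup>2 * (a * d + b * c)) = 1" by (simp add: N_def)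
      moreover have "cmod (x\<^sup>2 * (a * d + b * c)) \<le> cmod (x\<^sup>2) * 1"
        unfolding norm_mult by (intro mult_left_mono small) auto
      ultimately show False using x2[OF that] by simp
    qed
    define p where "p = (\<lambda>x. x\<^sup>2 * a * c / N x)"
    have "p holomorphic_on ball 0 1"
    proof -
      have "N holomorphic_on ball 0 1" unfolding N_def by (intro holomorphic_intros)
      then show ?thesis unfolding p_def by (intro holomorphic_on_divide holomorphic_intros) (simp_all add: N0)
    qed
    moreover have "p x = x\<^sup>2 * (a + b * p x) * (c + d * p x)" if "cmod x < 1" for x
    proof -
      have "p x * N x = x\<^sup>2 * a * c" using N0[OF that] by (simp add: p_def)
      moreover have "b * d * (p x)\<^sup>2 = 0" using True by (auto simp: p_def)
      ultimately show ?thesis unfolding N_def by algebra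
    qed
    moreover have "p 0 = 0" by (simp add: p_def)
    ultimately show ?thesis by blast
  next
    case False
    define disc where "disc = (\<lambda>x::complex. 1 - of_real T * x\<^sup>2 + of_real (q\<^sup>2) * (x\<^sup>2)\<^sup>2)"
    have "disc holomorphic_on ball 0 1" unfolding disc_def by (intro holomorphic_intros)
    moreover have "disc x \<noteq> 0" if "x \<in> ball 0 1" for x
      unfolding disc_def using bulk_discriminant_nonzero[OF T q x2[of x]] that by simp
    ultimately obtain S0 where S0: "S0 holomorphic_on ball 0 1"
      "\<And>x. x \<in> ball 0 1 \<Longrightarrow> disc x = (S0 x)\<^sup>2"
      using contractible_imp_holomorphic_sqrt[of disc, OF _ convex_imp_contractible[OF convex_ball]] by blast
    \<comment> \<open>Normalising the root to 1 at the origin picks the branch on which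
      \<open>p\<close> vanishes there.\<close>
    define S where "S = (\<lambda>x. S0 x / S0 0)"
    have "(S0 0)\<^sup>2 = 1" using S0(2)[of 0] by (simp add: disc_def)
    then have S00: "S0 0 \<noteq> 0" and sq: "\<And>x. (S x)\<^sup>2 = (S0 x)\<^sup>2" by (auto simp: S_def power_divide)
    have S: "S holomorphic_on ball 0 1" unfolding S_def by (intro holomorphic_intros S0) (simp add: S00)
    have S1: "S 0 = 1" using S00 by (simp add: S_def)
    define N where "N = (\<lambda>x::complex. 1 - x\<^sup>2 * (a * d + b * c) + S x)"
    have NN: "(S x)\<^sup>2 = (1 - x\<^sup>2 * (a * d + b * c))\<^sup>2 - 4 * x ^ 4 * (a * b * c * d)" if "cmod x < 1" for x
    proof -
      have "of_real (q\<^sup>2) = (a * d - b * c)\<^sup>2" by (simp add: det)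
      then have "(S x)\<^sup>2 = 1 - 2 * (a * d + b * c) * x\<^sup>2 + (a * d - b * c)\<^sup>2 * (x\<^sup>2)\<^sup>2"
        using S0(2)[of x] that unfolding sq disc_def Tc by simp
      then show ?thesis by algebra
    qed
    have N0: "N x \<noteq> 0" if "cmod x < 1" for x
    proof
      assume "N x = 0"
      then have "S x = - (1 - x\<^sup>2 * (a * d + b * c))" unfolding N_def by algebra
      then have "4 * x ^ 4 * (a * b * c * d) = 0" using NN[OF that] by (simp only: power2_minus) simp
      then have "x = 0" using False by simp
      then show False using \<open>N x = 0\<close> S1 by (simp add: N_def)
    qed
    \<comment> \<open>The quadratic formula with the square root moved to the denominator: it avoids
      dividing by the leading coefficient \<open>x\<^sup>2 b d\<close>.\<close>
    define p where "p = (\<lambda>x. 2 * x\<^sup>2 * a * c / N x)"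
    have "p holomorphic_on ball 0 1"
    proof -
      have "N holomorphic_on ball 0 1" unfolding N_def by (intro holomorphic_intros S)
      then show ?thesis unfolding p_def by (intro holomorphic_on_divide holomorphic_intros) (simp_all add: N0)
    qed
    moreover have "p x = x\<^sup>2 * (a + b * p x) * (c + d * p x)" if "cmod x < 1" for x
    proof -
      have p: "p x * N x = 2 * x\<^sup>2 * a * c" using N0[OF that] by (simp add: p_def)
      define n y u where "n = N x" and "y = x\<^sup>2" and "u = 1 - y * (a * d + b * c)"
      have n: "p x * n = 2 * y * a * c" using p by (simp add: n_def y_def)
      have "n * (2 * u - n) = 4 * y\<^sup>2 * (a * b * c * d)"
        using NN[OF that] unfolding n_def N_def u_def y_def by (simp add: algebra_simps power2_eq_square power4_eq_xxxx)
      moreover have "(p x - y * (a + b * p x) * (c + d * p x)) * n\<^sup>2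
          = y * a * c * (n * (2 * u - n) - 4 * y\<^sup>2 * (a * b * c * d))"
      proof -
        have "p x - y * (a + b * p x) * (c + d * p x) = u * p x - y * a * c - y * b * d * (p x)\<^sup>2"
          unfolding u_def by (simp add: algebra_simps power2_eq_square)
        moreover have "(u * p x - y * a * c - y * b * d * (p x)\<^sup>2) * n\<^sup>2
            = u * (p x * n) * n - y * a * c * n\<^sup>2 - y * b * d * (p x * n)\<^sup>2"
          by (simp add: algebra_simps power2_eq_square)
        ultimately have "(p x - y * (a + b * p x) * (c + d * p x)) * n\<^sup>2
            = u * (p x * n) * n - y * a * c * n\<^sup>2 - y * b * d * (p x * n)\<^sup>2" by simp
        then show ?thesis unfolding n by (simp add: algebra_simps power2_eq_square)
      qed
      ultimately have "(p x - y * (a + b * p x) * (c + d * p x)) * n\<^sup>2 = 0" by simp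
      then show ?thesis using N0[OF that] by (simp add: n_def y_def)
    qed
    moreover have "p 0 = 0" by (simp add: p_def)
    ultimately show ?thesis by blast
  qed
  then obtain p where p: "p holomorphic_on ball 0 1" "p 0 = 0"
    "\<And>x. cmod x < 1 \<Longrightarrow> p x = x\<^sup>2 * (a + b * p x) * (c + d * p x)" by blast
  define kf wf where "kf = (\<lambda>x. x * (a + b * p x))" and "wf = (\<lambda>x. x * (c + d * p x))"
  have hol: "kf holomorphic_on ball 0 1" "wf holomorphic_on ball 0 1"
    unfolding kf_def wf_def by (intro holomorphic_intros p)+
  have br: "branch s C x (kf x) (wf x)" if "cmod x < 1" for x
  proof -
    have "kf x * wf x = p x" using p(3)[OF that] by (simp add: kf_def wf_def power2_eq_square mult_ac)
    then show ?thesis unfolding branch_def abcd[symmetric] by (simp add: kf_def wf_def)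
  qed
  \<comment> \<open>If \<open>|x k|\<close> reached 1, by connectedness it would equal 1 at some
    \<open>y\<close> in the disc. At equality the energy still gives
    \<open>|k| \<le> |y| < 1\<close>, a contradiction.\<close>
  have xk: "cmod (x * kf x) < 1" if x: "cmod x < 1" for x
  proof (rule ccontr)
    assume "\<not> cmod (x * kf x) < 1"
    moreover have "connected ((\<lambda>x. cmod (x * kf x)) ` ball 0 1)"
      by (intro connected_continuous_image continuous_intros holomorphic_on_imp_continuous_on hol) auto
    moreover have "0 \<in> (\<lambda>x. cmod (x * kf x)) ` ball 0 1" by (rule image_eqI[of _ _ 0]) auto
    moreover have "cmod (x * kf x) \<in> (\<lambda>x. cmod (x * kf x)) ` ball 0 1" using x by (intro imageI) simp
    ultimately have "1 \<in> (\<lambda>x. cmod (x * kf x)) ` ball 0 1"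
      using connectedD_interval[of _ 0 "cmod (x * kf x)" 1] by simp
    then obtain y where y: "cmod y < 1" "cmod (y * kf y) = 1" by auto
    show False
    \<comment> \<open>The energy is silent on \<open>k\<close> here; instead \<open>cc = 0\<close>
      and \<open>|cd| < 1\<close>, which holds as \<open>s < 2\<close>, force \<open>w = 0\<close>
      at \<open>y\<close>.\<close>
    proof (cases "C = 1")
      case True
      then have "c = 0" by (simp add: abcd cc_def)
      have "\<bar>cd s C\<bar> < 1" using s sC[OF True] True by (auto simp: cd_def)
      then have "cmod (y * kf y * d) < 1" using y(2) by (simp add: norm_mult abcd)
      then have "1 - y * kf y * d \<noteq> 0" by auto
      moreover have "wf y * (1 - y * kf y * d) = 0"
        using br[OF y(1)] \<open>c = 0\<close> unfolding branch_def abcd[symmetric] by algebra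
      ultimately have "wf y = 0" by simp
      then have "kf y = y" using br[OF y(1)] True by (simp add: branch_def ca_def)
      then show False using y x2[OF y(1)] by (simp add: power2_eq_square)
    next
      case False
      have "(1 + C) * (cmod (wf y))\<^sup>2 * (1 - (cmod (y * kf y))\<^sup>2) \<le> (1 - C) * ((cmod y)\<^sup>2 - (cmod (kf y))\<^sup>2)"
        using branch_energy[OF _ s(2) br[OF y(1)]] s by (simp add: norm_mult power_mult_distrib algebra_simps)
      then have "0 \<le> (cmod y)\<^sup>2 - (cmod (kf y))\<^sup>2" using False C y(2) by (auto simp: zero_le_mult_iff)
      then have "cmod (kf y) \<le> cmod y" using power2_le_imp_le[of "cmod (kf y)" "cmod y"] by auto
      then have "cmod (y * kf y) \<le> cmod y * cmod y" unfolding norm_mult by (rule mult_left_mono) simp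
      also have "\<dots> < 1" using x2[OF y(1)] by (simp add: power2_eq_square norm_mult)
      finally show False using y(2) by simp
    qed
  qed
  show thesis
  proof (rule that[OF hol br])
    show "cmod (kf x) \<le> cmod x" if "cmod x < 1" for x
      using branch_k_le[OF s C br[OF that] _ xk[OF that]] that by simp
  qed auto
qed

section \<open>Power series in the unit disc and the exact solution\<close>

text \<open>Links coefficients, on which the time steps act, with values in the disc, where the
  bounds live.\<close>

definition disc_fps :: "complex fps \<Rightarrow> (complex \<Rightarrow> complex) \<Rightarrow> bool" where
  "disc_fps F f \<longleftrightarrow> 1 \<le> fps_conv_radius F \<and> (\<forall>x. cmod x < 1 \<longrightarrow> eval_fps F x = f x)"

lemma disc_fps_radius: "disc_fps F f \<Longrightarrow> cmod x < 1 \<Longrightarrow> ereal (cmod x) < fps_conv_radius F"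
  unfolding disc_fps_def by (metis less_le_trans ereal_less(3) one_ereal_def less_ereal.simps(1))

lemma disc_fps_eval: "disc_fps F f \<Longrightarrow> cmod x < 1 \<Longrightarrow> eval_fps F x = f x"
  by (simp add: disc_fps_def)

lemma disc_fps_const: "disc_fps (fps_const c) (\<lambda>x. c)"
  by (simp add: disc_fps_def)

lemma disc_fps_X: "disc_fps fps_X (\<lambda>x. x)"
  by (simp add: disc_fps_def)

lemma disc_fps_1: "disc_fps 1 (\<lambda>x. 1)"
  by (simp add: disc_fps_def)

lemma disc_fps_add: "disc_fps F f \<Longrightarrow> disc_fps G g \<Longrightarrow> disc_fps (F + G) (\<lambda>x. f x + g x)"
  using disc_fps_radius[of F f] disc_fps_radius[of G g] fps_conv_radius_add[of F G]
  by (auto simp: disc_fps_def eval_fps_add min_def split: if_splits)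

lemma disc_fps_diff: "disc_fps F f \<Longrightarrow> disc_fps G g \<Longrightarrow> disc_fps (F - G) (\<lambda>x. f x - g x)"
  using disc_fps_radius[of F f] disc_fps_radius[of G g] fps_conv_radius_diff[of F G]
  by (auto simp: disc_fps_def eval_fps_diff min_def split: if_splits)

lemma disc_fps_mult: "disc_fps F f \<Longrightarrow> disc_fps G g \<Longrightarrow> disc_fps (F * G) (\<lambda>x. f x * g x)"
  using disc_fps_radius[of F f] disc_fps_radius[of G g] fps_conv_radius_mult[of F G]
  by (auto simp: disc_fps_def eval_fps_mult min_def split: if_splits)

lemma disc_fps_power: "disc_fps F f \<Longrightarrow> disc_fps (F ^ n) (\<lambda>x. f x ^ n)"
  by (induction n) (auto intro: disc_fps_1 disc_fps_mult)

lemma disc_fps_sum: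
  "(\<And>i. i \<in> I \<Longrightarrow> disc_fps (F i) (f i)) \<Longrightarrow> disc_fps (\<Sum>i\<in>I. F i) (\<lambda>x. \<Sum>i\<in>I. f i x)"
proof (induction I rule: infinite_finite_induct)
  case (insert i I)
  then show ?case by (simp add: disc_fps_add)
qed (auto simp: disc_fps_def)

lemma disc_fps_inverse:
  assumes F: "disc_fps F f" and nz: "\<And>x. cmod x < 1 \<Longrightarrow> f x \<noteq> 0"
  shows "disc_fps (inverse F) (\<lambda>x. inverse (f x))"
proof -
  have nz': "eval_fps F z \<noteq> 0" if "ereal (cmod z) < 1" for z
    using disc_fps_eval[OF F] nz that by (simp add: one_ereal_def)
  have r: "1 \<le> fps_conv_radius F" using F by (simp add: disc_fps_def)
  show ?thesis
    using fps_conv_radius_inverse[of 1 F, OF nz'] eval_fps_inverse[of 1 F, OF nz'] r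
      disc_fps_radius[OF F] disc_fps_eval[OF F]
    by (auto simp: disc_fps_def min_def one_ereal_def split: if_splits)
qed

lemma disc_fps_unique:
  assumes "disc_fps F f" "disc_fps G f"
  shows "F = G"
proof (rule eval_fps_eqD)
  show "0 < fps_conv_radius F" "0 < fps_conv_radius G"
    using assms by (auto simp: disc_fps_def intro: less_le_trans[of _ 1])
  have "eventually (\<lambda>x::complex. x \<in> ball 0 1) (nhds 0)"
    by (intro eventually_nhds_in_open) auto
  then show "eventually (\<lambda>x. eval_fps F x = eval_fps G x) (nhds 0)"
    by eventually_elim (use assms in \<open>simp add: disc_fps_def\<close>)
qed

lemma disc_fps_expansion:
  assumes "f holomorphic_on ball 0 1"
  shows "disc_fps (fps_expansion f 0) f"
proof -
  have "f holomorphic_on eball 0 1" using assms by (simp add: one_ereal_def)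
  from conv_radius_fps_expansion[OF this] eval_fps_expansion'[OF this]
  show ?thesis by (auto simp: disc_fps_def one_ereal_def)
qed

lemmas disc_fps_intros = disc_fps_const disc_fps_X disc_fps_1 disc_fps_add disc_fps_diff
  disc_fps_mult disc_fps_power disc_fps_sum

definition branch_fps :: "real \<Rightarrow> real \<Rightarrow> complex fps \<Rightarrow> complex fps \<Rightarrow> bool" where
  "branch_fps s C K W \<longleftrightarrow>
     K = fps_X * (fps_const (of_real (ca s C)) + fps_const (of_real (cb s C)) * (K * W)) \<and>
     W = fps_X * (fps_const (of_real (cc s C)) + fps_const (of_real (cd s C)) * (K * W))"

text \<open>The branch equations hold as functions on the disc; uniqueness of power series lifts
  them to coefficients.\<close>

lemma branch_fps_exists:
  assumes s: "0 < s" "s \<le> 2" and C: "\<bar>C\<bar> \<le> 1" and sC: "C = 1 \<Longrightarrow> s < 2"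
  obtains kf wf K W where "disc_fps K kf" "disc_fps W wf" "branch_fps s C K W"
    "\<And>x. cmod x < 1 \<Longrightarrow> branch s C x (kf x) (wf x)"
    "\<And>x. cmod x < 1 \<Longrightarrow> cmod (kf x) \<le> cmod x"
proof -
  obtain kf wf where f: "kf holomorphic_on ball 0 1" "wf holomorphic_on ball 0 1"
    and br: "\<And>x. cmod x < 1 \<Longrightarrow> branch s C x (kf x) (wf x)"
    and le: "\<And>x. cmod x < 1 \<Longrightarrow> cmod (kf x) \<le> cmod x"
    using branch_exists[OF s C sC] by metis
  define K W where "K = fps_expansion kf 0" and "W = fps_expansion wf 0"
  have K: "disc_fps K kf" and W: "disc_fps W wf"
    unfolding K_def W_def by (intro disc_fps_expansion f)+
  have "disc_fps (fps_X * (fps_const (of_real p) + fps_const (of_real q) * (K * W)))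
     (\<lambda>x. x * (of_real p + of_real q * (kf x * wf x)))" for p q
    by (intro disc_fps_intros K W)
  moreover have "disc_fps K (\<lambda>x. x * (of_real (ca s C) + of_real (cb s C) * (kf x * wf x)))"
    "disc_fps W (\<lambda>x. x * (of_real (cc s C) + of_real (cd s C) * (kf x * wf x)))"
    using K W br unfolding disc_fps_def branch_def by auto
  ultimately have "branch_fps s C K W" unfolding branch_fps_def using disc_fps_unique by blast
  then show thesis using that[OF K W _ br le] by blast
qed

section \<open>Boundary conditions as finite linear forms, and the exact solution\<close>

fun gcoef1 :: "bc \<Rightarrow> real \<Rightarrow> nat \<Rightarrow> real" where
  "gcoef1 (Extrapolation \<sigma>) C j = (-1) ^ j * of_nat (\<sigma> choose (j + 1))"
| "gcoef1 (ExtrapolatedEquilibrium \<sigma>) C j = (1 + C) / 2 * ((-1) ^ j * of_nat (\<sigma> choose (j + 1)))"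
| "gcoef1 Future C j = (if j = 0 then (1 + C) / 2 else 0)"
| "gcoef1 Invented C j = (if j = 0 then 1 else 0)"
| "gcoef1 _ C j = 0"

fun gcoef2 :: "bc \<Rightarrow> real \<Rightarrow> nat \<Rightarrow> real" where
  "gcoef2 BounceBack C j = (if j = 0 then 1 else 0)"
| "gcoef2 AntiBounceBack C j = (if j = 0 then -1 else 0)"
| "gcoef2 TwoStepsAntiBounceBack C j = (if j = 1 then -1 else 0)"
| "gcoef2 (ExtrapolatedEquilibrium \<sigma>) C j = (1 + C) / 2 * ((-1) ^ j * of_nat (\<sigma> choose (j + 1)))"
| "gcoef2 Future C j = (if j = 2 then (1 + C) / 2 else 0)"
| "gcoef2 Invented C j = (if j = 0 then 2 else 0)"
| "gcoef2 _ C j = 0"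

text \<open>Width 3 reaches cell 2, the farthest cell read by \<open>Future\<close>.\<close>

fun gwidth :: "bc \<Rightarrow> nat" where
  "gwidth (Extrapolation \<sigma>) = \<sigma>"
| "gwidth (ExtrapolatedEquilibrium \<sigma>) = \<sigma>"
| "gwidth _ = 3"

lemma ghost_sum:
  fixes fs :: "nat \<Rightarrow> 'a::real_field \<times> 'a"
  shows "ghost b C fs = (\<Sum>j<gwidth b. of_real (gcoef1 b C j) * fst (fs j) + of_real (gcoef2 b C j) * snd (fs j))"
  by (cases b) (simp_all add: eval_nat_numeral sum_distrib_left distrib_left mult.assoc)

text \<open>The ghost value returned by the mode whose own ghost value is 1. The homogeneous
  boundary condition is therefore \<open>bsym = 1\<close>.\<close>

definition bsym :: "bc \<Rightarrow> real \<Rightarrow> complex \<Rightarrow> complex \<Rightarrow> complex" where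
  "bsym b C k w = ghost b C (\<lambda>j. (k ^ Suc j, k ^ j * w))"

definition bsym_fps :: "bc \<Rightarrow> real \<Rightarrow> complex fps \<Rightarrow> complex fps \<Rightarrow> complex fps" where
  "bsym_fps b C K W = (\<Sum>j<gwidth b. fps_const (of_real (gcoef1 b C j)) * K ^ Suc j
      + fps_const (of_real (gcoef2 b C j)) * (K ^ j * W))"

lemma disc_fps_bsym:
  "disc_fps K kf \<Longrightarrow> disc_fps W vf \<Longrightarrow> disc_fps (bsym_fps b C K W) (\<lambda>x. bsym b C (kf x) (vf x))"
  unfolding bsym_fps_def bsym_def ghost_sum fst_conv snd_conv by (intro disc_fps_intros)

text \<open>\<open>H\<close> is the generating function of the ghost value with source, hence the
  fixed point equation. In the induction the branch equations turn states before collision into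
  states after it, and transport is the shift by \<open>fps_X\<close>.\<close>

lemma sol_fps:
  assumes br: "branch_fps s C K W"
    and H: "H = bsym_fps b C K W * H + Abs_fps (\<lambda>n. of_real (g n))"
  shows "of_real (fst (sol s C b g n j)) = fps_nth (fps_X * H * K ^ j) n \<and>
         of_real (snd (sol s C b g n j)) = fps_nth (fps_X * H * K ^ Suc j * W) n"
proof (induction n arbitrary: j)
  case 0
  then show ?case by (simp add: mult.assoc)
next
  case (Suc n)
  let ?fs = "\<lambda>k. relax s C (sol s C b g n k)"
  have coll: "of_real (fst (?fs k)) = fps_nth (H * K ^ Suc k) n"
      "of_real (snd (?fs k)) = fps_nth (H * K ^ k * W) n" for k
  proof -
    define P where "P = K * W"
    have K: "K = fps_X * (fps_const (of_real (ca s C)) + fps_const (of_real (cb s C)) * P)"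
      and W: "W = fps_X * (fps_const (of_real (cc s C)) + fps_const (of_real (cd s C)) * P)"
      using br unfolding branch_fps_def P_def by blast+
    have "H * K ^ Suc k = fps_const (of_real (ca s C)) * (fps_X * H * K ^ k)
        + fps_const (of_real (cb s C)) * (fps_X * H * K ^ Suc k * W)"
    proof -
      have "H * K ^ Suc k = H * K ^ k * K" by (simp add: mult_ac)
      also have "\<dots> = H * K ^ k * (fps_X * (fps_const (of_real (ca s C)) + fps_const (of_real (cb s C)) * P))"
        by (rule arg_cong[where f = "\<lambda>z. H * K ^ k * z", OF K])
      finally have e: "H * K ^ Suc k = \<dots>" .
      show ?thesis unfolding e unfolding P_def by (simp add: algebra_simps)
    qed
    then show "of_real (fst (?fs k)) = fps_nth (H * K ^ Suc k) n"
      using Suc[of k] by (simp add: relax_eq)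
    have "H * K ^ k * W = fps_const (of_real (cc s C)) * (fps_X * H * K ^ k)
        + fps_const (of_real (cd s C)) * (fps_X * H * K ^ Suc k * W)"
    proof -
      have e: "H * K ^ k * W = H * K ^ k * (fps_X * (fps_const (of_real (cc s C)) + fps_const (of_real (cd s C)) * P))"
        by (rule arg_cong[where f = "\<lambda>z. H * K ^ k * z", OF W])
      show ?thesis unfolding e unfolding P_def by (simp add: algebra_simps)
    qed
    then show "of_real (snd (?fs k)) = fps_nth (H * K ^ k * W) n"
      using Suc[of k] by (simp add: relax_eq)
  qed
  have Xm: "fps_nth (fps_X * A) (Suc n) = fps_nth A n" for A :: "complex fps" by simp
  \<comment> \<open>The fixed point equation is used only here, at the wall.\<close>
  have "of_real (ghost b C ?fs + g n) = fps_nth H n"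
  proof -
    have "of_real (ghost b C ?fs) = (\<Sum>j<gwidth b. of_real (gcoef1 b C j) * fps_nth (H * K ^ Suc j) n
        + of_real (gcoef2 b C j) * fps_nth (H * K ^ j * W) n)"
      unfolding ghost_sum by (simp only: of_real_eq_id id_apply of_real_sum of_real_add of_real_mult coll)
    also have "\<dots> = fps_nth (bsym_fps b C K W * H) n"
      unfolding bsym_fps_def sum_distrib_right fps_sum_nth
      by (intro sum.cong refl) (simp add: distrib_left distrib_right mult_ac flip: fps_mult_left_const_nth)
    finally show ?thesis by (subst H) simp
  qed
  moreover have "of_real (snd (?fs (Suc j))) = fps_nth (fps_X * H * K ^ Suc j * W) (Suc n)"
    unfolding mult.assoc Xm coll by (simp add: mult_ac)
  moreover have "of_real (fst (?fs (j - 1))) = fps_nth (fps_X * H * K ^ j) (Suc n)" if "j \<noteq> 0"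
    using that unfolding mult.assoc Xm coll by (cases j) simp_all
  ultimately show ?case by (auto simp: step_def Let_def mult.assoc)
qed

section \<open>Parseval on circles by sampling at roots of unity\<close>

lemma sum_root_of_unity_powers:
  fixes d :: int
  assumes N: "0 < N" and d: "\<bar>d\<bar> < int N"
  shows "(\<Sum>k<N. cis (2 * pi * of_int d * real k / real N)) = (if d = 0 then of_nat N else 0)"
proof (cases "d = 0")
  case False
  define z where "z = cis (2 * pi * of_int d / real N)"
  have pw: "cis (2 * pi * of_int d * real k / real N) = z ^ k" for k
    unfolding z_def Complex.DeMoivre by (simp add: mult_ac)
  have "z \<noteq> 1"
  proof
    assume "z = 1"
    then obtain m :: int where "2 * pi * of_int d / real N = of_int m * (2 * pi)"
      unfolding z_def cis_conv_exp exp_eq_1 by auto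
    then have "of_int d = of_int m * real N" using N by (simp add: field_simps)
    then have "d = m * int N" by (metis of_int_eq_iff of_int_mult of_int_of_nat_eq)
    then have "\<bar>m\<bar> * int N < 1 * int N" using d N by (simp add: abs_mult)
    then have "m = 0" using N by (simp add: mult_less_cancel_right_pos)
    then show False using \<open>d = m * int N\<close> False by simp
  qed
  moreover have "z ^ N = 1" unfolding pw[symmetric] using N by (simp add: cis_multiple_2pi)
  ultimately show ?thesis using False by (simp add: pw geometric_sum)
qed simp

definition circle_pt :: "real \<Rightarrow> nat \<Rightarrow> nat \<Rightarrow> complex" where
  "circle_pt r N k = of_real r * cis (2 * pi * real k / real N)"

text \<open>Sampling at \<open>N\<close> equispaced points is exact below degree \<open>N\<close>,
  since index differences then stay below \<open>N\<close> in modulus and only the diagonal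
  survives.\<close>

lemma discrete_parseval:
  assumes N: "0 < N"
  shows "(\<Sum>k<N. (cmod (\<Sum>n<N. f n * circle_pt r N k ^ n))\<^sup>2) = real N * (\<Sum>n<N. (cmod (f n))\<^sup>2 * r ^ (2 * n))"
proof -
  define u where "u = (\<lambda>n. f n * of_real r ^ n)"
  have t: "f n * circle_pt r N k ^ n = u n * cis (2 * pi * real n * real k / real N)" for n k
    unfolding circle_pt_def u_def power_mult_distrib Complex.DeMoivre by (simp add: mult_ac)
  have "of_real (\<Sum>k<N. (cmod (\<Sum>n<N. f n * circle_pt r N k ^ n))\<^sup>2)
      = (\<Sum>k<N. (\<Sum>n<N. u n * cis (2 * pi * real n * real k / real N)) *
          cnj (\<Sum>n<N. u n * cis (2 * pi * real n * real k / real N)))"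
    unfolding t of_real_sum by (intro sum.cong refl complex_norm_square)
  also have "\<dots> = (\<Sum>k<N. \<Sum>n<N. \<Sum>m<N. u n * cnj (u m) *
      cis (2 * pi * of_int (int n - int m) * real k / real N))"
    unfolding cnj_sum sum_product
    by (intro sum.cong refl) (simp add: cis_cnj cis_mult algebra_simps diff_divide_distrib add_divide_distrib mult.left_commute)
  also have "\<dots> = (\<Sum>n<N. \<Sum>m<N. u n * cnj (u m) *
      (\<Sum>k<N. cis (2 * pi * of_int (int n - int m) * real k / real N)))"
    unfolding sum_distrib_left by (subst sum.swap, rule sum.cong[OF refl], rule sum.swap)
  also have "\<dots> = (\<Sum>n<N. \<Sum>m<N. if n = m then of_nat N * (u n * cnj (u n)) else 0)"
    by (intro sum.cong refl, subst sum_root_of_unity_powers[OF N]) auto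
  also have "\<dots> = of_real (real N * (\<Sum>n<N. (cmod (u n))\<^sup>2))"
    by (simp add: sum_distrib_left flip: complex_norm_square)
  finally have "(\<Sum>k<N. (cmod (\<Sum>n<N. f n * circle_pt r N k ^ n))\<^sup>2) = real N * (\<Sum>n<N. (cmod (u n))\<^sup>2)"
    by (simp only: of_real_eq_iff)
  moreover have "(\<bar>r\<bar> ^ n)\<^sup>2 = r ^ (2 * n)" for n
    by (metis power_mult power2_abs power_abs mult.commute)
  ultimately show ?thesis
    by (simp add: u_def norm_mult norm_power power_mult_distrib)
qed

text \<open>The multiplier theorem in a weighted l2 space. The pointwise bound is on the sum over
  \<open>j\<close>, so the sum over cells is obtained along with the sum over time. Since
  \<open>disc_fps\<close> gives only power series, the product is truncated at degree
  \<open>N\<close>, treated by \<open>discrete_parseval\<close>, and \<open>N\<close> tends to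
  infinity.\<close>

lemma fps_multiplier_bound:
  fixes \<Phi> :: "nat \<Rightarrow> complex fps"
  assumes \<Phi>: "\<And>j. j < J \<Longrightarrow> disc_fps (\<Phi> j) (\<phi> j)" and r: "0 < r" "r < 1"
    and G: "\<And>n. N0 \<le> n \<Longrightarrow> fps_nth G n = 0"
    and bound: "\<And>x. cmod x = r \<Longrightarrow> (\<Sum>j<J. (cmod (\<phi> j x))\<^sup>2) \<le> S"
  shows "(\<Sum>j<J. \<Sum>n<N1. (cmod (fps_nth (\<Phi> j * G) n))\<^sup>2 * r ^ (2 * n))
     \<le> S * (\<Sum>n<N0. (cmod (fps_nth G n))\<^sup>2 * r ^ (2 * n))"
proof -
  define g where "g = (\<lambda>x. \<Sum>n<N0. fps_nth G n * x ^ n)"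
  have Gsum: "G = (\<Sum>n<N0. fps_const (fps_nth G n) * fps_X ^ n)"
  proof (rule fps_ext)
    fix i
    have "(\<Sum>n<N0. fps_nth (fps_const (fps_nth G n) * fps_X ^ n) i) = (\<Sum>n<N0. if n = i then fps_nth G i else 0)"
      by (intro sum.cong refl) (simp add: fps_X_power_nth)
    also have "\<dots> = fps_nth G i" using G[of i] by auto
    finally show "fps_nth G i = fps_nth (\<Sum>n<N0. fps_const (fps_nth G n) * fps_X ^ n) i"
      by (simp add: fps_sum_nth)
  qed
  have "disc_fps (\<Sum>n<N0. fps_const (fps_nth G n) * fps_X ^ n) g"
    unfolding g_def by (intro disc_fps_intros)
  then have dG: "disc_fps G g" using Gsum by simp
  define M where "M = (\<lambda>j. \<Phi> j * G)"
  \<comment> \<open>\<open>A j\<close> bounds the product on the circle and \<open>e j N\<close>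
    bounds its tail, so truncation changes the squared modulus by at most
    \<open>e (2 A + e)\<close>, uniformly over the sample points.\<close>
  define a where "a = (\<lambda>j n. cmod (fps_nth (M j) n) * r ^ n)"
  define A where "A = (\<lambda>j. \<Sum>n. a j n)"
  define e where "e = (\<lambda>j N. A j - (\<Sum>n<N. a j n))"
  have dM: "disc_fps (M j) (\<lambda>x. \<phi> j x * g x)" if "j < J" for j
    unfolding M_def by (intro disc_fps_mult \<Phi> dG that)
  have sa: "summable (a j)" if "j < J" for j
  proof -
    have "cmod (of_real r) < 1" using r by simp
    from norm_summable_fps[OF disc_fps_radius[OF dM[OF that] this]] show ?thesis
      using r by (simp add: a_def norm_mult norm_power)
  qed
  have e_lim: "(\<lambda>N. \<Sum>j<J. e j N * (2 * A j + e j N)) \<longlonglongrightarrow> (\<Sum>j<J. 0 * (2 * A j + 0))"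
  proof (intro tendsto_sum tendsto_mult tendsto_add tendsto_const)
    fix j assume "j \<in> {..<J}"
    then have "(\<lambda>N. \<Sum>n<N. a j n) \<longlonglongrightarrow> A j" unfolding A_def by (intro summable_LIMSEQ sa) auto
    then show "e j \<longlonglongrightarrow> 0" unfolding e_def using tendsto_diff[OF tendsto_const[of "A j"]] by fastforce
    then show "e j \<longlonglongrightarrow> 0" .
  qed
  have key: "(\<Sum>j<J. \<Sum>n<N. (a j n)\<^sup>2) \<le> S * (\<Sum>n<N0. (cmod (fps_nth G n))\<^sup>2 * r ^ (2 * n))
      + (\<Sum>j<J. e j N * (2 * A j + e j N))" if N: "N0 \<le> N" "0 < N" for N
  proof -
    let ?x = "circle_pt r N"
    have nx: "cmod (?x k) = r" for k using r by (simp add: circle_pt_def norm_mult)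
    have ptw: "(cmod (\<Sum>n<N. fps_nth (M j) n * ?x k ^ n))\<^sup>2
        \<le> (cmod (\<phi> j (?x k) * g (?x k)))\<^sup>2 + e j N * (2 * A j + e j N)" if j: "j < J" for j k
    proof -
      let ?P = "\<Sum>n<N. fps_nth (M j) n * ?x k ^ n" and ?v = "\<phi> j (?x k) * g (?x k)"
      have x1: "cmod (?x k) < 1" using nx r by simp
      have na: "cmod (fps_nth (M j) n * ?x k ^ n) = a j n" for n
        by (simp add: norm_mult norm_power nx a_def)
      have sv: "(\<lambda>n. fps_nth (M j) n * ?x k ^ n) sums ?v"
        using sums_eval_fps[OF disc_fps_radius[OF dM[OF j] x1]] disc_fps_eval[OF dM[OF j] x1] by simp
      have v: "?v = (\<Sum>n. fps_nth (M j) n * ?x k ^ n)" using sv by (simp add: sums_iff)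
      have "cmod ?v \<le> A j" unfolding v A_def
        using summable_norm[of "\<lambda>n. fps_nth (M j) n * ?x k ^ n"] sa[OF j] unfolding na by simp
      have tail: "?v - ?P = (\<Sum>n. fps_nth (M j) (n + N) * ?x k ^ (n + N))"
        unfolding v by (subst suminf_split_initial_segment[of _ N]) (use sv in \<open>auto simp: sums_iff\<close>)
      have "cmod (?v - ?P) \<le> (\<Sum>n. a j (n + N))"
        unfolding tail using summable_norm[of "\<lambda>n. fps_nth (M j) (n + N) * ?x k ^ (n + N)"]
          summable_ignore_initial_segment[OF sa[OF j], of N] unfolding na by simp
      also have "\<dots> = e j N" unfolding e_def A_def
        by (subst suminf_split_initial_segment[OF sa[OF j], of N]) simp
      finally have d: "cmod (?v - ?P) \<le> e j N" .
      have "cmod ?P \<le> cmod ?v + e j N" using d norm_triangle_ineq4[of ?v "?v - ?P"] by simp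
      then have "(cmod ?P)\<^sup>2 \<le> (cmod ?v + e j N)\<^sup>2" by (intro power_mono) auto
      also have "\<dots> = (cmod ?v)\<^sup>2 + e j N * (2 * cmod ?v + e j N)"
        by (simp add: power2_eq_square algebra_simps)
      also have "\<dots> \<le> (cmod ?v)\<^sup>2 + e j N * (2 * A j + e j N)"
        using \<open>cmod ?v \<le> A j\<close> d by (intro add_mono mult_left_mono) (auto intro: order_trans[OF norm_ge_zero])
      finally show ?thesis .
    qed
    have "real N * (\<Sum>j<J. \<Sum>n<N. (a j n)\<^sup>2)
        = (\<Sum>j<J. \<Sum>k<N. (cmod (\<Sum>n<N. fps_nth (M j) n * ?x k ^ n))\<^sup>2)"
      unfolding discrete_parseval[OF N(2)]
      by (simp add: sum_distrib_left a_def power_mult_distrib power_mult mult.commute)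
    also have "\<dots> \<le> (\<Sum>j<J. \<Sum>k<N. (cmod (\<phi> j (?x k) * g (?x k)))\<^sup>2 + e j N * (2 * A j + e j N))"
      by (intro sum_mono ptw) auto
    also have "\<dots> = (\<Sum>k<N. (\<Sum>j<J. (cmod (\<phi> j (?x k)))\<^sup>2) * (cmod (g (?x k)))\<^sup>2)
        + real N * (\<Sum>j<J. e j N * (2 * A j + e j N))"
      unfolding sum.distrib
      by (subst sum.swap) (simp add: norm_mult power_mult_distrib sum_distrib_left sum_distrib_right)
    also have "(\<Sum>k<N. (\<Sum>j<J. (cmod (\<phi> j (?x k)))\<^sup>2) * (cmod (g (?x k)))\<^sup>2)
        \<le> (\<Sum>k<N. S * (cmod (g (?x k)))\<^sup>2)"
      by (intro sum_mono mult_right_mono bound nx) auto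
    also have "\<dots> = real N * (S * (\<Sum>n<N0. (cmod (fps_nth G n))\<^sup>2 * r ^ (2 * n)))"
    proof -
      have g: "g x = (\<Sum>n<N. fps_nth G n * x ^ n)" for x
        unfolding g_def using N G by (intro sum.mono_neutral_left) auto
      have "(\<Sum>n<N. (cmod (fps_nth G n))\<^sup>2 * r ^ (2 * n)) = (\<Sum>n<N0. (cmod (fps_nth G n))\<^sup>2 * r ^ (2 * n))"
        using N G by (intro sum.mono_neutral_right) auto
      then show ?thesis unfolding g sum_distrib_left[symmetric] discrete_parseval[OF N(2)] by simp
    qed
    finally have "real N * (\<Sum>j<J. \<Sum>n<N. (a j n)\<^sup>2) \<le> real N *
      (S * (\<Sum>n<N0. (cmod (fps_nth G n))\<^sup>2 * r ^ (2 * n)) + (\<Sum>j<J. e j N * (2 * A j + e j N)))"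
      by (simp add: distrib_left)
    then show ?thesis using N(2) by simp
  qed
  have "(\<Sum>j<J. \<Sum>n<N1. (a j n)\<^sup>2) \<le> S * (\<Sum>n<N0. (cmod (fps_nth G n))\<^sup>2 * r ^ (2 * n))
      + (\<Sum>j<J. 0 * (2 * A j + 0))"
  proof (rule tendsto_lowerbound[OF tendsto_add[OF tendsto_const e_lim]])
    show "eventually (\<lambda>N. (\<Sum>j<J. \<Sum>n<N1. (a j n)\<^sup>2) \<le>
        S * (\<Sum>n<N0. (cmod (fps_nth G n))\<^sup>2 * r ^ (2 * n)) + (\<Sum>j<J. e j N * (2 * A j + e j N))) sequentially"
      using eventually_ge_at_top[of "max (Suc N0) N1"]
    proof eventually_elim
      case (elim N)
      have "(\<Sum>j<J. \<Sum>n<N1. (a j n)\<^sup>2) \<le> (\<Sum>j<J. \<Sum>n<N. (a j n)\<^sup>2)"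
        using elim by (intro sum_mono sum_mono2) auto
      also note key
      finally show ?case using elim by simp
    qed
  qed simp
  then show ?thesis
    by (simp add: a_def M_def power_mult_distrib power_mult mult.commute)
qed

section \<open>Stability estimates as bounds on the transfer function\<close>

definition est :: "real \<Rightarrow> real \<Rightarrow> real \<Rightarrow> bc \<Rightarrow> real \<Rightarrow> bool" where
  "est u = stab_estimate (\<lambda>f. (fst f + u * snd f)\<^sup>2)"

lemma SSOO_est_iff: "SSOO_est s C b lam \<longleftrightarrow> est 1 s C b lam"
  by (simp add: SSOO_est_def est_def mom1_def)

definition weighted_output :: "(real \<times> real \<Rightarrow> real) \<Rightarrow> real \<Rightarrow> real \<Rightarrow> bc \<Rightarrow> real \<Rightarrow> real \<Rightarrow> (nat \<Rightarrow> real) \<Rightarrow> real \<Rightarrow> ennreal" where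
  "weighted_output q s C b lam \<alpha> g dx =
     (\<Sum>n. \<Sum>j. ennreal (dx / lam * dx * exp (- 2 * \<alpha> * real n * (dx / lam)) * q (sol s C b g n j)))"

definition weighted_source :: "real \<Rightarrow> real \<Rightarrow> (nat \<Rightarrow> real) \<Rightarrow> real \<Rightarrow> ennreal" where
  "weighted_source lam \<alpha> g dx = (\<Sum>n. ennreal (dx / lam * exp (- 2 * \<alpha> * real n * (dx / lam)) * (g n)\<^sup>2))"

lemma stab_estimate_iff:
  "stab_estimate q s C b lam \<longleftrightarrow> (\<exists>K>0. \<forall>\<alpha>>0. \<forall>g. \<forall>dx>0.
     ennreal (\<alpha> / (1 + \<alpha> * (dx / lam))) * weighted_output q s C b lam \<alpha> g dx
       \<le> ennreal K * weighted_source lam \<alpha> g dx)"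
  unfolding stab_estimate_def Let_def weighted_output_def weighted_source_def by (rule refl)

lemma stab_estimate_mono:
  assumes est: "stab_estimate q s C b lam" and q: "\<And>f. q' f \<le> q f" and lam: "lam > 0"
  shows "stab_estimate q' s C b lam"
proof -
  have "weighted_output q' s C b lam \<alpha> g dx \<le> weighted_output q s C b lam \<alpha> g dx" if "0 < dx" for \<alpha> g dx
    unfolding weighted_output_def using that q lam
    by (intro suminf_le summableI ennreal_leI mult_left_mono) auto
  then have "ennreal c * weighted_output q' s C b lam \<alpha> g dx \<le> ennreal c * weighted_output q s C b lam \<alpha> g dx"
    if "0 < dx" for c \<alpha> g dx using that by (intro mult_left_mono) auto
  then show ?thesis using est unfolding stab_estimate_iff by (meson order_trans)
qed

lemma stab_estimate_add:
  assumes est1: "stab_estimate q1 s C b lam" and est2: "stab_estimate q2 s C b lam" and lam: "lam > 0"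
    and nn: "\<And>f. 0 \<le> q1 f" "\<And>f. 0 \<le> q2 f"
  shows "stab_estimate (\<lambda>f. q1 f + q2 f) s C b lam"
proof -
  have out: "weighted_output (\<lambda>f. q1 f + q2 f) s C b lam \<alpha> g dx
      = weighted_output q1 s C b lam \<alpha> g dx + weighted_output q2 s C b lam \<alpha> g dx" if "0 < dx" for \<alpha> g dx
  proof -
    define v where "v = (\<lambda>n. dx / lam * dx * exp (- 2 * \<alpha> * real n * (dx / lam)))"
    have v: "0 \<le> v n" for n using lam that by (simp add: v_def)
    have e: "ennreal (v n * (q1 f + q2 f)) = ennreal (v n * q1 f) + ennreal (v n * q2 f)" for n f
      using v nn by (simp add: distrib_left)
    show ?thesis
      unfolding weighted_output_def by (simp only: suminf_add[OF summableI summableI] e[unfolded v_def])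
  qed
  from est1 obtain K1 where K1: "K1 > 0" "\<And>\<alpha> g dx. \<alpha> > 0 \<Longrightarrow> dx > 0 \<Longrightarrow>
     ennreal (\<alpha> / (1 + \<alpha> * (dx / lam))) * weighted_output q1 s C b lam \<alpha> g dx
       \<le> ennreal K1 * weighted_source lam \<alpha> g dx" unfolding stab_estimate_iff by blast
  from est2 obtain K2 where K2: "K2 > 0" "\<And>\<alpha> g dx. \<alpha> > 0 \<Longrightarrow> dx > 0 \<Longrightarrow>
     ennreal (\<alpha> / (1 + \<alpha> * (dx / lam))) * weighted_output q2 s C b lam \<alpha> g dx
       \<le> ennreal K2 * weighted_source lam \<alpha> g dx" unfolding stab_estimate_iff by blast
  show ?thesis unfolding stab_estimate_iff
  proof (intro exI[of _ "K1 + K2"] conjI allI impI)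
    fix \<alpha> dx :: real and g assume a: "0 < \<alpha>" and dx: "0 < dx"
    have "ennreal (K1 + K2) = ennreal K1 + ennreal K2" using K1 K2 by simp
    then show "ennreal (\<alpha> / (1 + \<alpha> * (dx / lam))) * weighted_output (\<lambda>f. q1 f + q2 f) s C b lam \<alpha> g dx
       \<le> ennreal (K1 + K2) * weighted_source lam \<alpha> g dx"
      using add_mono[OF K1(2)[OF a dx, of g] K2(2)[OF a dx, of g]]
      unfolding out[OF dx] by (simp only: distrib_left distrib_right)
  qed (use K1 K2 in simp)
qed

lemma SS_est_iff:
  assumes "lam > 0"
  shows "SS_est s C b lam \<longleftrightarrow> est 1 s C b lam \<and> est (-1) s C b lam"
proof -
  have q: "(\<lambda>f. (mom1 f)\<^sup>2 + (mom2 f)\<^sup>2) = (\<lambda>f. (fst f + 1 * snd f)\<^sup>2 + (fst f + (-1) * snd f)\<^sup>2)"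
    by (simp add: mom1_def mom2_def)
  show ?thesis
    unfolding SS_est_def q est_def
  proof safe
    assume S: "stab_estimate (\<lambda>f. (fst f + 1 * snd f)\<^sup>2 + (fst f + (-1) * snd f)\<^sup>2) s C b lam"
    show "stab_estimate (\<lambda>f. (fst f + 1 * snd f)\<^sup>2) s C b lam"
      by (rule stab_estimate_mono[OF S _ assms]) simp
    show "stab_estimate (\<lambda>f. (fst f + (-1) * snd f)\<^sup>2) s C b lam"
      by (rule stab_estimate_mono[OF S _ assms]) simp
  qed (rule stab_estimate_add[OF _ _ assms]; simp)
qed

lemma sol_cong: "(\<And>m. m < n \<Longrightarrow> g m = g' m) \<Longrightarrow> sol s C b g n = sol s C b g' n"
  by (induction n) auto

lemma branch_fps_nth_0:
  assumes "branch_fps s C K W"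
  shows "fps_nth K 0 = 0" "fps_nth W 0 = 0"
proof -
  obtain P Q where "K = fps_X * P" "W = fps_X * Q" using assms unfolding branch_fps_def by blast
  then show "fps_nth K 0 = 0" "fps_nth W 0 = 0" by simp_all
qed

text \<open>\<open>K\<close> and \<open>W\<close> have no constant term, so
  \<open>1 - bsym_fps\<close> is a formal unit for every boundary condition, stable or not. Zeros in
  the disc only affect the convergence of its inverse.\<close>

lemma sol_functional_fps:
  fixes b :: bc
  assumes br: "branch_fps s C K W"
  defines "D \<equiv> 1 - bsym_fps b C K W"
  shows "Abs_fps (\<lambda>n. of_real (fst (sol s C b g n j) + u * snd (sol s C b g n j)))
      = fps_X * K ^ j * (1 + fps_const (of_real u) * (K * W)) * inverse D * Abs_fps (\<lambda>n. of_real (g n))"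
    and "inverse D * D = 1"
proof -
  have "fps_nth (bsym_fps b C K W) 0 = 0"
    unfolding bsym_fps_def fps_sum_nth using branch_fps_nth_0[OF br]
    by (intro sum.neutral) simp
  then have "fps_nth D 0 \<noteq> 0" by (simp add: D_def)
  then show inv: "inverse D * D = 1" by (rule inverse_mult_eq_1)
  define G where "G = Abs_fps (\<lambda>n. complex_of_real (g n))"
  define H where "H = inverse D * G"
  have "D * H = G" unfolding H_def using inv by (metis mult.assoc mult.commute mult.left_neutral)
  then have "H = bsym_fps b C K W * H + G" unfolding D_def by (simp add: left_diff_distrib diff_eq_eq add.commute)
  from sol_fps[OF br, of H b g, OF this[unfolded G_def]]
  have "complex_of_real (fst (sol s C b g n j) + u * snd (sol s C b g n j))
    = fps_nth (fps_X * H * K ^ j + fps_const (of_real u) * (fps_X * H * K ^ Suc j * W)) n" for n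
    by (simp add: fps_mult_left_const_nth)
  moreover have "fps_X * H * K ^ j + fps_const (of_real u) * (fps_X * H * K ^ Suc j * W)
     = fps_X * K ^ j * (1 + fps_const (of_real u) * (K * W)) * inverse D * G"
    by (simp add: H_def algebra_simps)
  ultimately show "Abs_fps (\<lambda>n. of_real (fst (sol s C b g n j) + u * snd (sol s C b g n j)))
      = fps_X * K ^ j * (1 + fps_const (of_real u) * (K * W)) * inverse D * Abs_fps (\<lambda>n. of_real (g n))"
    unfolding G_def[symmetric] by (intro fps_ext) (simp only: fps_nth_Abs_fps)
qed

lemma sum_power2_le:
  fixes q r :: real
  assumes "0 \<le> q" "q \<le> r" "r < 1"
  shows "(\<Sum>j<J. (q ^ j)\<^sup>2) \<le> 1 / (1 - r)"
proof -
  have "q * q \<le> q * 1" using assms by (intro mult_left_mono) auto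
  then have q2: "q\<^sup>2 < 1" "q\<^sup>2 \<le> r" using assms by (simp_all add: power2_eq_square)
  have "(\<Sum>j<J. (q ^ j)\<^sup>2) = (\<Sum>j<J. (q\<^sup>2) ^ j)" by (simp add: power_mult[symmetric] mult.commute)
  also have "\<dots> = (1 - (q\<^sup>2) ^ J) / (1 - q\<^sup>2)" using q2 by (subst sum_gp_strict) auto
  also have "\<dots> \<le> 1 / (1 - r)" using q2 assms by (intro frac_le) auto
  finally show ?thesis .
qed

text \<open>By causality the source can be cut at time \<open>N\<close>, which makes its series a
  polynomial. Summing over cells costs \<open>1 / (1 - r)\<close>, because
  \<open>|k| \<le> |x| = r\<close>.\<close>

lemma est_finite_bound:
  assumes par: "0 < s" "s \<le> 2" "\<bar>C\<bar> \<le> 1" "C = 1 \<Longrightarrow> s < 2"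
    and nz: "\<And>x k w. cmod x < 1 \<Longrightarrow> cmod k \<le> cmod x \<Longrightarrow> branch s C x k w \<Longrightarrow> bsym b C k w \<noteq> 1"
    and bd: "\<And>x k w. cmod x < 1 \<Longrightarrow> cmod k \<le> cmod x \<Longrightarrow> branch s C x k w \<Longrightarrow>
        cmod (1 + of_real u * (k * w)) \<le> M * cmod (1 - bsym b C k w)"
    and r: "0 < r" "r < 1"
  shows "(\<Sum>j<J. \<Sum>n<N. (fst (sol s C b g n j) + u * snd (sol s C b g n j))\<^sup>2 * r ^ (2 * n))
     \<le> M\<^sup>2 / (1 - r) * (\<Sum>n<N. (g n)\<^sup>2 * r ^ (2 * n))"
proof -
  obtain kf vf K W where K: "disc_fps K kf" and W: "disc_fps W vf" and brf: "branch_fps s C K W"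
    and br: "\<And>x. cmod x < 1 \<Longrightarrow> branch s C x (kf x) (vf x)"
    and le: "\<And>x. cmod x < 1 \<Longrightarrow> cmod (kf x) \<le> cmod x"
    using branch_fps_exists[OF par] by metis
  define D where "D = 1 - bsym_fps b C K W"
  define g' where "g' = (\<lambda>n. if n < N then g n else 0)"
  define \<Delta> where "\<Delta> = (\<lambda>x. 1 - bsym b C (kf x) (vf x))"
  define \<Phi> where "\<Phi> = (\<lambda>j. fps_X * K ^ j * (1 + fps_const (of_real u) * (K * W)) * inverse D)"
  define \<phi> where "\<phi> = (\<lambda>j x. x * kf x ^ j * (1 + of_real u * (kf x * vf x)) * inverse (\<Delta> x))"
  have nz': "\<Delta> x \<noteq> 0" if "cmod x < 1" for x using nz[OF that le[OF that] br[OF that]] by (simp add: \<Delta>_def)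
  have "disc_fps D \<Delta>" unfolding D_def \<Delta>_def by (intro disc_fps_intros disc_fps_bsym K W)
  then have \<Phi>: "disc_fps (\<Phi> j) (\<phi> j)" for j
    unfolding \<Phi>_def \<phi>_def by (intro disc_fps_intros disc_fps_inverse K W nz')
  have "(\<Sum>j<J. \<Sum>n<N. (cmod (fps_nth (\<Phi> j * Abs_fps (\<lambda>n. of_real (g' n))) n))\<^sup>2 * r ^ (2 * n))
     \<le> M\<^sup>2 / (1 - r) * (\<Sum>n<N. (cmod (fps_nth (Abs_fps (\<lambda>n. of_real (g' n))) n))\<^sup>2 * r ^ (2 * n))"
  proof (rule fps_multiplier_bound[OF \<Phi> r])
    fix x assume x: "cmod x = r"
    then have x1: "cmod x < 1" using r by simp
    have "cmod (\<phi> j x) \<le> M * cmod (kf x) ^ j" for j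
    proof -
      have "cmod (\<phi> j x) = cmod x * cmod (kf x) ^ j * (cmod (1 + of_real u * (kf x * vf x)) / cmod (\<Delta> x))"
        unfolding \<phi>_def by (simp add: norm_mult norm_power norm_inverse divide_inverse)
      also have "\<dots> \<le> 1 * cmod (kf x) ^ j * M"
      proof (intro mult_mono)
        show "cmod (1 + of_real u * (kf x * vf x)) / cmod (\<Delta> x) \<le> M"
          using bd[OF x1 le[OF x1] br[OF x1]] nz'[OF x1] by (simp add: pos_divide_le_eq \<Delta>_def)
      qed (use x1 in auto)
      finally show ?thesis by (simp add: mult.commute)
    qed
    then have "(\<Sum>j<J. (cmod (\<phi> j x))\<^sup>2) \<le> (\<Sum>j<J. (M * cmod (kf x) ^ j)\<^sup>2)"
      by (intro sum_mono power_mono) auto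
    also have "\<dots> = M\<^sup>2 * (\<Sum>j<J. (cmod (kf x) ^ j)\<^sup>2)" by (simp add: power_mult_distrib sum_distrib_left)
    also have "\<dots> \<le> M\<^sup>2 * (1 / (1 - r))"
      using le[OF x1] x r by (intro mult_left_mono sum_power2_le) auto
    finally show "(\<Sum>j<J. (cmod (\<phi> j x))\<^sup>2) \<le> M\<^sup>2 / (1 - r)" by simp
  qed (auto simp: g'_def)
  moreover have "\<Phi> j * Abs_fps (\<lambda>n. of_real (g' n))
     = Abs_fps (\<lambda>n. of_real (fst (sol s C b g' n j) + u * snd (sol s C b g' n j)))" for j
    unfolding \<Phi>_def D_def sol_functional_fps(1)[OF brf] ..
  moreover have "sol s C b g' n = sol s C b g n" if "n < N" for n
    using that by (intro sol_cong) (simp add: g'_def)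
  ultimately show ?thesis by (simp add: g'_def del: of_real_add of_real_mult)
qed

lemma est_if_transfer_bounded:
  assumes par: "0 < s" "s \<le> 2" "\<bar>C\<bar> \<le> 1" "C = 1 \<Longrightarrow> s < 2" and lam: "lam > 0"
    and nz: "\<And>x k w. cmod x < 1 \<Longrightarrow> cmod k \<le> cmod x \<Longrightarrow> branch s C x k w \<Longrightarrow> bsym b C k w \<noteq> 1"
    and bd: "\<And>x k w. cmod x < 1 \<Longrightarrow> cmod k \<le> cmod x \<Longrightarrow> branch s C x k w \<Longrightarrow>
        cmod (1 + of_real u * (k * w)) \<le> M * cmod (1 - bsym b C k w)"
  shows "est u s C b lam"
  unfolding est_def stab_estimate_def Let_def
\<comment> \<open>The factor \<open>lam\<close> comes from \<open>dx = lam dt\<close>; adding 1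
  keeps the constant positive when \<open>M = 0\<close>.\<close>
proof (intro exI[of _ "lam * (M\<^sup>2 + 1)"] conjI allI impI)
  show "0 < lam * (M\<^sup>2 + 1)" using lam by (simp add: add_nonneg_pos)
  fix \<alpha> dx :: real and g :: "nat \<Rightarrow> real"
  assume a: "0 < \<alpha>" and dx: "0 < dx"
  define dt where "dt = dx / lam"
  have dt: "0 < dt" "dx = lam * dt" using dx lam by (auto simp: dt_def)
  define r where "r = exp (- (\<alpha> * dt))"
  have r: "0 < r" "r < 1" using a dt by (auto simp: r_def)
  have ex: "exp (- 2 * \<alpha> * real n * dt) = r ^ (2 * n)" for n
    unfolding r_def exp_of_nat_mult[symmetric] by (simp add: mult_ac)
  define m where "m = (\<lambda>n j. (fst (sol s C b g n j) + u * snd (sol s C b g n j))\<^sup>2)"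
  define c where "c = \<alpha> / (1 + \<alpha> * dt)"
  have c0: "0 \<le> c" using a dt by (simp add: c_def)
  \<comment> \<open>The prefactor of the estimate is what absorbs the loss
    \<open>1 / (1 - r)\<close> from the sum over cells.\<close>
  have cr: "c * dt \<le> 1 - r"
  proof -
    have "1 + \<alpha> * dt \<le> exp (\<alpha> * dt)" by (rule exp_ge_add_one_self)
    then have "r \<le> 1 / (1 + \<alpha> * dt)"
      using a dt by (simp add: r_def exp_minus inverse_eq_divide add_pos_pos frac_le)
    moreover have "c * dt = 1 - 1 / (1 + \<alpha> * dt)"
      using a dt by (simp add: c_def field_simps add_pos_pos add_nonneg_eq_0_iff)
    ultimately show ?thesis by simp
  qed
  let ?R = "ennreal (lam * (M\<^sup>2 + 1)) * (\<Sum>n. ennreal (dt * r ^ (2 * n) * (g n)\<^sup>2))"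
  have fin: "(\<Sum>j<J. \<Sum>n<N. ennreal (c * (dt * dx * r ^ (2 * n) * m n j))) \<le> ?R" for J N
  proof -
    have "(\<Sum>j<J. \<Sum>n<N. ennreal (c * (dt * dx * r ^ (2 * n) * m n j)))
        = ennreal (\<Sum>j<J. \<Sum>n<N. c * (dt * dx * r ^ (2 * n) * m n j))"
      using c0 dt dx r by (simp add: m_def sum_nonneg)
    also have "\<dots> = ennreal (c * dt * dx * (\<Sum>j<J. \<Sum>n<N. m n j * r ^ (2 * n)))"
      by (simp add: sum_distrib_left mult_ac)
    also have "\<dots> \<le> ennreal (lam * (M\<^sup>2 + 1) * (\<Sum>n<N. dt * r ^ (2 * n) * (g n)\<^sup>2))"
    proof (rule ennreal_leI)
      let ?S = "\<Sum>n<N. (g n)\<^sup>2 * r ^ (2 * n)"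
      have S: "0 \<le> ?S" using r by (intro sum_nonneg) auto
      have "c * dt * dx * (\<Sum>j<J. \<Sum>n<N. m n j * r ^ (2 * n)) \<le> c * dt * dx * (M\<^sup>2 / (1 - r) * ?S)"
        unfolding m_def using c0 dt dx by (intro mult_left_mono est_finite_bound[OF par nz bd r]) auto
      also have "\<dots> \<le> (1 - r) * dx * (M\<^sup>2 / (1 - r) * ?S)"
        using cr dx r S by (intro mult_right_mono mult_nonneg_nonneg) auto
      also have "\<dots> = dx * M\<^sup>2 * ?S" using r by simp
      also have "\<dots> \<le> dx * (M\<^sup>2 + 1) * ?S" using dx S by (intro mult_right_mono mult_left_mono) auto
      also have "\<dots> = lam * (M\<^sup>2 + 1) * (\<Sum>n<N. dt * r ^ (2 * n) * (g n)\<^sup>2)"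
        unfolding dt(2) by (simp add: sum_distrib_left mult_ac)
      finally show "c * dt * dx * (\<Sum>j<J. \<Sum>n<N. m n j * r ^ (2 * n)) \<le> \<dots>" .
    qed
    also have "\<dots> = ennreal (lam * (M\<^sup>2 + 1)) * (\<Sum>n<N. ennreal (dt * r ^ (2 * n) * (g n)\<^sup>2))"
      using lam dt r by (subst ennreal_mult) (auto simp: sum_nonneg)
    also have "\<dots> \<le> ?R"
      by (intro mult_left_mono sum_le_suminf summableI) auto
    finally show ?thesis .
  qed
  have "ennreal c * (\<Sum>n. \<Sum>j. ennreal (dt * dx * r ^ (2 * n) * m n j))
     = (\<Sum>n. \<Sum>j. ennreal (c * (dt * dx * r ^ (2 * n) * m n j)))"
    using c0 dt dx r by (simp add: ennreal_mult m_def flip: ennreal_suminf_cmult)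
  \<comment> \<open>The estimate sums over cells inside the sum over time, the finite bound the
    other way round; for finitely many time levels the two orders may be exchanged.\<close>
  also have "\<dots> \<le> ?R"
  proof (rule suminf_le_const[OF summableI])
    fix N
    have "(\<Sum>n<N. \<Sum>j. ennreal (c * (dt * dx * r ^ (2 * n) * m n j)))
        = (\<Sum>j. \<Sum>n<N. ennreal (c * (dt * dx * r ^ (2 * n) * m n j)))"
      by (rule suminf_sum[symmetric]) (rule summableI)
    also have "\<dots> \<le> ?R" by (rule suminf_le_const[OF summableI fin])
    finally show "(\<Sum>n<N. \<Sum>j. ennreal (c * (dt * dx * r ^ (2 * n) * m n j))) \<le> ?R" .
  qed
  finally show "ennreal (\<alpha> / (1 + \<alpha> * (dx / lam))) * (\<Sum>n. \<Sum>j. ennreal (dx / lam * dx * exp (- 2 * \<alpha> * real n * (dx / lam)) * (fst (sol s C b g n j) + u * snd (sol s C b g n j))\<^sup>2))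
     \<le> ennreal (lam * (M\<^sup>2 + 1)) * (\<Sum>n. ennreal (dx / lam * exp (- 2 * \<alpha> * real n * (dx / lam)) * (g n)\<^sup>2))"
    unfolding dt_def[symmetric] ex c_def m_def .
qed

section \<open>Consequences of an estimate for the transfer function\<close>

lemma est_imp_weighted_bound:
  assumes est: "est u s C b lam" and lam: "lam > 0"
  obtains K where "K > 0"
    "\<And>t g J N. 0 < t \<Longrightarrow> t < 1 \<Longrightarrow> summable (\<lambda>n. t ^ n * (g n)\<^sup>2) \<Longrightarrow>
      (\<Sum>n<N. \<Sum>j<J. t ^ n * (fst (sol s C b g n j) + u * snd (sol s C b g n j))\<^sup>2)
        \<le> K / (1 - t) * (\<Sum>n. t ^ n * (g n)\<^sup>2)"
proof -
  from est obtain K where K: "K > 0" "\<And>\<alpha> g dx. \<alpha> > 0 \<Longrightarrow> dx > 0 \<Longrightarrow>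
     ennreal (\<alpha> / (1 + \<alpha> * (dx / lam))) * weighted_output (\<lambda>f. (fst f + u * snd f)\<^sup>2) s C b lam \<alpha> g dx
       \<le> ennreal K * weighted_source lam \<alpha> g dx" unfolding est_def stab_estimate_iff by blast
  show thesis
  \<comment> \<open>The 4 is from \<open>c \<ge> (1 - t) / 4\<close>; the step size used is
    \<open>dx = lam\<close>, that is \<open>dt = 1\<close>.\<close>
  proof (rule that[of "4 * K / lam"])
    fix t :: real and g J N
    assume t: "0 < t" "t < 1" and sg: "summable (\<lambda>n. t ^ n * (g n)\<^sup>2)"
    define m where "m = (\<lambda>n j. (fst (sol s C b g n j) + u * snd (sol s C b g n j))\<^sup>2)"
    \<comment> \<open>Every weight ratio \<open>t\<close> between 0 and 1 occurs as
      \<open>exp (- 2 * \<alpha>)\<close>.\<close>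
    define \<alpha> where "\<alpha> = - ln t / 2"
    have a: "\<alpha> > 0" using t by (simp add: \<alpha>_def)
    have ex: "exp (- 2 * \<alpha> * real n) = t ^ n" for n
      using t by (simp add: \<alpha>_def exp_of_nat2_mult)
    have out: "weighted_output (\<lambda>f. (fst f + u * snd f)\<^sup>2) s C b lam \<alpha> g lam = (\<Sum>n. \<Sum>j. ennreal (lam * t ^ n * m n j))"
      using lam by (simp add: weighted_output_def m_def flip: ex)
    have src: "weighted_source lam \<alpha> g lam = ennreal (\<Sum>n. t ^ n * (g n)\<^sup>2)"
      using lam sg t by (simp add: weighted_source_def suminf_ennreal2 flip: ex)
    define c where "c = \<alpha> / (1 + \<alpha>)"
    have c: "(1 - t) / 4 \<le> c" "0 < c"
    proof -
      have "t = exp (- 2 * \<alpha>)" using ex[of 1] by simp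
      then have "1 - t \<le> 2 * \<alpha>" using exp_ge_add_one_self[of "- 2 * \<alpha>"] by linarith
      show "(1 - t) / 4 \<le> c"
      proof (cases "\<alpha> \<le> 1")
        case True
        then have "\<alpha> / 2 \<le> c" unfolding c_def using a by (intro divide_left_mono) auto
        moreover have "(1 - t) / 4 \<le> \<alpha> / 2" using \<open>1 - t \<le> 2 * \<alpha>\<close> by simp
        ultimately show ?thesis by (rule order_trans[rotated])
      next
        case False
        then have "1 / 2 \<le> c" unfolding c_def by (simp add: field_simps)
        moreover have "(1 - t) / 4 \<le> 1 / 2" using t by simp
        ultimately show ?thesis by (rule order_trans[rotated])
      qed
      show "0 < c" using a by (simp add: c_def)
    qed
    have G0: "0 \<le> K * (\<Sum>n. t ^ n * (g n)\<^sup>2)" using K(1) sg t by (simp add: suminf_nonneg)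
    have "ennreal (c * (\<Sum>n<N. \<Sum>j<J. lam * t ^ n * m n j)) = ennreal c * (\<Sum>n<N. \<Sum>j<J. ennreal (lam * t ^ n * m n j))"
      using c lam t by (subst ennreal_mult) (auto simp: m_def sum_nonneg simp flip: sum_ennreal)
    also have "\<dots> \<le> ennreal c * (\<Sum>n<N. \<Sum>j. ennreal (lam * t ^ n * m n j))"
      by (intro mult_left_mono sum_mono sum_le_suminf summableI) auto
    also have "\<dots> \<le> ennreal c * (\<Sum>n. \<Sum>j. ennreal (lam * t ^ n * m n j))"
      by (intro mult_left_mono sum_le_suminf summableI) auto
    also have "\<dots> \<le> ennreal K * ennreal (\<Sum>n. t ^ n * (g n)\<^sup>2)"
      using K(2)[OF a lam, of g] lam by (simp add: out src c_def)
    also have "\<dots> = ennreal (K * (\<Sum>n. t ^ n * (g n)\<^sup>2))"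
      using K(1) sg t by (subst ennreal_mult) (auto intro!: suminf_nonneg)
    finally have "c * (\<Sum>n<N. \<Sum>j<J. lam * t ^ n * m n j) \<le> K * (\<Sum>n. t ^ n * (g n)\<^sup>2)"
      using G0 by (simp only: ennreal_le_iff)
    moreover have "(1 - t) / 4 * (lam * (\<Sum>n<N. \<Sum>j<J. t ^ n * m n j)) \<le> c * (\<Sum>n<N. \<Sum>j<J. lam * t ^ n * m n j)"
    proof -
      have eq: "lam * (\<Sum>n<N. \<Sum>j<J. t ^ n * m n j) = (\<Sum>n<N. \<Sum>j<J. lam * t ^ n * m n j)"
        by (simp add: sum_distrib_left mult.assoc)
      have "0 \<le> (\<Sum>n<N. \<Sum>j<J. lam * t ^ n * m n j)"
        using lam t by (intro sum_nonneg) (auto simp: m_def)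
      then show ?thesis unfolding eq by (rule mult_right_mono[OF c(1)])
    qed
    ultimately have "(1 - t) / 4 * (lam * (\<Sum>n<N. \<Sum>j<J. t ^ n * m n j)) \<le> K * (\<Sum>n. t ^ n * (g n)\<^sup>2)"
      by linarith
    then have "(\<Sum>n<N. \<Sum>j<J. t ^ n * m n j) * ((1 - t) / 4 * lam) \<le> K * (\<Sum>n. t ^ n * (g n)\<^sup>2)"
      by (simp only: mult_ac)
    then have "(\<Sum>n<N. \<Sum>j<J. t ^ n * m n j) \<le> K * (\<Sum>n. t ^ n * (g n)\<^sup>2) / ((1 - t) / 4 * lam)"
      using t lam by (subst pos_le_divide_eq) auto
    then show "(\<Sum>n<N. \<Sum>j<J. t ^ n * (fst (sol s C b g n j) + u * snd (sol s C b g n j))\<^sup>2)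
        \<le> 4 * K / lam / (1 - t) * (\<Sum>n. t ^ n * (g n)\<^sup>2)"
      unfolding m_def by (simp add: mult_ac)
  qed (use K lam in simp)
qed

text \<open>The bound says \<open>|f n| \<le> sqrt A / sqrt t ^ n\<close>, so the series converges
  up to radius \<open>sqrt t\<close>.\<close>

lemma fps_conv_radius_gt_if_square_bound:
  fixes f :: "nat \<Rightarrow> complex"
  assumes bd: "\<And>n. t ^ n * (cmod (f n))\<^sup>2 \<le> A" and t: "0 < t" and x: "(cmod x)\<^sup>2 < t"
  shows "ereal (cmod x) < fps_conv_radius (Abs_fps f)"
proof -
  have "cmod x < sqrt t" using x by (simp add: real_less_rsqrt)
  then obtain y where y: "cmod x < y" "y < sqrt t" using dense by blast
  have y0: "0 < y" using y(1) norm_ge_zero[of x] by linarith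
  have "cmod (f n) * y ^ n \<le> sqrt A * (y / sqrt t) ^ n" for n
  proof -
    have "(sqrt t ^ n * cmod (f n))\<^sup>2 \<le> A"
      using bd[of n] t by (simp add: power_mult_distrib flip: real_sqrt_power)
    then have "sqrt t ^ n * cmod (f n) \<le> sqrt A" by (simp add: real_le_rsqrt)
    then have "sqrt t ^ n * cmod (f n) * (y / sqrt t) ^ n \<le> sqrt A * (y / sqrt t) ^ n"
      using y0 t by (intro mult_right_mono) auto
    moreover have "sqrt t ^ n * (y / sqrt t) ^ n = y ^ n"
      using t by (simp flip: power_mult_distrib)
    ultimately show ?thesis by (metis mult.assoc mult.commute)
  qed
  then have le: "norm (f n * of_real y ^ n) \<le> sqrt A * (y / sqrt t) ^ n" for n
    using y0 by (simp add: norm_mult norm_power)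
  have "summable (\<lambda>n. sqrt A * (y / sqrt t) ^ n)"
    using y y0 t by (intro summable_mult summable_geometric) auto
  then have "summable (\<lambda>n. f n * of_real y ^ n)"
    by (rule summable_comparison_test'[where N = 0]) (rule le)
  then have "ereal (cmod (of_real y)) \<le> conv_radius f" by (rule conv_radius_geI)
  moreover have "fps_nth (Abs_fps f) = f" by (rule ext) simp
  ultimately have "ereal y \<le> fps_conv_radius (Abs_fps f)" using y0 by (simp add: fps_conv_radius_def)
  moreover have "ereal (cmod x) < ereal y" using y(1) by simp
  ultimately show ?thesis by (rule less_le_trans[rotated])
qed

definition out :: "real \<Rightarrow> real \<Rightarrow> real \<Rightarrow> bc \<Rightarrow> (nat \<Rightarrow> real) \<Rightarrow> nat \<Rightarrow> nat \<Rightarrow> complex" where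
  "out u s C b g n j = of_real (fst (sol s C b g n j) + u * snd (sol s C b g n j))"

text \<open>The transfer identity is kept multiplied by \<open>1 - bsym\<close>, so that it can be
  evaluated at a zero of \<open>1 - bsym\<close>, where the quotient makes no sense.\<close>

definition transfer_bound :: "real \<Rightarrow> real \<Rightarrow> real \<Rightarrow> real \<Rightarrow> bc \<Rightarrow> (complex \<Rightarrow> complex) \<Rightarrow> (complex \<Rightarrow> complex) \<Rightarrow> bool" where
  "transfer_bound K u s C b kf vf \<longleftrightarrow> (\<forall>t g. 0 < t \<longrightarrow> t < 1 \<longrightarrow> summable (\<lambda>n. t ^ n * (g n)\<^sup>2) \<longrightarrow>
      (\<forall>N J. (\<Sum>n<N. \<Sum>j<J. t ^ n * (cmod (out u s C b g n j))\<^sup>2) \<le> K / (1 - t) * (\<Sum>n. t ^ n * (g n)\<^sup>2)) \<and>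
      (\<forall>x j. (cmod x)\<^sup>2 < t \<longrightarrow> ereal (cmod x) < fps_conv_radius (Abs_fps (\<lambda>n. complex_of_real (g n))) \<longrightarrow>
         summable (\<lambda>n. out u s C b g n j * x ^ n) \<and>
         (\<Sum>n. out u s C b g n j * x ^ n) * (1 - bsym b C (kf x) (vf x))
            = x * kf x ^ j * (1 + of_real u * (kf x * vf x)) * eval_fps (Abs_fps (\<lambda>n. of_real (g n))) x))"

text \<open>The estimate makes the output series converge up to radius \<open>sqrt t\<close>; hence
  the formal identity for the solution may be evaluated there.\<close>

lemma est_imp_transfer:
  assumes par: "0 < s" "s \<le> 2" "\<bar>C\<bar> \<le> 1" "C = 1 \<Longrightarrow> s < 2" and lam: "lam > 0"
    and est: "est u s C b lam"
  shows "\<exists>K kf vf. K > 0 \<and> (\<forall>x. cmod x < 1 \<longrightarrow> branch s C x (kf x) (vf x) \<and> cmod (kf x) \<le> cmod x) \<and>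
     transfer_bound K u s C b kf vf"
proof -
  obtain kf vf K W where K: "disc_fps K kf" and W: "disc_fps W vf" and brf: "branch_fps s C K W"
    and br: "\<And>x. cmod x < 1 \<Longrightarrow> branch s C x (kf x) (vf x)"
    and le: "\<And>x. cmod x < 1 \<Longrightarrow> cmod (kf x) \<le> cmod x"
    using branch_fps_exists[OF par] by metis
  obtain B where B: "B > 0" "\<And>t g J N. 0 < t \<Longrightarrow> t < 1 \<Longrightarrow> summable (\<lambda>n. t ^ n * (g n)\<^sup>2) \<Longrightarrow>
      (\<Sum>n<N. \<Sum>j<J. t ^ n * (fst (sol s C b g n j) + u * snd (sol s C b g n j))\<^sup>2)
        \<le> B / (1 - t) * (\<Sum>n. t ^ n * (g n)\<^sup>2)"
    using est_imp_weighted_bound[OF est lam] by blast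
  define D where "D = 1 - bsym_fps b C K W"
  have D: "disc_fps D (\<lambda>x. 1 - bsym b C (kf x) (vf x))"
    unfolding D_def by (intro disc_fps_intros disc_fps_bsym K W)
  have "transfer_bound B u s C b kf vf" unfolding transfer_bound_def
  proof (intro allI impI)
    fix t :: real and g
    assume t: "0 < t" "t < 1" and sg: "summable (\<lambda>n. t ^ n * (g n)\<^sup>2)"
    define m where "m = out u s C b g"
    have bound: "(\<Sum>n<N. \<Sum>j<J. t ^ n * (cmod (m n j))\<^sup>2) \<le> B / (1 - t) * (\<Sum>n. t ^ n * (g n)\<^sup>2)" for N J
      using B(2)[OF t sg, of J N] by (simp add: m_def out_def del: of_real_add of_real_mult)
    define G where "G = Abs_fps (\<lambda>n. complex_of_real (g n))"
    have "summable (\<lambda>n. m n j * x ^ n) \<and> (\<Sum>n. m n j * x ^ n) * (1 - bsym b C (kf x) (vf x))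
               = x * kf x ^ j * (1 + of_real u * (kf x * vf x)) * eval_fps G x"
      if x: "(cmod x)\<^sup>2 < t" and xG: "ereal (cmod x) < fps_conv_radius G" for x j
    proof -
      have x1: "cmod x < 1" using x t by (smt (verit) one_le_power)
      have "t ^ n * (cmod (m n j))\<^sup>2 \<le> B / (1 - t) * (\<Sum>n. t ^ n * (g n)\<^sup>2)" for n
      proof -
        have "t ^ n * (cmod (m n j))\<^sup>2 \<le> (\<Sum>j'<Suc j. t ^ n * (cmod (m n j'))\<^sup>2)"
          using t by (intro member_le_sum[of j "{..<Suc j}" "\<lambda>j'. t ^ n * (cmod (m n j'))\<^sup>2"]) auto
        also have "\<dots> \<le> (\<Sum>n'<Suc n. \<Sum>j'<Suc j. t ^ n' * (cmod (m n' j'))\<^sup>2)"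
          using t by (intro member_le_sum[of n "{..<Suc n}" "\<lambda>n'. \<Sum>j'<Suc j. t ^ n' * (cmod (m n' j'))\<^sup>2"]) (auto intro!: sum_nonneg add_nonneg_nonneg)
        also note bound
        finally show ?thesis .
      qed
      from fps_conv_radius_gt_if_square_bound[OF this t(1) x]
      have rM: "ereal (cmod x) < fps_conv_radius (Abs_fps (\<lambda>n. m n j))" .
      have E: "Abs_fps (\<lambda>n. m n j) = fps_X * K ^ j * (1 + fps_const (of_real u) * (K * W)) * inverse D * G"
        unfolding m_def out_def D_def G_def by (rule sol_functional_fps(1)[OF brf])
      define P where "P = fps_X * K ^ j * (1 + fps_const (of_real u) * (K * W))"
      have P: "disc_fps P (\<lambda>x. x * kf x ^ j * (1 + of_real u * (kf x * vf x)))"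
        unfolding P_def by (intro disc_fps_intros K W)
      \<comment> \<open>Clearing \<open>inverse D\<close> is essential: its radius of convergence
        can be less than 1.\<close>
      have "Abs_fps (\<lambda>n. m n j) * D = P * G * (inverse D * D)"
        unfolding E P_def[symmetric] by (simp only: mult_ac)
      then have "Abs_fps (\<lambda>n. m n j) * D = P * G"
        using sol_functional_fps(2)[OF brf, of b] unfolding D_def by simp
      then have "eval_fps (Abs_fps (\<lambda>n. m n j)) x * eval_fps D x = eval_fps P x * eval_fps G x"
        using eval_fps_mult[OF rM disc_fps_radius[OF D x1]] eval_fps_mult[OF disc_fps_radius[OF P x1] xG] by simp
      then show ?thesis
        using summable_fps[OF rM] unfolding disc_fps_eval[OF D x1] disc_fps_eval[OF P x1]
        by (simp add: eval_fps_def)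
    qed
    then show "(\<forall>N J. (\<Sum>n<N. \<Sum>j<J. t ^ n * (cmod (out u s C b g n j))\<^sup>2) \<le> B / (1 - t) * (\<Sum>n. t ^ n * (g n)\<^sup>2)) \<and>
      (\<forall>x j. (cmod x)\<^sup>2 < t \<longrightarrow> ereal (cmod x) < fps_conv_radius (Abs_fps (\<lambda>n. complex_of_real (g n))) \<longrightarrow>
         summable (\<lambda>n. out u s C b g n j * x ^ n) \<and>
         (\<Sum>n. out u s C b g n j * x ^ n) * (1 - bsym b C (kf x) (vf x))
            = x * kf x ^ j * (1 + of_real u * (kf x * vf x)) * eval_fps (Abs_fps (\<lambda>n. of_real (g n))) x)"
      using bound unfolding G_def[symmetric] m_def by simp
  qed
  then show ?thesis using B(1) br le by (intro exI[of _ B] exI[of _ kf] exI[of _ vf]) simp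
qed

text \<open>The Godunov-Ryabenkii condition. For a unit impulse the source series is 1; at a zero of
  \<open>1 - bsym\<close> the left side of the transfer identity vanishes, so the numerator has to
  vanish too.\<close>

lemma est_imp_no_zero:
  assumes s: "0 < s" "s \<le> 2" and C: "\<bar>C\<bar> < 1" and lam: "lam > 0" and est: "est u s C b lam"
    and x: "cmod x < 1" and br: "branch s C x k w" and k: "cmod k < 1" and zero: "bsym b C k w = 1"
  shows "x * (1 + of_real u * (k * w)) = 0"
proof -
  have C': "\<bar>C\<bar> \<le> 1" "C = 1 \<Longrightarrow> s < 2" using C by auto
  obtain K kf vf where K: "K > 0" and brf: "\<And>x. cmod x < 1 \<Longrightarrow> branch s C x (kf x) (vf x)"
    and le: "\<And>x. cmod x < 1 \<Longrightarrow> cmod (kf x) \<le> cmod x"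
    and tr: "transfer_bound K u s C b kf vf"
    using est_imp_transfer[OF s C' lam est] by blast
  have kw: "kf x = k" "vf x = w"
    using branch_unique[OF s C x brf[OF x] br _ k] le[OF x] x by auto
  define t where "t = ((cmod x)\<^sup>2 + 1) / 2"
  have x2: "(cmod x)\<^sup>2 < 1" using x by (simp add: abs_square_less_1)
  then have t: "0 < t" "t < 1" "(cmod x)\<^sup>2 < t" by (simp_all add: t_def add_nonneg_pos)
  define g :: "nat \<Rightarrow> real" where "g = (\<lambda>n. if n = 0 then 1 else 0)"
  have G: "Abs_fps (\<lambda>n. complex_of_real (g n)) = 1" by (rule fps_ext) (simp add: g_def)
  have "summable (\<lambda>n. t ^ n * (g n)\<^sup>2)"
    by (rule summable_finite[of "{0}"]) (auto simp: g_def)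
  from tr[unfolded transfer_bound_def, rule_format, OF t(1,2) this, THEN conjunct2, rule_format, of x 0] t(3)
  show ?thesis by (simp add: G kw zero)
qed

text \<open>The source \<open>sg ^ n\<close> resonates with \<open>x = sg t\<close>, where its
  series has the value \<open>1 / (1 - t)\<close>. Cauchy-Schwarz bounds the squared output
  transforms, summed over cells, by \<open>K / (1 - t)^3\<close>, while their exact values form a
  geometric series in \<open>|k|^2\<close>. The resulting factor \<open>1 - |k|^2\<close> is kept:
  when \<open>|k|\<close> tends to 1 it contributes a further order of decay.\<close>

lemma est_imp_real_bound:
  assumes par: "0 < s" "s \<le> 2" "\<bar>C\<bar> \<le> 1" "C = 1 \<Longrightarrow> s < 2" and lam: "lam > 0"
    and est: "est u s C b lam"
  shows "\<exists>K kf vf. K > 0 \<and> (\<forall>x. cmod x < 1 \<longrightarrow> branch s C x (kf x) (vf x) \<and> cmod (kf x) \<le> cmod x) \<and>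
    (\<forall>t sg x. 0 < t \<longrightarrow> t < 1 \<longrightarrow> \<bar>sg\<bar> = 1 \<longrightarrow> x = of_real (sg * t) \<longrightarrow>
       (1 - t) * t\<^sup>2 * (cmod (1 + of_real u * (kf x * vf x)))\<^sup>2
         \<le> K * (1 - (cmod (kf x))\<^sup>2) * (cmod (1 - bsym b C (kf x) (vf x)))\<^sup>2)"
proof -
  obtain K kf vf where K: "K > 0" and brf: "\<And>x. cmod x < 1 \<Longrightarrow> branch s C x (kf x) (vf x)"
    and le: "\<And>x. cmod x < 1 \<Longrightarrow> cmod (kf x) \<le> cmod x"
    and tr: "transfer_bound K u s C b kf vf"
    using est_imp_transfer[OF par lam est] by blast
  show ?thesis
  proof (rule exI[of _ K], rule exI[of _ kf], rule exI[of _ vf], intro conjI allI impI K brf le)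
    fix t sg :: real and x :: complex
    assume t: "0 < t" "t < 1" and sg: "\<bar>sg\<bar> = 1" and x: "x = of_real (sg * t)"
    define g where "g = (\<lambda>n::nat. sg ^ n)"
    have g2: "(g n)\<^sup>2 = 1" for n using sg by (simp add: g_def flip: power_mult) (metis power2_abs power_one power_mult mult.commute)
    have nx: "cmod x = t" using t sg by (simp add: x abs_mult del: of_real_mult)
    have x1: "cmod x < 1" using nx t by simp
    \<comment> \<open>The weight \<open>t ^ n\<close> controls the output up to radius
      \<open>sqrt t\<close>, strictly beyond \<open>|x| = t\<close>.\<close>
    have t2: "(cmod x)\<^sup>2 < t" using t by (simp add: nx power2_eq_square)
    have tg: "(\<Sum>n. t ^ n * (g n)\<^sup>2) = 1 / (1 - t)" "summable (\<lambda>n. t ^ n * (g n)\<^sup>2)"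
      using t by (simp_all add: g2 suminf_geometric summable_geometric)
    define m where "m = out u s C b g"
    note TR = tr[unfolded transfer_bound_def, rule_format, OF t tg(2)]
    have bound: "(\<Sum>n<N. \<Sum>j<J. t ^ n * (cmod (m n j))\<^sup>2) \<le> K / (1 - t) * (1 / (1 - t))" for N J
      using TR[THEN conjunct1, rule_format, of J N] unfolding tg(1) m_def .
    have rG: "ereal (cmod x) < fps_conv_radius (Abs_fps (\<lambda>n. complex_of_real (g n)))"
      by (rule fps_conv_radius_gt_if_square_bound[OF _ t(1) t2, of _ 1])
        (use t in \<open>simp add: g2 power_le_one flip: of_real_power\<close>)
    have "eval_fps (Abs_fps (\<lambda>n. complex_of_real (g n))) x = (\<Sum>n. of_real t ^ n)"
      unfolding eval_fps_def
    proof (intro suminf_cong)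
      fix n
      have "g n * (sg * t) ^ n = t ^ n"
        using g2[of n] by (simp add: g_def power_mult_distrib power2_eq_square)
      then show "fps_nth (Abs_fps (\<lambda>n. complex_of_real (g n))) n * x ^ n = of_real t ^ n"
        unfolding x fps_nth_Abs_fps by (metis of_real_mult of_real_power)
    qed
    also have "\<dots> = 1 / (1 - of_real t)" using t by (intro suminf_geometric) simp
    finally have eG: "eval_fps (Abs_fps (\<lambda>n. complex_of_real (g n))) x = of_real (1 / (1 - t))" by simp
    define \<Delta> where "\<Delta> = 1 - bsym b C (kf x) (vf x)"
    define P where "P = cmod (1 + of_real u * (kf x * vf x))"
    define S where "S = (\<lambda>j. \<Sum>n. m n j * x ^ n)"
    have S: "(\<lambda>n. m n j * x ^ n) sums S j"
      "S j * \<Delta> = x * kf x ^ j * (1 + of_real u * (kf x * vf x)) * of_real (1 / (1 - t))" for j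
      using TR[THEN conjunct2, rule_format, OF t2 rG, of j] unfolding eG \<Delta>_def m_def[symmetric] S_def
      by (simp_all only: summable_sums)
    have SJ: "(\<Sum>j<J. (cmod (S j))\<^sup>2) \<le> K / (1 - t) ^ 3" for J
    proof (rule tendsto_upperbound)
      show "(\<lambda>N. \<Sum>j<J. (cmod (\<Sum>n<N. m n j * x ^ n))\<^sup>2) \<longlonglongrightarrow> (\<Sum>j<J. (cmod (S j))\<^sup>2)"
        using S(1) unfolding sums_def by (intro tendsto_intros) auto
      show "eventually (\<lambda>N. (\<Sum>j<J. (cmod (\<Sum>n<N. m n j * x ^ n))\<^sup>2) \<le> K / (1 - t) ^ 3) sequentially"
      proof (intro always_eventually allI)
        fix N
        have geo: "(\<Sum>n<N. t ^ n) \<le> 1 / (1 - t)"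
          using t sum_le_suminf[OF summable_geometric, of t "{..<N}"] by (simp add: suminf_geometric)
        have "(cmod (\<Sum>n<N. m n j * x ^ n))\<^sup>2 \<le> (\<Sum>n<N. t ^ n * (cmod (m n j))\<^sup>2) * (1 / (1 - t))" for j
        proof -
          have "cmod (\<Sum>n<N. m n j * x ^ n) \<le> (\<Sum>n<N. cmod (m n j * x ^ n))" by (rule norm_sum)
          \<comment> \<open>Half of \<open>t ^ n\<close> stays with the output, where the estimate
            applies; the other half gives a geometric sum.\<close>
          also have "\<dots> = (\<Sum>n<N. (sqrt t ^ n * cmod (m n j)) * sqrt t ^ n)"
          proof (intro sum.cong refl)
            fix n
            have "sqrt t ^ n * sqrt t ^ n = t ^ n" using t by (simp flip: power_mult_distrib)
            then show "cmod (m n j * x ^ n) = sqrt t ^ n * cmod (m n j) * sqrt t ^ n"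
              by (simp add: norm_mult norm_power nx mult_ac)
          qed
          finally have "(cmod (\<Sum>n<N. m n j * x ^ n))\<^sup>2 \<le> (\<Sum>n<N. (sqrt t ^ n * cmod (m n j)) * sqrt t ^ n)\<^sup>2"
            by (intro power_mono) auto
          also have "\<dots> \<le> (\<Sum>n<N. (sqrt t ^ n * cmod (m n j))\<^sup>2) * (\<Sum>n<N. (sqrt t ^ n)\<^sup>2)"
            by (rule Cauchy_Schwarz_ineq_sum)
          also have "\<dots> = (\<Sum>n<N. t ^ n * (cmod (m n j))\<^sup>2) * (\<Sum>n<N. t ^ n)"
          proof -
            have "(sqrt t ^ n)\<^sup>2 = t ^ n" for n using t by (simp add: power_even_eq[symmetric] power2_eq_square flip: power_mult_distrib)
            then show ?thesis by (simp add: power_mult_distrib)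
          qed
          also have "\<dots> \<le> (\<Sum>n<N. t ^ n * (cmod (m n j))\<^sup>2) * (1 / (1 - t))"
            using t by (intro mult_left_mono geo sum_nonneg) auto
          finally show ?thesis .
        qed
        then have "(\<Sum>j<J. (cmod (\<Sum>n<N. m n j * x ^ n))\<^sup>2) \<le> (\<Sum>j<J. (\<Sum>n<N. t ^ n * (cmod (m n j))\<^sup>2) * (1 / (1 - t)))"
          by (intro sum_mono)
        also have "\<dots> = (\<Sum>n<N. \<Sum>j<J. t ^ n * (cmod (m n j))\<^sup>2) * (1 / (1 - t))"
          by (subst sum.swap) (simp only: sum_distrib_right)
        also have "\<dots> \<le> K / (1 - t) * (1 / (1 - t)) * (1 / (1 - t))"
          using t by (intro mult_right_mono bound) auto
        finally show "(\<Sum>j<J. (cmod (\<Sum>n<N. m n j * x ^ n))\<^sup>2) \<le> K / (1 - t) ^ 3"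
          by (simp add: power3_eq_cube)
      qed
    qed simp
    define q where "q = (cmod (kf x))\<^sup>2"
    have q: "0 \<le> q" "q < 1"
      using le[OF x1] x1 by (auto simp: q_def abs_square_less_1)
    have pre: "t\<^sup>2 * P\<^sup>2 * (1 - t) * (\<Sum>j<J. q ^ j) \<le> K * (cmod \<Delta>)\<^sup>2" for J
    proof -
      have "(cmod (S j))\<^sup>2 * (cmod \<Delta>)\<^sup>2 = t\<^sup>2 * q ^ j * P\<^sup>2 / (1 - t)\<^sup>2" for j
      proof -
        have "cmod (S j) * cmod \<Delta> = t * cmod (kf x) ^ j * P * (1 / (1 - t))"
          using arg_cong[OF S(2)[of j], of cmod] t
          by (simp add: norm_mult norm_power nx P_def del: of_real_divide of_real_diff)
        then have "(cmod (S j) * cmod \<Delta>)\<^sup>2 = (t * cmod (kf x) ^ j * P * (1 / (1 - t)))\<^sup>2" by simp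
        then show ?thesis by (simp add: power_mult_distrib power_divide q_def flip: power_mult) (simp add: mult.commute)
      qed
      then have "t\<^sup>2 * P\<^sup>2 / (1 - t)\<^sup>2 * (\<Sum>j<J. q ^ j) = (\<Sum>j<J. (cmod (S j))\<^sup>2) * (cmod \<Delta>)\<^sup>2"
        by (simp add: sum_distrib_left sum_distrib_right sum_divide_distrib mult_ac)
      also have "\<dots> \<le> K / (1 - t) ^ 3 * (cmod \<Delta>)\<^sup>2" by (intro mult_right_mono SJ) auto
      finally have "(1 - t) ^ 3 * (t\<^sup>2 * P\<^sup>2 / (1 - t)\<^sup>2 * (\<Sum>j<J. q ^ j)) \<le> (1 - t) ^ 3 * (K / (1 - t) ^ 3 * (cmod \<Delta>)\<^sup>2)"
        using t by (intro mult_left_mono) auto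
      then show ?thesis using t by (simp add: power3_eq_cube power2_eq_square mult_ac)
    qed
    have "t\<^sup>2 * P\<^sup>2 * (1 - t) * (1 / (1 - q)) \<le> K * (cmod \<Delta>)\<^sup>2"
    proof (rule tendsto_upperbound)
      show "(\<lambda>J. t\<^sup>2 * P\<^sup>2 * (1 - t) * (\<Sum>j<J. q ^ j)) \<longlonglongrightarrow> t\<^sup>2 * P\<^sup>2 * (1 - t) * (1 / (1 - q))"
        using geometric_sums[of q] q unfolding sums_def by (intro tendsto_mult tendsto_const) auto
    qed (use pre in auto)
    then show "(1 - t) * t\<^sup>2 * (cmod (1 + of_real u * (kf x * vf x)))\<^sup>2
         \<le> K * (1 - (cmod (kf x))\<^sup>2) * (cmod (1 - bsym b C (kf x) (vf x)))\<^sup>2"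
      using q unfolding P_def[symmetric] \<Delta>_def[symmetric] q_def[symmetric] by (simp add: field_simps)
  qed
qed

section \<open>Critical modes as solutions of \<open>bsym = 1\<close>\<close>

lemma ghost_scale:
  fixes c :: "'a::real_field"
  shows "ghost b C (\<lambda>j. (c * f j, c * h j)) = c * ghost b C (\<lambda>j. (f j, h j))"
  unfolding ghost_sum by (simp add: sum_distrib_left distrib_left mult_ac)

text \<open>Dividing the mode by \<open>fst \<phi>\<close> puts it in the normal form
  \<open>(1, k w)\<close>.\<close>

lemma critical_mode_imp_branch:
  assumes s: "0 < s" and C: "\<bar>C\<bar> \<le> 1" and cm: "critical_mode s C b z \<kappa>" and z: "1 < cmod z"
  shows "cmod \<kappa> < 1 \<and> (\<exists>w. branch s C (1 / z) \<kappa> w \<and> bsym b C \<kappa> w = 1)"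
proof -
  have k: "cmod \<kappa> < 1" using cm z unfolding critical_mode_def stable_root_or_limit_def by auto
  have z0: "z \<noteq> 0" using z by auto
  obtain \<phi> where \<phi>: "\<phi> \<noteq> (0, 0)" and st: "\<And>n j. (z ^ Suc n * \<kappa> ^ j * fst \<phi>, z ^ Suc n * \<kappa> ^ j * snd \<phi>)
     = step s C b 0 (\<lambda>j. (z ^ n * \<kappa> ^ j * fst \<phi>, z ^ n * \<kappa> ^ j * snd \<phi>)) j"
    using cm unfolding critical_mode_def Let_def by blast
  define A B where "A = of_real (ca s C) * fst \<phi> + of_real (cb s C) * snd \<phi>"
    and "B = of_real (cc s C) * fst \<phi> + of_real (cd s C) * snd \<phi>"
  have rx: "relax s C (z ^ 0 * \<kappa> ^ j * fst \<phi>, z ^ 0 * \<kappa> ^ j * snd \<phi>) = (\<kappa> ^ j * A, \<kappa> ^ j * B)" for j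
    unfolding relax_eq A_def B_def by (simp add: algebra_simps)
  have e0: "z * fst \<phi> = ghost b C (\<lambda>j. (\<kappa> ^ j * A, \<kappa> ^ j * B))" and e1: "z * snd \<phi> = \<kappa> * B"
    using st[of 0 0] unfolding step_def Let_def rx by simp_all
  have e2: "z * \<kappa> * fst \<phi> = A"
    using st[of 0 1] unfolding step_def Let_def rx by simp
  \<comment> \<open>Otherwise \<open>cb = 0\<close> and \<open>cd = 1\<close>: the second component
    is merely transported, so \<open>z = \<kappa>\<close>, which is impossible for
    \<open>|z| > 1 > |\<kappa>|\<close>.\<close>
  have f0: "fst \<phi> \<noteq> 0"
  proof
    assume f: "fst \<phi> = 0"
    then have s0: "snd \<phi> \<noteq> 0" using \<phi> by (metis prod.collapse)
    then have "cb s C = 0" using e2 f by (simp add: A_def)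
    then have "cd s C = 1" unfolding cb_def cd_def by simp
    then have "z = \<kappa>" using e1 f s0 by (simp add: B_def)
    then show False using z k by simp
  qed
  define w where "w = B / (z * fst \<phi>)"
  have kw: "\<kappa> * w = snd \<phi> / fst \<phi>" unfolding w_def using e1 z0 f0 by (simp add: field_simps)
  have "branch s C (1 / z) \<kappa> w"
    unfolding branch_def kw using z0 f0 e2 unfolding w_def A_def B_def
    by (simp add: field_simps)
  moreover have "bsym b C \<kappa> w = 1"
  proof -
    have g: "(\<lambda>j. (\<kappa> ^ j * A, \<kappa> ^ j * B)) = (\<lambda>j. (z * fst \<phi> * \<kappa> ^ Suc j, z * fst \<phi> * (\<kappa> ^ j * w)))"
      using z0 f0 by (simp add: w_def fun_eq_iff flip: e2)
    have "z * fst \<phi> = z * fst \<phi> * bsym b C \<kappa> w"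
      unfolding bsym_def ghost_scale[symmetric] by (rule e0[unfolded g])
    then show ?thesis using z0 f0 by simp
  qed
  ultimately show ?thesis using k by blast
qed

lemma branch_bulk_char:
  assumes "z \<noteq> 0" "branch s C (1 / z) k w"
  shows "bulk_char s C z k"
  unfolding bulk_char_def
proof (intro exI[of _ "(1, k * w)"] conjI)
  have "z * k = of_real (ca s C) + of_real (cb s C) * (k * w)" "z * w = of_real (cc s C) + of_real (cd s C) * (k * w)"
    using assms unfolding branch_def by (metis mult.assoc mult_1 nonzero_mult_div_cancel_left times_divide_eq_left times_divide_eq_right)+
  then show "z * k * fst (1, k * w) = fst (relax s C (1, k * w))" "z * snd (1, k * w) = k * snd (relax s C (1, k * w))"
    unfolding relax_eq by (simp_all add: mult.left_commute)
qed auto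

lemma critical_modeI:
  assumes z: "z \<noteq> 0" and br: "branch s C (1 / z) k w" and sy: "bsym b C k w = 1"
    and st: "stable_root_or_limit s C z k"
  shows "critical_mode s C b z k"
  unfolding critical_mode_def Let_def
proof (intro conjI st exI[of _ "(1, k * w)"] allI)
  fix n j
  have e: "of_real (ca s C) + of_real (cb s C) * (k * w) = z * k" "of_real (cc s C) + of_real (cd s C) * (k * w) = z * w"
    using br z unfolding branch_def by (metis mult.assoc mult_1 nonzero_mult_div_cancel_left times_divide_eq_left times_divide_eq_right)+
  have rx: "relax s C (z ^ n * k ^ j * fst (1, k * w), z ^ n * k ^ j * snd (1, k * w))
     = (z ^ Suc n * k ^ Suc j, z ^ Suc n * (k ^ j * w))" for j
  proof -
    have "relax s C (z ^ n * k ^ j * fst (1, k * w), z ^ n * k ^ j * snd (1, k * w))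
      = (z ^ n * k ^ j * (of_real (ca s C) + of_real (cb s C) * (k * w)), z ^ n * k ^ j * (of_real (cc s C) + of_real (cd s C) * (k * w)))"
      unfolding relax_eq by (simp add: algebra_simps)
    then show ?thesis unfolding e by (simp add: mult_ac)
  qed
  show "(z ^ Suc n * k ^ j * fst (1, k * w), z ^ Suc n * k ^ j * snd (1, k * w))
     = step s C b 0 (\<lambda>j. (z ^ n * k ^ j * fst (1, k * w), z ^ n * k ^ j * snd (1, k * w))) j"
    unfolding step_def Let_def rx ghost_scale bsym_def[symmetric] sy
    by (cases j) (simp_all add: mult_ac)
qed auto

lemma critical_mode_unstable:
  assumes x: "x \<noteq> 0" "cmod x < 1" and br: "branch s C x k w" and k: "cmod k < 1" and sy: "bsym b C k w = 1"
  shows "critical_mode s C b (1 / x) k" "1 < cmod (1 / x)"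
proof -
  show z: "1 < cmod (1 / x)" using x by (simp add: norm_divide)
  have b: "branch s C (1 / (1 / x)) k w" using br x by simp
  show "critical_mode s C b (1 / x) k"
    using x by (intro critical_modeI[OF _ b sy]) (auto simp: stable_root_or_limit_def z k intro: branch_bulk_char[OF _ b])
qed

section \<open>Radial approach to the points 1 and -1\<close>

definition tseq :: "nat \<Rightarrow> real" where "tseq n = 1 - 1 / (real n + 2)"

lemma tseq: "0 < tseq n" "tseq n < 1" by (simp_all add: tseq_def)

lemma tseq_tendsto: "tseq \<longlonglongrightarrow> 1"
proof -
  have "(\<lambda>n. 1 / (real n + 2)) \<longlonglongrightarrow> 0"
    using LIMSEQ_Suc[OF LIMSEQ_inverse_real_of_nat] by (simp add: inverse_eq_divide add.commute)
  from tendsto_diff[OF tendsto_const[of 1] this] show ?thesis by (simp add: tseq_def[abs_def])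
qed

text \<open>Both critical time factors \<open>z = 1\<close> and \<open>z = - 1\<close> are reached along \<open>x = \<plusminus> tseq n\<close>; by
  \<open>branch_minus\<close> the sign can be moved into the boundary symbol.\<close>

definition branch_seq :: "real \<Rightarrow> real \<Rightarrow> (nat \<Rightarrow> complex) \<Rightarrow> (nat \<Rightarrow> complex) \<Rightarrow> bool" where
  "branch_seq s C k w \<longleftrightarrow> (\<forall>n. branch s C (of_real (tseq n)) (k n) (w n) \<and> cmod (k n) \<le> tseq n)"

lemma branch_sign: "\<bar>sg\<bar> = 1 \<Longrightarrow> branch s C (of_real (sg * t)) (of_real sg * k) (of_real sg * w) \<longleftrightarrow> branch s C (of_real t) k w"
  using branch_minus[of s C "of_real t" k w] branch_minus[of s C "- of_real t" "-k" "-w"]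
  by (cases "sg = 1") (auto simp: abs_if split: if_splits)

lemma branch_seq_exists:
  assumes par: "0 < s" "s \<le> 2" "\<bar>C\<bar> \<le> 1" "C = 1 \<Longrightarrow> s < 2"
  shows "\<exists>k w. branch_seq s C k w"
proof -
  obtain kf vf where "\<And>x. cmod x < 1 \<Longrightarrow> branch s C x (kf x) (vf x)" "\<And>x. cmod x < 1 \<Longrightarrow> cmod (kf x) \<le> cmod x"
    using branch_exists[OF par] by metis
  then have "branch_seq s C (\<lambda>n. kf (of_real (tseq n))) (\<lambda>n. vf (of_real (tseq n)))"
    unfolding branch_seq_def using tseq by (metis abs_of_pos norm_of_real)
  then show ?thesis by blast
qed

lemma est_imp_branch_seq:
  assumes par: "0 < s" "s \<le> 2" "\<bar>C\<bar> \<le> 1" "C = 1 \<Longrightarrow> s < 2" and lam: "lam > 0"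
    and est: "est u s C b lam" and sg: "\<bar>sg\<bar> = 1"
  shows "\<exists>K k w. K > 0 \<and> branch_seq s C k w \<and> (\<forall>n. (1 - tseq n) * (tseq n)\<^sup>2 * (cmod (1 + of_real u * (k n * w n)))\<^sup>2
      \<le> K * (1 - (cmod (k n))\<^sup>2) * (cmod (1 - bsym b C (of_real sg * k n) (of_real sg * w n)))\<^sup>2)"
proof -
  obtain K kf vf where K: "K > 0" and br: "\<forall>x. cmod x < 1 \<longrightarrow> branch s C x (kf x) (vf x) \<and> cmod (kf x) \<le> cmod x"
    and bd: "\<forall>t sg x. 0 < t \<longrightarrow> t < 1 \<longrightarrow> \<bar>sg\<bar> = 1 \<longrightarrow> x = of_real (sg * t) \<longrightarrow>
       (1 - t) * t\<^sup>2 * (cmod (1 + of_real u * (kf x * vf x)))\<^sup>2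
         \<le> K * (1 - (cmod (kf x))\<^sup>2) * (cmod (1 - bsym b C (kf x) (vf x)))\<^sup>2"
    using est_imp_real_bound[OF par lam est] by blast
  define x k w where "x = (\<lambda>n. complex_of_real (sg * tseq n))" and "k = (\<lambda>n. of_real sg * kf (x n))" and "w = (\<lambda>n. of_real sg * vf (x n))"
  have sg2: "complex_of_real sg * (of_real sg * y) = y" for y
    using sg by (auto simp: abs_if split: if_splits)
  have nx: "cmod (x n) = tseq n" for n using tseq(1)[of n] sg by (simp add: x_def abs_mult del: of_real_mult)
  have B: "branch s C (x n) (kf (x n)) (vf (x n))" "cmod (kf (x n)) \<le> tseq n" for n
    using br[rule_format, of "x n"] tseq(2)[of n] by (simp_all add: nx)
  have nk: "cmod (k n) = cmod (kf (x n))" for n using sg by (simp add: k_def norm_mult)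
  have "branch s C (of_real (tseq n)) (k n) (w n)" for n
    using branch_sign[OF sg, of s C "tseq n" "k n" "w n"] B(1)[of n] unfolding k_def w_def sg2 x_def by simp
  then have "branch_seq s C k w" unfolding branch_seq_def nk using B(2) by blast
  moreover have "k n * w n = kf (x n) * vf (x n)" for n
    unfolding k_def w_def using sg2 by (metis mult.assoc mult.left_commute)
  moreover have "of_real sg * k n = kf (x n)" "of_real sg * w n = vf (x n)" for n
    unfolding k_def w_def by (rule sg2)+
  ultimately show ?thesis
    using bd[rule_format, OF tseq sg x_def[THEN fun_cong]] K
    by (intro exI[of _ K] exI[of _ k] exI[of _ w]) (simp add: nk)
qed

text \<open>The radial sequence itself, with \<open>z = 1 / (sg tseq n)\<close>, witnesses that the
  limit of \<open>k\<close> is a limit of stable roots; the branch equations pass to the limit by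
  continuity.\<close>

lemma critical_mode_limit:
  assumes bs: "branch_seq s C k w" and k: "k \<longlonglongrightarrow> \<kappa>" and w: "w \<longlonglongrightarrow> \<omega>" and sg: "\<bar>sg\<bar> = 1"
    and sy: "bsym b C (of_real sg * \<kappa>) (of_real sg * \<omega>) = 1"
  shows "critical_mode s C b (of_real sg) (of_real sg * \<kappa>)"
proof -
  have br: "branch s C (of_real (tseq n)) (k n) (w n)" and kn: "cmod (k n) < 1" for n
    using bs tseq(2)[of n] unfolding branch_seq_def by (auto intro: le_less_trans)
  have t: "(\<lambda>n. complex_of_real (tseq n)) \<longlonglongrightarrow> 1" using tendsto_of_real[OF tseq_tendsto] by simp
  have "branch s C (of_real 1) \<kappa> \<omega>" unfolding branch_def
  proof
    have "(\<lambda>n. of_real (tseq n) * (of_real (ca s C) + of_real (cb s C) * (k n * w n)))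
       \<longlonglongrightarrow> 1 * (of_real (ca s C) + of_real (cb s C) * (\<kappa> * \<omega>))" by (intro tendsto_intros t k w)
    also have "(\<lambda>n. of_real (tseq n) * (of_real (ca s C) + of_real (cb s C) * (k n * w n))) = k"
      using br unfolding branch_def by (intro ext) metis
    finally show "\<kappa> = of_real 1 * (of_real (ca s C) + of_real (cb s C) * (\<kappa> * \<omega>))"
      unfolding of_real_1 by (rule LIMSEQ_unique[OF k])
    have "(\<lambda>n. of_real (tseq n) * (of_real (cc s C) + of_real (cd s C) * (k n * w n)))
       \<longlonglongrightarrow> 1 * (of_real (cc s C) + of_real (cd s C) * (\<kappa> * \<omega>))" by (intro tendsto_intros t k w)
    also have "(\<lambda>n. of_real (tseq n) * (of_real (cc s C) + of_real (cd s C) * (k n * w n))) = w"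
      using br unfolding branch_def by (intro ext) metis
    finally show "\<omega> = of_real 1 * (of_real (cc s C) + of_real (cd s C) * (\<kappa> * \<omega>))"
      unfolding of_real_1 by (rule LIMSEQ_unique[OF w])
  qed
  then have "branch s C (of_real (sg * 1)) (of_real sg * \<kappa>) (of_real sg * \<omega>)" unfolding branch_sign[OF sg] .
  then have b1: "branch s C (1 / of_real sg) (of_real sg * \<kappa>) (of_real sg * \<omega>)"
    using sg by (cases "sg = 1") (auto simp: abs_if split: if_splits)
  have sg0: "sg \<noteq> 0" using sg by auto
  have "stable_root_or_limit s C (of_real sg) (of_real sg * \<kappa>)"
    unfolding stable_root_or_limit_def
  proof (rule disjI2, intro conjI exI allI)
    show "cmod (of_real sg) = 1" using sg by simp
    have z: "1 / (1 / complex_of_real (sg * tseq n)) = of_real (sg * tseq n)" for n by simp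
    show "1 < cmod (1 / of_real (sg * tseq n))" for n
      using tseq[of n] sg by (simp add: norm_divide norm_mult)
    show "cmod (of_real sg * k n) < 1" for n using kn[of n] sg by (simp add: norm_mult)
    have "branch s C (of_real (sg * tseq n)) (of_real sg * k n) (of_real sg * w n)" for n
      unfolding branch_sign[OF sg] by (rule br)
    then show "bulk_char s C (1 / of_real (sg * tseq n)) (of_real sg * k n)" for n
      using tseq(1)[of n] sg0 by (intro branch_bulk_char[where w = "of_real sg * w n"]) (simp_all only: z, simp)
    have "(\<lambda>n. 1 / complex_of_real (sg * tseq n)) \<longlonglongrightarrow> 1 / (of_real sg * 1)"
      unfolding of_real_mult using sg0 by (intro tendsto_intros t) auto
    moreover have "1 / (complex_of_real sg * 1) = of_real sg" using sg by (auto simp: abs_if split: if_splits)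
    ultimately show "(\<lambda>n. 1 / complex_of_real (sg * tseq n)) \<longlonglongrightarrow> of_real sg" by simp
    show "(\<lambda>n. of_real sg * k n) \<longlonglongrightarrow> of_real sg * \<kappa>" by (intro tendsto_intros k)
  qed
  then show ?thesis using sg0 by (intro critical_modeI[OF _ b1 sy]) auto
qed

section \<open>Limits of the stable branch at the critical frequencies\<close>

text \<open>With \<open>q = 1 - s\<close>, \<open>e = 1 + k w\<close>, \<open>a = b + q\<close> and
  \<open>c = d - q\<close>, the equation for \<open>k w\<close> becomes
  \<open>1 - q^2 x^2 = e (1 - x^2 (q (d - b) + b d e))\<close>. For \<open>|e| \<le> 1\<close> the
  cofactor is at most \<open>1 + 3 + 2 = 6\<close>; for larger \<open>e\<close> the claim is
  trivial, as the left side is at most 1.\<close>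

lemma one_plus_product_lower:
  assumes s: "0 < s" "s \<le> 2" and C: "\<bar>C\<bar> \<le> 1" and x: "cmod x < 1" and br: "branch s C x k w"
  shows "1 - (1 - s)\<^sup>2 * (cmod x)\<^sup>2 \<le> 6 * cmod (1 + k * w)"
proof -
  define e a b c d q where "e = 1 + k * w" and "a = complex_of_real (ca s C)" and "b = complex_of_real (cb s C)"
    and "c = complex_of_real (cc s C)" and "d = complex_of_real (cd s C)" and "q = complex_of_real (1 - s)"
  have ab: "a = b + q" "c = d - q" by (simp_all add: a_def b_def c_def d_def q_def coef_defs field_simps)
  have "k = x * (a + b * (k * w))" "w = x * (c + d * (k * w))"
    using br by (auto simp: branch_def a_def b_def c_def d_def)
  then have "k * w = x\<^sup>2 * ((a + b * (k * w)) * (c + d * (k * w)))" by (metis mult.assoc mult.left_commute power2_eq_square)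
  then have "e - 1 = x\<^sup>2 * ((q + b * e) * (d * e - q))"
    unfolding ab e_def by (simp add: algebra_simps)
  then have id: "1 - q\<^sup>2 * x\<^sup>2 = e * (1 - x\<^sup>2 * (q * (d - b) + b * d * e))"
    by (simp add: algebra_simps power2_eq_square)
  have q: "cmod q \<le> 1" "cmod q = \<bar>1 - s\<bar>" using s by (simp_all add: q_def del: of_real_diff)
  have b: "cmod b \<le> 2"
  proof -
    have "s * (1 + C) \<le> 2 * 2" "0 \<le> s * (1 + C)" using s C by (intro mult_mono mult_nonneg_nonneg; simp)+
    then show ?thesis by (simp add: b_def cb_def del: of_real_divide of_real_mult)
  qed
  have d: "cmod d \<le> 1" using abs_cd_le[OF s C] by (simp add: d_def)
  have x2: "cmod (x\<^sup>2) \<le> 1" using x by (simp add: norm_power power_le_one)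
  have lower: "1 - (1 - s)\<^sup>2 * (cmod x)\<^sup>2 \<le> cmod (1 - q\<^sup>2 * x\<^sup>2)"
    using norm_triangle_ineq2[of 1 "q\<^sup>2 * x\<^sup>2"] by (simp add: norm_mult norm_power q(2))
  show ?thesis
  proof (cases "cmod e \<le> 1")
    case True
    have "cmod (q * (d - b)) \<le> 1 * (1 + 2)"
      unfolding norm_mult using q(1) norm_triangle_ineq4[of d b] b d by (intro mult_mono) auto
    moreover have "cmod (b * d * e) \<le> 2 * 1 * 1"
      unfolding norm_mult using b d True by (intro mult_mono mult_nonneg_nonneg) auto
    ultimately have "cmod (q * (d - b)) + cmod (b * d * e) \<le> 5" by simp
    then have "cmod (q * (d - b) + b * d * e) \<le> 5" by (rule norm_triangle_le)
    then have "cmod (x\<^sup>2 * (q * (d - b) + b * d * e)) \<le> 1 * 5"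
      unfolding norm_mult using x2 by (intro mult_mono) auto
    then have "cmod (1 - x\<^sup>2 * (q * (d - b) + b * d * e)) \<le> 6"
      using norm_triangle_ineq4[of 1 "x\<^sup>2 * (q * (d - b) + b * d * e)"] by simp
    then have "cmod e * cmod (1 - x\<^sup>2 * (q * (d - b) + b * d * e)) \<le> cmod e * 6"
      by (intro mult_left_mono) auto
    then show ?thesis using lower unfolding id norm_mult e_def by linarith
  next
    case False
    have "0 \<le> (1 - s)\<^sup>2 * (cmod x)\<^sup>2" by simp
    then show ?thesis using False unfolding e_def by linarith
  qed
qed

text \<open>Polynomial division of the quadratic for \<open>w\<close> by \<open>1 - w\<close>. The
  right side is its value at \<open>w = 1\<close>, which vanishes as \<open>t\<close> tends to 1:
  one of the two factors on the left must become small, and the sign of \<open>C\<close> decides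
  which.\<close>

lemma branch_w_factor:
  assumes br: "branch s C (of_real t) k w"
  shows "(1 - w) * (of_real (1 + (s - 1) * t\<^sup>2 - t * cb s C) - of_real t * (of_real (cb s C) * w))
     = of_real ((1 - t) * (1 - (s - 1) * t))"
proof -
  have bc: "complex_of_real (cc s C) = of_real s - of_real (cb s C)" by (simp add: coef_defs field_simps)
  show ?thesis using branch_w_quad[OF br] unfolding bc by (simp add: algebra_simps power2_eq_square)
qed

lemma branch_bw_le_norm:
  assumes s: "0 < s" "s \<le> 2" and C: "\<bar>C\<bar> \<le> 1" and br: "branch s C x k w"
    and x: "cmod x < 1" and k: "cmod k \<le> cmod x"
  shows "cmod (of_real (cb s C) * w) \<le> s / 2 * sqrt (1 - C\<^sup>2)"
proof -
  have "cmod (x * k) < 1" using x k mult_le_one[of "cmod x" "cmod k"] mult_strict_mono[of "cmod x" 1 "cmod k" 1]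
    by (simp add: norm_mult)
  then have "(cmod (of_real (cb s C) * w))\<^sup>2 \<le> (s / 2)\<^sup>2 * (1 - C\<^sup>2) * (cmod x)\<^sup>2"
    using branch_bw_le[OF s C br] x by simp
  also have "\<dots> \<le> (s / 2)\<^sup>2 * (1 - C\<^sup>2) * 1"
    using x C by (intro mult_left_mono) (auto simp: power_le_one abs_square_le_1)
  also have "\<dots> = (s / 2)\<^sup>2 * (sqrt (1 - C\<^sup>2))\<^sup>2"
    using C by (simp add: abs_square_le_1)
  also have "\<dots> = (s / 2 * sqrt (1 - C\<^sup>2))\<^sup>2" by (rule power_mult_distrib[symmetric])
  finally have sq: "(cmod (of_real (cb s C) * w))\<^sup>2 \<le> (s / 2 * sqrt (1 - C\<^sup>2))\<^sup>2" .
  have "C\<^sup>2 \<le> 1" using C by (simp add: abs_square_le_1)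
  then have "0 \<le> sqrt (1 - C\<^sup>2)" by simp
  then have "0 \<le> s / 2 * sqrt (1 - C\<^sup>2)" using s by (intro mult_nonneg_nonneg) simp_all
  with sq show ?thesis by (rule power2_le_imp_le)
qed

text \<open>For \<open>C < 0\<close> the second factor of \<open>branch_w_factor\<close> is bounded
  below: its real constant is at least \<open>t s (1 - C) / 2\<close>, while
  \<open>|cb w| \<le> s / 2\<close>. The factor \<open>1 - (s - 1) t\<close> is retained, since for
  \<open>s = 2\<close> it equals \<open>1 - t\<close> and doubles the order.\<close>

lemma outflow_w_near_1:
  assumes s: "0 < s" "s \<le> 2" and C: "-1 \<le> C" "C < 0" and t: "0 < t" "t < 1"
    and br: "branch s C (of_real t) k w" and k: "cmod k \<le> t"
  shows "t * (s * (- C) / 2) * cmod (1 - w) \<le> (1 - t) * (1 - (s - 1) * t)"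
proof -
  define B where "B = 1 + (s - 1) * t\<^sup>2 - t * cb s C"
  have C': "\<bar>C\<bar> \<le> 1" using C by simp
  have bw: "cmod (of_real (cb s C) * w) \<le> s / 2 * sqrt (1 - C\<^sup>2)"
    using branch_bw_le_norm[OF s C' br] t k by simp
  have "sqrt (1 - C\<^sup>2) \<le> 1" by simp
  then have bw': "cmod (of_real (cb s C) * w) \<le> s / 2"
    using order_trans[OF bw mult_left_mono[of "sqrt (1 - C\<^sup>2)" 1 "s / 2"]] s by simp
  have y: "0 \<le> (1 - t) * (1 - (s - 1) * t)"
  proof -
    have "(s - 1) * t \<le> 1 * 1" using s t by (intro mult_mono) auto
    then show ?thesis using t by simp
  qed
  have "B = (1 - t) * (1 - (s - 1) * t) + t * (s - cb s C)" by (simp add: B_def algebra_simps power2_eq_square)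
  then have "t * (s - cb s C) \<le> B" using y by simp
  moreover have "s - cb s C = s / 2 * (1 - C)" by (simp add: cb_def field_simps)
  ultimately have B: "t * (s / 2 * (1 - C)) \<le> B" by simp
  have "t * (s * (- C) / 2) = t * (s / 2 * (1 - C)) - t * (s / 2)" by (simp add: algebra_simps)
  also have "\<dots> \<le> cmod (of_real B - of_real t * (of_real (cb s C) * w))"
  proof -
    have "cmod (of_real t * (of_real (cb s C) * w)) \<le> t * (s / 2)"
      using t bw' by (simp only: norm_mult[of "of_real t"] norm_of_real abs_of_pos mult_left_mono less_imp_le)
    moreover have "t * (s / 2 * (1 - C)) \<le> cmod (of_real B)" using B by simp
    ultimately show ?thesis
      using norm_triangle_ineq2[of "of_real B" "of_real t * (of_real (cb s C) * w)"] by linarith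
  qed
  finally have "t * (s * (- C) / 2) * cmod (1 - w) \<le> cmod (of_real B - of_real t * (of_real (cb s C) * w)) * cmod (1 - w)"
    by (intro mult_right_mono) auto
  also have "\<dots> = cmod (of_real ((1 - t) * (1 - (s - 1) * t)))"
    unfolding norm_mult[symmetric] using branch_w_factor[OF br] unfolding B_def by (metis mult.commute)
  also have "\<dots> = (1 - t) * (1 - (s - 1) * t)" using y by (simp only: norm_of_real abs_of_nonneg)
  finally show ?thesis .
qed

text \<open>For \<open>C > 0\<close> the energy gives \<open>|w| \<le> R < 1\<close>, so
  \<open>1 - w\<close> is bounded below and the second factor of \<open>branch_w_factor\<close> is
  small: \<open>cb w\<close> is close to \<open>s - cb = cc\<close>. Then \<open>k\<close> is close
  to \<open>ca / (1 - cc) = 1\<close>.\<close>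

lemma inflow_near_1:
  assumes s: "0 < s" "s \<le> 2" and C: "0 < C" "C \<le> 1"
  obtains M where "0 < M" "\<And>t k w. 0 < t \<Longrightarrow> t < 1 \<Longrightarrow> branch s C (of_real t) k w \<Longrightarrow> cmod k \<le> t \<Longrightarrow>
     cmod (1 - k) \<le> M * (1 - t) \<and> t * cmod (w - of_real (cc s C / cb s C)) \<le> M * (1 - t)"
proof -
  have C': "\<bar>C\<bar> \<le> 1" using C by simp
  have b: "0 < cb s C" using s C by (simp add: cb_def)
  define R where "R = sqrt ((1 - C) / (1 + C))"
  have R: "0 \<le> R" "R < 1" using C by (simp_all add: R_def)
  define \<rho> where "\<rho> = sqrt (1 - C\<^sup>2)"
  have "C\<^sup>2 \<le> 1" "0 < C\<^sup>2" using C by (simp_all add: power_le_one)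
  then have \<rho>: "0 \<le> \<rho>" "\<rho> < 1" by (simp_all add: \<rho>_def)
  define N where "N = 2 / (1 - R) + 2"
  define M where "M = N / cb s C + (1 + N) / (1 - \<rho>)"
  have N: "0 < N" using R by (simp add: N_def add_pos_pos)
  have "0 < M" unfolding M_def using N b \<rho> by (intro add_pos_pos divide_pos_pos) auto
  moreover have "cmod (1 - k) \<le> M * (1 - t) \<and> t * cmod (w - of_real (cc s C / cb s C)) \<le> M * (1 - t)"
    if t: "0 < t" "t < 1" and br: "branch s C (of_real t) k w" and k: "cmod k \<le> t" for t k w
  proof -
    define \<beta> where "\<beta> = complex_of_real (cb s C) * w"
    have tk: "cmod (of_real t * k) < 1"
      using t k mult_strict_mono[of t 1 "cmod k" 1] by (simp add: norm_mult)
    have "(1 + C) * (cmod w)\<^sup>2 \<le> (1 - C) * t\<^sup>2"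
      using branch_w_le[OF s C' br _ tk] t by simp
    also have "\<dots> \<le> (1 - C) * 1" using t C by (intro mult_left_mono) (auto simp: power_le_one)
    finally have "(cmod w)\<^sup>2 \<le> (1 - C) / (1 + C)" using C by (simp add: field_simps)
    then have wR: "cmod w \<le> R" unfolding R_def by (rule real_le_rsqrt)
    then have "1 - R \<le> cmod (1 - w)" using norm_triangle_ineq2[of 1 w] by simp
    define y where "y = (1 - t) * (1 - (s - 1) * t)"
    have y: "0 \<le> y" "y \<le> 2 * (1 - t)"
    proof -
      have "(s - 1) * t \<le> 1 * 1" using s t by (intro mult_mono) auto
      moreover have "-1 * 1 \<le> (s - 1) * t" using s t mult_right_mono[of "-1" "s - 1" t] by simp
      ultimately have "0 \<le> 1 - (s - 1) * t" "1 - (s - 1) * t \<le> 2" by simp_all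
      then show "0 \<le> y" "y \<le> 2 * (1 - t)" using t mult_left_mono[of "1 - (s - 1) * t" 2 "1 - t"] by (simp_all add: y_def)
    qed
    define E where "E = of_real (1 + (s - 1) * t\<^sup>2 - t * cb s C) - of_real t * \<beta>"
    have "cmod (1 - w) * cmod E = y"
      unfolding norm_mult[symmetric] E_def \<beta>_def branch_w_factor[OF br] y_def[symmetric] norm_of_real using y by simp
    moreover have "(1 - R) * cmod E \<le> cmod (1 - w) * cmod E"
      by (intro mult_right_mono \<open>1 - R \<le> cmod (1 - w)\<close>) auto
    ultimately have "(1 - R) * cmod E \<le> 2 * (1 - t)" using y by linarith
    then have E: "cmod E \<le> 2 / (1 - R) * (1 - t)" using R by (simp add: field_simps)
    have cs: "cc s C = s - cb s C" by (simp add: coef_defs field_simps)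
    \<comment> \<open>\<open>E\<close> and \<open>y\<close> are both of order \<open>1 - t\<close>,
      with constants \<open>2 / (1 - R)\<close> and 2; this is the origin of
      \<open>N\<close>.\<close>
    have "E = of_real y + of_real t * (of_real (cc s C) - \<beta>)"
      unfolding E_def y_def cs by (simp add: algebra_simps power2_eq_square)
    then have "of_real t * (of_real (cc s C) - \<beta>) = E - of_real y" by simp
    then have tc: "cmod (of_real t * (of_real (cc s C) - \<beta>)) \<le> N * (1 - t)"
      using norm_triangle_ineq4[of E "of_real y"] E y unfolding N_def by (simp add: distrib_right)
    have "t * (cb s C * cmod (w - of_real (cc s C / cb s C))) = cmod (of_real t * (of_real (cc s C) - \<beta>))"
    proof -
      have "of_real (cb s C) * (of_real (cc s C / cb s C) - w) = of_real (cc s C) - \<beta>"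
        using b by (simp add: \<beta>_def algebra_simps)
      then have "cb s C * cmod (of_real (cc s C / cb s C) - w) = cmod (of_real (cc s C) - \<beta>)"
        using b by (metis norm_mult norm_of_real abs_of_pos)
      then show ?thesis using t by (simp add: norm_mult norm_minus_commute)
    qed
    then have "t * (cb s C * cmod (w - of_real (cc s C / cb s C))) \<le> N * (1 - t)" using tc by simp
    then have w1: "t * cmod (w - of_real (cc s C / cb s C)) \<le> N / cb s C * (1 - t)"
      using b by (simp add: field_simps)
    have "(1 - k) * (1 - of_real t * \<beta>) = of_real (1 - t) + of_real t * (of_real (cc s C) - \<beta>)"
    proof -
      have "k * (1 - of_real t * \<beta>) = of_real t * of_real (ca s C)" using branch_k_bw[OF br] by (simp add: \<beta>_def)
      moreover have "complex_of_real (ca s C) = 1 - of_real (cc s C)" by (simp add: coef_defs)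
      ultimately show ?thesis by (simp add: algebra_simps)
    qed
    then have "cmod (1 - k) * cmod (1 - of_real t * \<beta>) \<le> (1 - t) + N * (1 - t)"
      unfolding norm_mult[symmetric] using norm_triangle_ineq[of "of_real (1 - t)" "of_real t * (of_real (cc s C) - \<beta>)"] tc t
      by (simp del: of_real_diff)
    moreover have "1 - \<rho> \<le> cmod (1 - of_real t * \<beta>)"
    proof -
      have "cmod \<beta> \<le> s / 2 * \<rho>" unfolding \<beta>_def \<rho>_def using branch_bw_le_norm[OF s C' br] t k by simp
      also have "\<dots> \<le> 1 * \<rho>" using s \<rho> by (intro mult_right_mono) auto
      finally have "t * cmod \<beta> \<le> 1 * \<rho>" using t by (intro mult_mono) auto
      then show ?thesis using norm_triangle_ineq2[of 1 "of_real t * \<beta>"] t by (simp add: norm_mult)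
    qed
    then have "cmod (1 - k) * (1 - \<rho>) \<le> cmod (1 - k) * cmod (1 - of_real t * \<beta>)" by (intro mult_left_mono) auto
    ultimately have "cmod (1 - k) * (1 - \<rho>) \<le> (1 + N) * (1 - t)" by (simp add: distrib_right)
    then have k1: "cmod (1 - k) \<le> (1 + N) / (1 - \<rho>) * (1 - t)" using \<rho> by (simp add: field_simps)
    have "N / cb s C * (1 - t) \<le> M * (1 - t)" "(1 + N) / (1 - \<rho>) * (1 - t) \<le> M * (1 - t)"
      using N b \<rho> t unfolding M_def by (intro mult_right_mono; simp add: divide_nonneg_pos)+
    then show ?thesis using k1 w1 by linarith
  qed
  ultimately show thesis using that by blast
qed

section \<open>Boundary symbols bounded away from 1\<close>

text \<open>The binomial theorem without its first term. Hence \<open>1 - bsym\<close> is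
  \<open>(1 - k) ^ \<sigma>\<close> for extrapolation: only \<open>k = 1\<close> is critical, with
  multiplicity \<open>\<sigma>\<close>.\<close>

lemma alternating_binomial_sum:
  fixes k :: complex
  shows "(\<Sum>j<\<sigma>. (-1) ^ j * of_nat (\<sigma> choose (j + 1)) * k ^ Suc j) = 1 - (1 - k) ^ \<sigma>"
proof -
  have "(1 - k) ^ \<sigma> = (\<Sum>i\<le>\<sigma>. of_nat (\<sigma> choose i) * (- k) ^ i)"
    using binomial_ring[of "- k" 1 \<sigma>] by simp
  also have "\<dots> = 1 + (\<Sum>i<\<sigma>. of_nat (\<sigma> choose Suc i) * (- k) ^ Suc i)"
    unfolding sum.atMost_shift by simp
  also have "(\<Sum>i<\<sigma>. of_nat (\<sigma> choose Suc i) * (- k) ^ Suc i) = - (\<Sum>j<\<sigma>. (-1) ^ j * of_nat (\<sigma> choose (j + 1)) * k ^ Suc j)"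
    unfolding sum_negf[symmetric] by (intro sum.cong refl) (simp add: power_minus[of k] mult_ac)
  finally show ?thesis by simp
qed

lemma bsym_simps:
  "bsym BounceBack C k w = w"
  "bsym AntiBounceBack C k w = - w"
  "bsym TwoStepsAntiBounceBack C k w = - (k * w)"
  "bsym (Extrapolation \<sigma>) C k w = 1 - (1 - k) ^ \<sigma>"
  "bsym KineticDirichlet C k w = 0"
  "bsym (ExtrapolatedEquilibrium 1) C k w = of_real ((1 + C) / 2) * (k + w)"
  "bsym (ExtrapolatedEquilibrium 3) C k w = of_real ((1 + C) / 2) * ((3 - 3 * k + k\<^sup>2) * (k + w))"
  "bsym Future C k w = of_real ((1 + C) / 2) * (k + k\<^sup>2 * w)"
  "bsym Invented C k w = k + 2 * w"
  using alternating_binomial_sum[of \<sigma> k]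
  by (simp_all add: bsym_def eval_nat_numeral) (simp add: algebra_simps)

definition on_branch :: "real \<Rightarrow> real \<Rightarrow> complex \<Rightarrow> complex \<Rightarrow> complex \<Rightarrow> bool" where
  "on_branch s C x k w \<longleftrightarrow> cmod x < 1 \<and> cmod k \<le> cmod x \<and> branch s C x k w"

lemma on_branch_D:
  assumes "on_branch s C x k w"
  shows "cmod x < 1" "cmod k \<le> cmod x" "branch s C x k w" "cmod k < 1" "cmod (x * k) < 1"
proof -
  show x: "cmod x < 1" and k: "cmod k \<le> cmod x" and "branch s C x k w" using assms by (auto simp: on_branch_def)
  then show k1: "cmod k < 1" by simp
  then show "cmod (x * k) < 1" unfolding norm_mult using x mult_strict_mono[of "cmod x" 1 "cmod k" 1] by simp
qed

lemma on_branch_w_sq: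
  assumes s: "0 < s" "s \<le> 2" and C: "\<bar>C\<bar> \<le> 1" and ob: "on_branch s C x k w"
  shows "(1 + C) * (cmod w)\<^sup>2 \<le> 1 - C"
proof -
  have "(1 + C) * (cmod w)\<^sup>2 \<le> (1 - C) * (cmod x)\<^sup>2"
    using branch_w_le[OF s C on_branch_D(3)[OF ob] _ on_branch_D(5)[OF ob]] on_branch_D(1)[OF ob] by simp
  also have "\<dots> \<le> (1 - C) * 1"
    using C on_branch_D(1)[OF ob] by (intro mult_left_mono power_le_one) auto
  finally show ?thesis by simp
qed

lemma on_branch_w_le:
  assumes s: "0 < s" "s \<le> 2" and C: "-1 < C" "C \<le> 1" and ob: "on_branch s C x k w"
  shows "cmod w \<le> sqrt ((1 - C) / (1 + C))"
proof -
  have "(1 + C) * (cmod w)\<^sup>2 \<le> 1 - C" using on_branch_w_sq[OF s _ ob] C by simp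
  then have "(cmod w)\<^sup>2 \<le> (1 - C) / (1 + C)" using C by (simp add: pos_le_divide_eq mult.commute)
  then show ?thesis by (rule real_le_rsqrt)
qed

text \<open>At \<open>C = -1\<close> the energy bound on \<open>w\<close> is void. There
  \<open>k = x (1 - s)\<close> exactly, and the denominator \<open>1 - x k\<close> of
  \<open>w\<close> is at least \<open>1 - |1 - s|\<close>.\<close>

lemma on_branch_w_bounded:
  assumes s: "0 < s" "s \<le> 2" and C: "\<bar>C\<bar> \<le> 1" and sC: "C = -1 \<Longrightarrow> s < 2"
  shows "\<exists>M>0. \<forall>x k w. on_branch s C x k w \<longrightarrow> cmod w \<le> M"
proof (cases "C = -1")
  case False
  then have C1: "-1 < C" "C \<le> 1" using C by auto
  have "cmod w \<le> sqrt ((1 - C) / (1 + C)) + 1" if "on_branch s C x k w" for x k w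
    using on_branch_w_le[OF s C1 that] by simp
  moreover have "0 < sqrt ((1 - C) / (1 + C)) + 1" using C1 by (intro add_nonneg_pos) auto
  ultimately show ?thesis by blast
next
  case True
  define m where "m = 1 - \<bar>1 - s\<bar>"
  have m: "0 < m" using s sC[OF True] by (auto simp: m_def)
  have "cmod w \<le> s / m" if ob: "on_branch s C x k w" for x k w
  proof -
    note br = on_branch_D(3)[OF ob] and x = on_branch_D(1)[OF ob]
    have k: "k = x * of_real (1 - s)" using br True by (simp add: branch_def coef_defs)
    have w: "w * (1 - x * k) = x * of_real s" using branch_w_dk[OF br] True by (simp add: coef_defs)
    have "cmod (x * k) \<le> \<bar>1 - s\<bar>"
    proof -
      have "cmod (x * k) = (cmod x * cmod x) * \<bar>1 - s\<bar>" unfolding k by (simp add: norm_mult del: of_real_diff)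
      also have "\<dots> \<le> 1 * \<bar>1 - s\<bar>" using x by (intro mult_right_mono mult_le_one) auto
      finally show ?thesis by simp
    qed
    then have "m \<le> cmod (1 - x * k)" using norm_triangle_ineq2[of 1 "x * k"] by (simp add: m_def)
    then have "cmod w * m \<le> cmod w * cmod (1 - x * k)" by (rule mult_left_mono) simp
    also have "\<dots> = cmod x * s" unfolding norm_mult[symmetric] w using s by (simp add: norm_mult)
    also have "\<dots> \<le> 1 * s" using x s by (intro mult_right_mono) auto
    finally show ?thesis using m by (simp add: pos_le_divide_eq)
  qed
  moreover have "0 < s / m" using s m by simp
  ultimately show ?thesis by blast
qed

text \<open>The numerators \<open>1 + u k w\<close> are bounded, since \<open>w\<close> is; a
  uniform gap between the symbol and 1 settles both moments at once.\<close>

lemma SS_est_if_symbol_away_from_1: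
  assumes s: "0 < s" "s \<le> 2" and C: "\<bar>C\<bar> \<le> 1" and sC: "\<bar>C\<bar> = 1 \<Longrightarrow> s < 2" and lam: "lam > 0"
    and \<delta>: "0 < \<delta>" and bd: "\<And>x k w. on_branch s C x k w \<Longrightarrow> \<delta> \<le> cmod (1 - bsym b C k w)"
  shows "SS_est s C b lam"
proof -
  obtain M where M: "0 < M" "\<And>x k w. on_branch s C x k w \<Longrightarrow> cmod w \<le> M"
    using on_branch_w_bounded[OF s C] sC by fastforce
  have "est u s C b lam" if u: "\<bar>u\<bar> = 1" for u
  proof (rule est_if_transfer_bounded[OF s C _ lam, where M = "(1 + M) / \<delta>"])
    fix x k w assume "cmod x < 1" "cmod k \<le> cmod x" "branch s C x k w"
    then have ob: "on_branch s C x k w" by (simp add: on_branch_def)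
    from bd[OF ob] show "bsym b C k w \<noteq> 1" using \<delta> by auto
    have "cmod (k * w) \<le> 1 * M"
      unfolding norm_mult using M(2)[OF ob] on_branch_D(4)[OF ob] by (intro mult_mono) auto
    then have "cmod (of_real u * (k * w)) \<le> M" using u by (simp add: norm_mult)
    then have "cmod (1 + of_real u * (k * w)) \<le> 1 + M" by (intro norm_triangle_le) simp
    also have "\<dots> = (1 + M) / \<delta> * \<delta>" using \<delta> by simp
    also have "\<dots> \<le> (1 + M) / \<delta> * cmod (1 - bsym b C k w)" using bd[OF ob] \<delta> M by (intro mult_left_mono) auto
    finally show "cmod (1 + of_real u * (k * w)) \<le> (1 + M) / \<delta> * cmod (1 - bsym b C k w)" .
  qed (use sC in auto)
  then show ?thesis unfolding SS_est_iff[OF lam] by simp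
qed

lemma SS_KineticDirichlet:
  assumes "0 < s" "s \<le> 2" "\<bar>C\<bar> \<le> 1" "\<bar>C\<bar> = 1 \<Longrightarrow> s < 2" "lam > 0"
  shows "SS_est s C KineticDirichlet lam"
  by (rule SS_est_if_symbol_away_from_1[OF assms, of 1]) (simp_all add: bsym_simps)

text \<open>At an inflow boundary the reflection coefficient is strictly contractive,
  \<open>|w| \<le> R < 1\<close>.\<close>

lemma SS_inflow_reflection:
  assumes s: "0 < s" "s \<le> 2" and C: "0 < C" "C \<le> 1" and sC: "\<bar>C\<bar> = 1 \<Longrightarrow> s < 2" and lam: "lam > 0"
    and b: "b \<in> {BounceBack, AntiBounceBack, TwoStepsAntiBounceBack}"
  shows "SS_est s C b lam"
proof -
  define R where "R = sqrt ((1 - C) / (1 + C))"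
  have R: "0 \<le> R" "R < 1" using C by (simp_all add: R_def)
  have C': "\<bar>C\<bar> \<le> 1" using C by simp
  show ?thesis
  proof (rule SS_est_if_symbol_away_from_1[OF s C' sC lam])
    show "0 < 1 - R" using R by simp
    fix x k w assume ob: "on_branch s C x k w"
    have w: "cmod w \<le> R" unfolding R_def using on_branch_w_le[OF s _ _ ob] C by simp
    have "cmod (k * w) \<le> 1 * R"
      unfolding norm_mult using w on_branch_D(4)[OF ob] by (intro mult_mono) auto
    then have "cmod (bsym b C k w) \<le> R" using b w by (auto simp: bsym_simps)
    then show "1 - R \<le> cmod (1 - bsym b C k w)" using norm_triangle_ineq2[of 1 "bsym b C k w"] by simp
  qed
qed

text \<open>Here \<open>1 - bsym\<close> is \<open>1 + k w\<close>, and \<open>|1 - s| < 1\<close>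
  makes the bound of \<open>one_plus_product_lower\<close> uniform.\<close>

lemma SS_outflow_two_steps:
  assumes s: "0 < s" "s < 2" and C: "\<bar>C\<bar> \<le> 1" and lam: "lam > 0"
  shows "SS_est s C TwoStepsAntiBounceBack lam"
proof (rule SS_est_if_symbol_away_from_1[OF s(1) _ C s(2) lam])
  have "(1 - s)\<^sup>2 < 1" using s by (simp add: abs_square_less_1)
  then show "0 < (1 - (1 - s)\<^sup>2) / 6" by simp
  fix x k w assume ob: "on_branch s C x k w"
  have "(1 - s)\<^sup>2 * (cmod x)\<^sup>2 \<le> (1 - s)\<^sup>2 * 1"
    using on_branch_D(1)[OF ob] by (intro mult_left_mono power_le_one) auto
  then show "(1 - (1 - s)\<^sup>2) / 6 \<le> cmod (1 - bsym TwoStepsAntiBounceBack C k w)"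
    using one_plus_product_lower[OF s(1) _ C on_branch_D(1,3)[OF ob]] s by (simp add: bsym_simps)
qed (use s in simp)

text \<open>If \<open>k\<close> is near 1, the quadratic for \<open>k\<close> forces
  \<open>x\<close> near 1, and then \<open>branch_w_dk\<close> forces \<open>w\<close> near
  \<open>c / b = R^2\<close>. But the energy gives \<open>|w| \<le> R\<close>, and
  \<open>R < R^2\<close> when \<open>C < 0\<close>. The proof turns this into
  \<open>c - R b \<le> L |1 - k|\<close>.\<close>

lemma outflow_k_away_from_1:
  assumes s: "0 < s" "s < 2" and C: "-1 \<le> C" "C < 0"
  shows "\<exists>\<delta>>0. \<forall>x k w. on_branch s C x k w \<longrightarrow> \<delta> \<le> cmod (1 - k)"
proof -
  define m where "m = 1 - \<bar>1 - s\<bar>"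
  have m: "0 < m" using s by (auto simp: m_def)
  have C': "\<bar>C\<bar> \<le> 1" using C by simp
  show ?thesis
  proof (cases "C = -1")
    case True
    have "m \<le> cmod (1 - k)" if ob: "on_branch s C x k w" for x k w
    proof -
      have k: "k = x * of_real (1 - s)" using on_branch_D(3)[OF ob] True by (simp add: branch_def coef_defs)
      have "cmod k = cmod x * \<bar>1 - s\<bar>" unfolding k by (simp add: norm_mult del: of_real_diff)
      also have "\<dots> \<le> 1 * \<bar>1 - s\<bar>" using on_branch_D(1)[OF ob] by (intro mult_right_mono) auto
      finally show ?thesis using norm_triangle_ineq2[of 1 k] by (simp add: m_def)
    qed
    then show ?thesis using m by blast
  next
    case False
    then have C1: "-1 < C" using C by simp
    define b c d R where "b = cb s C" and "c = cc s C" and "d = cd s C" and "R = sqrt ((1 - C) / (1 + C))"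
    have b: "0 < b" and c: "0 < c" using s C1 C by (simp_all add: b_def c_def cb_def cc_def)
    have R: "1 < R" using C1 C by (simp add: R_def)
    have R2: "R\<^sup>2 * b = c" using C1 C by (simp add: R_def b_def c_def cb_def cc_def)
    have d: "\<bar>d\<bar> \<le> 1" unfolding d_def using abs_cd_le[OF s(1) _ C'] s by simp
    have bd: "1 - d = b" by (simp add: b_def d_def coef_defs)
    define L where "L = (c + R) * (6 / m) + R"
    have L: "0 < L" using c R m by (simp add: L_def add_pos_pos)
    have "c - R * b = R * b * (R - 1)" using R2 by (simp add: algebra_simps power2_eq_square)
    then have g: "0 < c - R * b" using R b by simp
    have "(c - R * b) / L \<le> cmod (1 - k)" if ob: "on_branch s C x k w" for x k w
    proof -
      note br = on_branch_D(3)[OF ob] and x = on_branch_D(1)[OF ob]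
      define e where "e = 1 - k"
      have ke: "k = 1 - e" by (simp add: e_def)
      have e2: "cmod e \<le> 2" unfolding e_def using on_branch_D(4)[OF ob] by (intro order_trans[OF norm_triangle_ineq4]) simp
      have ca: "complex_of_real (ca s C) = 2 - of_real s - of_real d" by (simp add: d_def coef_defs field_simps)
      \<comment> \<open>The quadratic for \<open>k\<close> expanded around \<open>k = 1\<close>; its
        constant term vanishes at \<open>x = 1\<close>, and the cofactor is at most
        \<open>2 + 2 + 2\<close>.\<close>
      have "(1 - x) * (1 - of_real (1 - s) * x) = e * ((1 + of_real (1 - s) * x\<^sup>2) - 2 * of_real d * x + of_real d * x * e)"
        using branch_k_quad[OF br] unfolding ke ca d_def[symmetric] by (simp add: algebra_simps power2_eq_square)
      then have "cmod (1 - x) * cmod (1 - of_real (1 - s) * x)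
          = cmod e * cmod ((1 + of_real (1 - s) * x\<^sup>2) - 2 * of_real d * x + of_real d * x * e)"
        by (metis norm_mult)
      also have "\<dots> \<le> cmod e * 6"
      proof (rule mult_left_mono)
        have "cmod (of_real (1 - s) * x\<^sup>2) \<le> 1 * 1"
          unfolding norm_mult norm_power norm_of_real using s x by (intro mult_mono power_le_one) auto
        then have n1: "cmod (1 + of_real (1 - s) * x\<^sup>2) \<le> 2" by (intro norm_triangle_le) simp
        have dx: "cmod (of_real d * x) \<le> 1 * 1"
          unfolding norm_mult norm_of_real using d x by (intro mult_mono) auto
        then have n2: "cmod (2 * of_real d * x) \<le> 2" by (simp add: norm_mult)
        have "cmod (of_real d * x * e) \<le> 1 * 2"
          unfolding norm_mult[of "of_real d * x"] using dx e2 by (intro mult_mono) auto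
        then show "cmod ((1 + of_real (1 - s) * x\<^sup>2) - 2 * of_real d * x + of_real d * x * e) \<le> 6"
          using n1 n2 norm_triangle_ineq4[of "1 + of_real (1 - s) * x\<^sup>2" "2 * of_real d * x"]
          by (intro norm_triangle_le) simp
      qed simp
      finally have "cmod (1 - x) * cmod (1 - of_real (1 - s) * x) \<le> cmod e * 6" .
      moreover have "m \<le> cmod (1 - of_real (1 - s) * x)"
      proof -
        have "cmod (of_real (1 - s) * x) \<le> \<bar>1 - s\<bar> * 1"
          unfolding norm_mult norm_of_real using x by (intro mult_left_mono) auto
        then show ?thesis using norm_triangle_ineq2[of 1 "of_real (1 - s) * x"] by (simp add: m_def)
      qed
      then have "cmod (1 - x) * m \<le> cmod (1 - x) * cmod (1 - of_real (1 - s) * x)" by (rule mult_left_mono) simp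
      ultimately have "cmod (1 - x) * m \<le> 6 * cmod e" by simp
      then have x1: "cmod (1 - x) \<le> 6 / m * cmod e" using m by (simp add: field_simps)
      have w: "cmod w \<le> R" unfolding R_def using on_branch_w_le[OF s(1) _ C1 _ ob] s C by simp
      have split: "1 - x * (of_real d * k) = of_real b + of_real d * ((1 - x) + x * e)"
        unfolding ke bd[symmetric] by (simp add: algebra_simps)
      have "c - c * cmod (1 - x) \<le> cmod (x * of_real c)"
      proof -
        have "1 - cmod (1 - x) \<le> cmod x" using norm_triangle_ineq2[of 1 "1 - x"] by simp
        then have "c * (1 - cmod (1 - x)) \<le> c * cmod x" using c by (intro mult_left_mono) auto
        then show ?thesis using c by (simp add: norm_mult algebra_simps)
      qed
      also have "cmod (x * of_real c) = cmod w * cmod (1 - x * (of_real d * k))"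
        unfolding norm_mult[symmetric] using branch_w_dk[OF br] by (simp add: c_def d_def)
      also have "\<dots> \<le> R * (b + (cmod (1 - x) + cmod e))"
      proof (rule mult_mono[OF w])
        have "cmod (x * e) \<le> 1 * cmod e" unfolding norm_mult using x by (intro mult_right_mono) auto
        then have "cmod ((1 - x) + x * e) \<le> cmod (1 - x) + cmod e" by (intro norm_triangle_le) simp
        then have "cmod (of_real d * ((1 - x) + x * e)) \<le> 1 * (cmod (1 - x) + cmod e)"
          unfolding norm_mult norm_of_real using d by (intro mult_mono) auto
        then show "cmod (1 - x * (of_real d * k)) \<le> b + (cmod (1 - x) + cmod e)"
          unfolding split using b by (intro norm_triangle_le) simp
      qed (use R in auto)
      finally have "c - R * b \<le> (c + R) * cmod (1 - x) + R * cmod e" by (simp add: algebra_simps)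
      also have "\<dots> \<le> (c + R) * (6 / m * cmod e) + R * cmod e"
        using c R by (intro add_right_mono mult_left_mono x1) auto
      also have "\<dots> = L * cmod e" by (simp add: L_def distrib_right)
      finally show ?thesis using L by (simp add: e_def pos_divide_le_eq mult.commute)
    qed
    moreover have "0 < (c - R * b) / L" using g L by simp
    ultimately show ?thesis by blast
  qed
qed

lemma SS_outflow_extrapolation:
  assumes s: "0 < s" "s < 2" and C: "-1 \<le> C" "C < 0" and lam: "lam > 0"
  shows "SS_est s C (Extrapolation \<sigma>) lam"
proof -
  obtain \<delta> where \<delta>: "0 < \<delta>" "\<And>x k w. on_branch s C x k w \<Longrightarrow> \<delta> \<le> cmod (1 - k)"
    using outflow_k_away_from_1[OF s C] by blast
  show ?thesis
  proof (rule SS_est_if_symbol_away_from_1[OF s(1) _ _ s(2) lam])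
    show "0 < \<delta> ^ \<sigma>" using \<delta> by simp
    show "\<delta> ^ \<sigma> \<le> cmod (1 - bsym (Extrapolation \<sigma>) C k w)" if "on_branch s C x k w" for x k w
      using \<delta>(1) \<delta>(2)[OF that] by (simp add: bsym_simps norm_power power_mono)
  qed (use s C in auto)
qed

section \<open>Failure of the estimates\<close>

lemma leapfrog_coefs: "ca 2 C = C" "cb 2 C = 1 + C" "cc 2 C = 1 - C" "cd 2 C = - C"
  by (simp_all add: coef_defs field_simps)

text \<open>With \<open>z = 1 / x\<close> this is the dispersion relation
  \<open>z - 1 / z = C (1 / k - k)\<close> of the leapfrog scheme.\<close>

lemma leapfrog_relation:
  assumes br: "branch 2 C x k w"
  shows "(1 - x\<^sup>2) * k = of_real C * x * (1 - k\<^sup>2)"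
  using branch_k_quad[OF br] by (simp add: leapfrog_coefs algebra_simps)

text \<open>For \<open>0 < |y| < 1\<close> the real part of \<open>1 / y - y\<close> has the sign of
  \<open>Re y\<close>, and a negative \<open>C\<close> reverses it across the dispersion
  relation.\<close>

lemma leapfrog_Re_sign:
  assumes C: "C < 0" and ob: "on_branch 2 C x k w" and x: "0 < Re x"
  shows "Re k < 0"
proof -
  have x0: "x \<noteq> 0" using x by auto
  have k0: "k \<noteq> 0"
  proof
    assume "k = 0"
    then have "complex_of_real C * x = 0" using leapfrog_relation[OF on_branch_D(3)[OF ob]] by simp
    then show False using C x0 by simp
  qed
  have "1 / x - x = of_real C * (1 / k - k)"
    using leapfrog_relation[OF on_branch_D(3)[OF ob]] x0 k0 by (simp add: field_simps power2_eq_square)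
  then have "Re (1 / x - x) = C * Re (1 / k - k)" by simp
  moreover have re: "Re (1 / y - y) = Re y * (1 / (cmod y)\<^sup>2 - 1)" for y
    by (simp add: Re_divide cmod_power2 algebra_simps)
  ultimately have eq: "Re x * (1 / (cmod x)\<^sup>2 - 1) = C * (Re k * (1 / (cmod k)\<^sup>2 - 1))" by simp
  have pos: "0 < 1 / (cmod y)\<^sup>2 - 1" if "y \<noteq> 0" "cmod y < 1" for y
    using that by (simp add: abs_square_less_1)
  have "0 < C * (Re k * (1 / (cmod k)\<^sup>2 - 1))"
    unfolding eq[symmetric] using x pos[OF x0 on_branch_D(1)[OF ob]] by simp
  then have "Re k * (1 / (cmod k)\<^sup>2 - 1) < 0" using C by (simp add: zero_less_mult_iff)
  then show ?thesis using pos[OF k0 on_branch_D(4)[OF ob]] by (simp add: mult_less_0_iff)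
qed

lemma one_le_cmod_one_minus: "Re k \<le> 0 \<Longrightarrow> 1 \<le> cmod (1 - k)"
  using complex_Re_le_cmod[of "1 - k"] by simp

lemma product_not_minus_1:
  assumes s: "0 < s" "s \<le> 2" and C: "\<bar>C\<bar> \<le> 1" and ob: "on_branch s C x k w"
  shows "0 < cmod (1 + k * w)"
proof -
  have "(1 - s)\<^sup>2 \<le> 1" using s by (simp add: abs_square_le_1)
  then have "(1 - s)\<^sup>2 * (cmod x)\<^sup>2 \<le> 1 * (cmod x)\<^sup>2" by (rule mult_right_mono) simp
  moreover have "(cmod x)\<^sup>2 < 1" using on_branch_D(1)[OF ob] by (simp add: abs_square_less_1)
  ultimately have "0 < 6 * cmod (1 + k * w)"
    using one_plus_product_lower[OF s C on_branch_D(1,3)[OF ob]] by linarith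
  then show ?thesis by simp
qed

text \<open>For \<open>u = 1\<close> numerator and denominator of the transfer function are both
  \<open>1 + k w\<close> and cancel exactly.\<close>

lemma SSOO_two_steps:
  assumes s: "0 < s" "s \<le> 2" and C: "\<bar>C\<bar> \<le> 1" and sC: "C = 1 \<Longrightarrow> s < 2" and lam: "lam > 0"
  shows "est 1 s C TwoStepsAntiBounceBack lam"
proof (rule est_if_transfer_bounded[OF s C sC lam, where M = 1])
  fix x k w assume "cmod x < 1" "cmod k \<le> cmod x" "branch s C x k w"
  then have "on_branch s C x k w" by (simp add: on_branch_def)
  from product_not_minus_1[OF s C this] have "1 + k * w \<noteq> 0" by auto
  then show "bsym TwoStepsAntiBounceBack C k w \<noteq> 1"
    by (metis bsym_simps(3) add_eq_0_iff equation_minus_iff)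
qed (auto simp: bsym_simps)

text \<open>The only danger is \<open>x\<close> near -1, where \<open>k\<close> tends to 1. There
  \<open>(1 + C) x (1 + k w) = (1 + x) - (1 - k)\<close>, and the dispersion relation gives
  \<open>|1 + x| = O(|1 - k|)\<close>: the numerator vanishes as fast as the denominator. Elsewhere
  \<open>|1 - k| \<ge> 1 / 2\<close>, from the sign of \<open>Re k\<close> or from
  \<open>|k| \<le> |x|\<close>.\<close>

lemma SSOO_outflow_extrapolation_1:
  assumes C: "-1 < C" "C < 0" and lam: "lam > 0"
  shows "est 1 2 C (Extrapolation 1) lam"
proof -
  define R where "R = sqrt ((1 - C) / (1 + C))"
  have R: "0 \<le> R" using C by (simp add: R_def)
  define N where "N = 1 + 6 / (- C)"
  have N: "0 < N" using C by (simp add: N_def add_pos_pos divide_pos_neg)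
  define M where "M = 2 * N / (1 + C) + 2 * (1 + R)"
  have MN: "2 * N / (1 + C) \<le> M" "2 * (1 + R) \<le> M" using N C R by (simp_all add: M_def)
  have C': "\<bar>C\<bar> \<le> 1" using C by simp
  show ?thesis
  proof (rule est_if_transfer_bounded[OF _ _ C' _ lam, where M = M])
    fix x k w assume "cmod x < 1" "cmod k \<le> cmod x" "branch 2 C x k w"
    then have ob: "on_branch 2 C x k w" by (simp add: on_branch_def)
    note br = on_branch_D(3)[OF ob] and x = on_branch_D(1)[OF ob] and k = on_branch_D(4)[OF ob]
    show "bsym (Extrapolation 1) C k w \<noteq> 1" using k by (auto simp: bsym_simps)
    have w: "cmod w \<le> R" unfolding R_def using on_branch_w_le[OF _ _ C(1) _ ob] C by simp
    have "cmod (k * w) \<le> 1 * R" unfolding norm_mult using w k by (intro mult_mono) auto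
    then have p: "cmod (1 + k * w) \<le> 1 + R" by (intro norm_triangle_le) simp
    have small: "cmod (1 + k * w) \<le> M * cmod (1 - k)" if "1 / 2 \<le> cmod (1 - k)"
    proof -
      have "1 + R = 2 * (1 + R) * (1 / 2)" by simp
      also have "\<dots> \<le> M * cmod (1 - k)" using MN R that by (intro mult_mono) auto
      finally show ?thesis using p by simp
    qed
    have "cmod (1 + k * w) \<le> M * cmod (1 - k)"
    proof (cases "0 < Re x \<or> cmod x < 1 / 2")
      case True
      then have "1 / 2 \<le> cmod (1 - k)"
      proof
        assume "0 < Re x"
        then show ?thesis using one_le_cmod_one_minus[of k] leapfrog_Re_sign[OF C(2) ob] by simp
      next
        assume "cmod x < 1 / 2"
        then show ?thesis using on_branch_D(2)[OF ob] norm_triangle_ineq2[of 1 k] by simp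
      qed
      then show ?thesis by (rule small)
    next
      case False
      then have x': "Re x \<le> 0" "1 / 2 \<le> cmod x" by auto
      \<comment> \<open>Allows \<open>k\<close> to be cancelled from the left side of the dispersion
        relation.\<close>
      have k_low: "cmod x * (- C) \<le> 3 * cmod k"
      proof -
        have "x * of_real C = k * (1 - x\<^sup>2 + x * of_real C * k)"
          using leapfrog_relation[OF br] by (simp add: algebra_simps power2_eq_square)
        then have "cmod x * (- C) = cmod k * cmod (1 - x\<^sup>2 + x * of_real C * k)"
          using C by (metis norm_mult norm_of_real abs_of_neg)
        also have "\<dots> \<le> cmod k * 3"
        proof (rule mult_left_mono)
          have "cmod (x * of_real C * k) \<le> 1 * 1 * 1"
            unfolding norm_mult norm_of_real using x k C' by (intro mult_mono) auto
          moreover have "cmod (1 - x\<^sup>2) \<le> 2"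
            using norm_triangle_ineq4[of 1 "x\<^sup>2"] power_le_one[of "cmod x" 2] x by (simp add: norm_power)
          ultimately show "cmod (1 - x\<^sup>2 + x * of_real C * k) \<le> 3" by (intro norm_triangle_le) simp
        qed simp
        finally show ?thesis by simp
      qed
      have "cmod (1 - x) * cmod (1 + x) * cmod k = (- C) * cmod x * (cmod (1 - k) * cmod (1 + k))"
      proof -
        have "(1 - x) * (1 + x) * k = of_real C * x * ((1 - k) * (1 + k))"
          using leapfrog_relation[OF br] by (simp add: algebra_simps power2_eq_square)
        then show ?thesis using C by (metis norm_mult norm_of_real abs_of_neg)
      qed
      also have "\<dots> \<le> 1 * cmod x * (cmod (1 - k) * 2)"
        using C x k norm_triangle_ineq[of 1 k] by (intro mult_mono mult_nonneg_nonneg) auto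
      finally have a: "cmod (1 - x) * cmod (1 + x) * cmod k \<le> 2 * cmod x * cmod (1 - k)" by simp
      have "1 * cmod (1 + x) * (cmod x * (- C) / 3) \<le> cmod (1 - x) * cmod (1 + x) * cmod k"
        using one_le_cmod_one_minus[OF x'(1)] k_low C
        by (intro mult_mono mult_nonneg_nonneg) (auto intro: mult_nonneg_nonpos)
      then have "cmod x * (cmod (1 + x) * (- C) / 3) \<le> cmod x * (2 * cmod (1 - k))" using a by (simp add: mult_ac)
      then have "cmod (1 + x) * (- C) / 3 \<le> 2 * cmod (1 - k)" using x'(2) by (subst (asm) mult_le_cancel_left_pos) auto
      then have x1: "cmod (1 + x) \<le> 6 / (- C) * cmod (1 - k)" using C by (simp add: field_simps)
      have "of_real (1 + C) * x * (1 + k * w) = (1 + x) - (1 - k)"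
      proof -
        have "k = x * (of_real C + of_real (1 + C) * (k * w))" using br by (simp add: branch_def leapfrog_coefs)
        then have "x * (of_real C + of_real (1 + C) * (k * w)) = k" by simp
        then show ?thesis by (simp add: algebra_simps)
      qed
      then have "(1 + C) * cmod x * cmod (1 + k * w) = cmod ((1 + x) - (1 - k))"
        using C by (metis norm_mult norm_of_real abs_of_pos add.commute diff_gt_0_iff_gt diff_minus_eq_add)
      also have "\<dots> \<le> N * cmod (1 - k)"
        using norm_triangle_ineq4[of "1 + x" "1 - k"] x1 by (simp add: N_def algebra_simps)
      finally have n: "(1 + C) * cmod x * cmod (1 + k * w) \<le> N * cmod (1 - k)" .
      have "(1 + C) * (1 / 2) * cmod (1 + k * w) \<le> (1 + C) * cmod x * cmod (1 + k * w)"
        using C x' by (intro mult_right_mono mult_left_mono) auto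
      then have "(1 + C) * (1 / 2) * cmod (1 + k * w) \<le> N * cmod (1 - k)" using n by simp
      then have "cmod (1 + k * w) \<le> 2 * N / (1 + C) * cmod (1 - k)" using C by (simp add: field_simps)
      also have "\<dots> \<le> M * cmod (1 - k)" by (rule mult_right_mono[OF MN(1)]) simp
      finally show ?thesis .
    qed
    then show "cmod (1 + of_real 1 * (k * w)) \<le> M * cmod (1 - bsym (Extrapolation 1) C k w)" by (simp add: bsym_simps)
  qed (use C in auto)
qed

lemma branch_seq_on_branch:
  assumes "branch_seq s C k w"
  shows "on_branch s C (of_real (tseq n)) (k n) (w n)"
  using assms tseq[of n] by (simp add: branch_seq_def on_branch_def)

lemma tseq_bound_tendsto_0:
  assumes bd: "\<And>n. tseq n * a n \<le> M * (1 - tseq n)" and a: "\<And>n. 0 \<le> a n"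
  shows "a \<longlonglongrightarrow> 0"
proof (rule tendsto_sandwich[of "\<lambda>_. 0" _ _ "\<lambda>n. M * (1 - tseq n) / tseq n"])
  show "\<forall>\<^sub>F n in sequentially. a n \<le> M * (1 - tseq n) / tseq n"
    using bd tseq(1) by (simp add: pos_le_divide_eq mult.commute)
  have "(\<lambda>n. M * (1 - tseq n) / tseq n) \<longlonglongrightarrow> M * (1 - 1) / 1"
    by (intro tendsto_intros tseq_tendsto) auto
  then show "(\<lambda>n. M * (1 - tseq n) / tseq n) \<longlonglongrightarrow> 0" by simp
qed (use a in auto)

text \<open>The limit of \<open>k\<close> follows from that of \<open>w\<close> by
  \<open>branch_k_bw\<close>, whose denominator tends to \<open>1 - cb = cd\<close>, positive for
  \<open>C < 0\<close>.\<close>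

lemma outflow_limits:
  assumes s: "0 < s" "s \<le> 2" and C: "-1 \<le> C" "C < 0" and bs: "branch_seq s C k w"
  shows "w \<longlonglongrightarrow> 1" "k \<longlonglongrightarrow> of_real (ca s C / cd s C)"
proof -
  have g: "0 < s * (- C) / 2" using mult_pos_pos[of s "- C"] s C by simp
  have "(\<lambda>n. s * (- C) / 2 * cmod (1 - w n)) \<longlonglongrightarrow> 0"
  proof (rule tseq_bound_tendsto_0[of _ 2])
    fix n
    note ob = branch_seq_on_branch[OF bs, of n]
    have "tseq n * (s * (- C) / 2) * cmod (1 - w n) \<le> (1 - tseq n) * (1 - (s - 1) * tseq n)"
      using outflow_w_near_1[OF s C tseq on_branch_D(3)[OF ob]] on_branch_D(2)[OF ob] tseq[of n] by simp
    also have "\<dots> \<le> (1 - tseq n) * 2"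
    proof (rule mult_left_mono)
      have "-1 * 1 \<le> (s - 1) * tseq n" using s tseq[of n] mult_right_mono[of "-1" "s - 1" "tseq n"] by simp
      then show "1 - (s - 1) * tseq n \<le> 2" by simp
    qed (use tseq[of n] in simp)
    finally show "tseq n * (s * (- C) / 2 * cmod (1 - w n)) \<le> 2 * (1 - tseq n)" by simp
  qed (rule mult_nonneg_nonneg[OF less_imp_le[OF g] norm_ge_zero])
  then have "(\<lambda>n. s * (- C) / 2 * cmod (1 - w n) / (s * (- C) / 2)) \<longlonglongrightarrow> 0 / (s * (- C) / 2)"
    using g by (intro tendsto_divide tendsto_const) auto
  then have "(\<lambda>n. cmod (1 - w n)) \<longlonglongrightarrow> 0" using s C by simp
  then have "(\<lambda>n. 1 - w n) \<longlonglongrightarrow> 0" by (rule tendsto_norm_zero_cancel)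
  from tendsto_diff[OF tendsto_const[of 1] this] show w: "w \<longlonglongrightarrow> 1" by simp
  have d: "cd s C = 1 - cb s C" by (simp add: coef_defs)
  have "s * (1 + C) \<le> 2 * (1 + C)" using s C by (intro mult_right_mono) auto
  then have d0: "0 < cd s C" unfolding cd_def using C by simp
  then have nz: "1 - 1 * (complex_of_real (cb s C) * 1) \<noteq> 0" unfolding d by (simp flip: of_real_diff)
  have t: "(\<lambda>n. complex_of_real (tseq n)) \<longlonglongrightarrow> 1" using tendsto_of_real[OF tseq_tendsto] by simp
  have "(\<lambda>n. of_real (tseq n) * of_real (ca s C) / (1 - of_real (tseq n) * (of_real (cb s C) * w n)))
     \<longlonglongrightarrow> 1 * of_real (ca s C) / (1 - 1 * (of_real (cb s C) * 1))"
    by (intro tendsto_intros t w nz)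
  also have "1 * of_real (ca s C) / (1 - 1 * (complex_of_real (cb s C) * 1)) = of_real (ca s C / cd s C)"
    unfolding d by simp
  also have "(\<lambda>n. of_real (tseq n) * of_real (ca s C) / (1 - of_real (tseq n) * (of_real (cb s C) * w n))) = k"
  proof
    fix n
    note ob = branch_seq_on_branch[OF bs, of n]
    have C': "\<bar>C\<bar> \<le> 1" using C by simp
    have "cmod (of_real (cb s C) * w n) < 1"
      using branch_bw_less_1[OF s C' on_branch_D(3,1,5)[OF ob]] .
    then have "cmod (of_real (tseq n) * (of_real (cb s C) * w n)) < 1"
      using tseq[of n] mult_strict_mono[of "tseq n" 1 "cmod (of_real (cb s C) * w n)" 1] unfolding norm_mult[of "of_real (tseq n)"] by simp
    then have "1 - of_real (tseq n) * (of_real (cb s C) * w n) \<noteq> 0" by auto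
    then show "of_real (tseq n) * of_real (ca s C) / (1 - of_real (tseq n) * (of_real (cb s C) * w n)) = k n"
      using branch_k_bw[OF on_branch_D(3)[OF ob]] by (simp add: field_simps)
  qed
  finally show "k \<longlonglongrightarrow> of_real (ca s C / cd s C)" .
qed

text \<open>\<open>Re k < 0\<close> keeps \<open>1 - k\<close> away from 0, so the dispersion
  relation hands the whole smallness of \<open>1 - t^2\<close> to \<open>1 + k\<close>. Only this
  rate makes the factor \<open>1 - |k|^2\<close> usable.\<close>

lemma leapfrog_k_near_minus_1:
  assumes C: "-1 < C" "C < 0" and bs: "branch_seq 2 C k w"
  shows "tseq n * cmod (1 + k n) \<le> 2 / (- C) * (1 - tseq n)"
proof -
  note ob = branch_seq_on_branch[OF bs, of n]
  define t where "t = tseq n"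
  have t: "0 < t" "t < 1" using tseq[of n] by (simp_all add: t_def)
  have k: "1 \<le> cmod (1 - k n)" using leapfrog_Re_sign[OF C(2) ob] tseq(1)[of n] by (intro one_le_cmod_one_minus) simp
  have "complex_of_real (1 - t\<^sup>2) * k n = of_real (C * t) * ((1 - k n) * (1 + k n))"
    using leapfrog_relation[OF on_branch_D(3)[OF ob]] by (simp add: t_def algebra_simps power2_eq_square)
  then have e: "\<bar>1 - t\<^sup>2\<bar> * cmod (k n) = \<bar>C * t\<bar> * (cmod (1 - k n) * cmod (1 + k n))"
    by (metis norm_mult norm_of_real)
  have "\<bar>C * t\<bar> * (1 * cmod (1 + k n)) \<le> \<bar>1 - t\<^sup>2\<bar> * cmod (k n)"
    unfolding e using k by (intro mult_left_mono mult_right_mono) auto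
  also have "\<dots> \<le> \<bar>1 - t\<^sup>2\<bar> * 1" using on_branch_D(4)[OF ob] by (intro mult_left_mono) auto
  also have "\<bar>1 - t\<^sup>2\<bar> = (1 - t) * (1 + t)" using t by (simp add: power2_eq_square algebra_simps mult_le_one)
  also have "(1 - t) * (1 + t) * 1 \<le> (1 - t) * 2" using mult_left_mono[of "1 + t" 2 "1 - t"] t by simp
  finally have "(- C) * t * cmod (1 + k n) \<le> (1 - t) * 2" using C t by (simp add: abs_mult)
  then show ?thesis unfolding t_def[symmetric] using C by (simp add: field_simps)
qed

lemma leapfrog_limits:
  assumes C: "-1 < C" "C < 0" and bs: "branch_seq 2 C k w"
  shows "w \<longlonglongrightarrow> 1" "k \<longlonglongrightarrow> -1"
proof -
  have "ca 2 C / cd 2 C = -1" using C by (simp add: leapfrog_coefs)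
  then show "w \<longlonglongrightarrow> 1" "k \<longlonglongrightarrow> -1" using outflow_limits[OF _ _ _ C(2) bs] C by simp_all
qed

lemma inflow_limits:
  assumes s: "0 < s" "s \<le> 2" and C: "0 < C" "C \<le> 1" and bs: "branch_seq s C k w"
  shows "w \<longlonglongrightarrow> of_real (cc s C / cb s C)" "k \<longlonglongrightarrow> 1"
proof -
  obtain M where M: "0 < M" "\<And>t k w. 0 < t \<Longrightarrow> t < 1 \<Longrightarrow> branch s C (of_real t) k w \<Longrightarrow> cmod k \<le> t \<Longrightarrow>
     cmod (1 - k) \<le> M * (1 - t) \<and> t * cmod (w - of_real (cc s C / cb s C)) \<le> M * (1 - t)"
    using inflow_near_1[OF s C] by blast
  have b: "cmod (1 - k n) \<le> M * (1 - tseq n)" "tseq n * cmod (w n - of_real (cc s C / cb s C)) \<le> M * (1 - tseq n)" for n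
    using M(2)[OF tseq, of n "k n" "w n"] bs unfolding branch_seq_def by blast+
  have "tseq n * cmod (1 - k n) \<le> M * (1 - tseq n)" for n
  proof -
    have "tseq n * cmod (1 - k n) \<le> 1 * cmod (1 - k n)" using tseq[of n] by (intro mult_right_mono) auto
    then show ?thesis using b(1)[of n] by simp
  qed
  then have "(\<lambda>n. cmod (1 - k n)) \<longlonglongrightarrow> 0" by (rule tseq_bound_tendsto_0) simp
  then have "(\<lambda>n. 1 - k n) \<longlonglongrightarrow> 0" by (rule tendsto_norm_zero_cancel)
  from tendsto_diff[OF tendsto_const[of 1] this] show "k \<longlonglongrightarrow> 1" by simp
  have "(\<lambda>n. cmod (w n - of_real (cc s C / cb s C))) \<longlonglongrightarrow> 0" by (rule tseq_bound_tendsto_0[OF b(2)]) simp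
  then have "(\<lambda>n. w n - of_real (cc s C / cb s C)) \<longlonglongrightarrow> 0" by (rule tendsto_norm_zero_cancel)
  from tendsto_add[OF this tendsto_const[of "complex_of_real (cc s C / cb s C)"]] show "w \<longlonglongrightarrow> of_real (cc s C / cb s C)" by simp
qed

section \<open>Classification for general parameters\<close>

lemma no_limit_zero:
  fixes a c :: "nat \<Rightarrow> real"
  assumes "\<And>n. a n \<le> c n" "a \<longlonglongrightarrow> l" "c \<longlonglongrightarrow> 0" "0 < l"
  shows False
  using LIMSEQ_le[OF assms(2,3)] assms(1,4) by fastforce

lemma one_minus_tseq_tendsto: "(\<lambda>n. c * (1 - tseq n)) \<longlonglongrightarrow> 0"
  using tendsto_mult[OF tendsto_const[of c] tendsto_diff[OF tendsto_const[of 1] tseq_tendsto]] by simp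

text \<open>The numerator is at least of order \<open>y\<close>, the denominator
  \<open>1 - w\<close> at most of order \<open>(1 - t) y\<close>. The estimate would then bound a
  positive limit by a multiple of \<open>1 - t\<close>.\<close>

lemma not_est_outflow_reflection:
  assumes s: "0 < s" "s \<le> 2" and C: "-1 \<le> C" "C < 0" and lam: "lam > 0" and sg: "\<bar>sg\<bar> = 1"
    and b: "\<And>k w. bsym b C (of_real sg * k) (of_real sg * w) = w"
  shows "\<not> est 1 s C b lam"
proof
  assume est: "est 1 s C b lam"
  have C': "\<bar>C\<bar> \<le> 1" "C = 1 \<Longrightarrow> s < 2" using C by auto
  obtain K k w where K: "K > 0" and bs: "branch_seq s C k w"
    and bd: "\<forall>n. (1 - tseq n) * (tseq n)\<^sup>2 * (cmod (1 + of_real 1 * (k n * w n)))\<^sup>2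
      \<le> K * (1 - (cmod (k n))\<^sup>2) * (cmod (1 - bsym b C (of_real sg * k n) (of_real sg * w n)))\<^sup>2"
    using est_imp_branch_seq[OF s C' lam est sg] by blast
  define g where "g = s * (- C) / 2"
  have g: "0 < g" using mult_pos_pos[of s "- C"] s C by (simp add: g_def)
  have "tseq n ^ 4 * g\<^sup>2 * (1 + (s - 1) * tseq n)\<^sup>2 \<le> 36 * K * (1 - tseq n)" for n
  proof -
    note ob = branch_seq_on_branch[OF bs, of n]
    define t where "t = tseq n"
    \<comment> \<open>Common factor of both rates. It tends to 0 for \<open>s = 2\<close> but
      cancels, so a single argument serves all \<open>s\<close>.\<close>
    define y where "y = 1 - (s - 1) * t"
    define e where "e = cmod (1 + k n * w n)"
    define D where "D = cmod (1 - w n)"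
    have t: "0 < t" "t < 1" using tseq[of n] by (simp_all add: t_def)
    have "(s - 1) * t \<le> 1 * t" using s t by (intro mult_right_mono) auto
    then have y: "0 < y" unfolding y_def using t by linarith
    have e0: "0 \<le> e" "0 \<le> D" by (simp_all add: e_def D_def)
    have gD: "t * g * D \<le> (1 - t) * y"
      using outflow_w_near_1[OF s C tseq on_branch_D(3)[OF ob]] on_branch_D(2)[OF ob] t
      by (simp add: g_def D_def y_def t_def)
    have ye: "y * (1 + (s - 1) * t) \<le> 6 * e"
      using one_plus_product_lower[OF s C'(1) on_branch_D(1,3)[OF ob]] t
      by (simp add: e_def y_def t_def[symmetric] algebra_simps power2_eq_square)
    have "-1 * t \<le> (s - 1) * t" using s t by (intro mult_right_mono) auto
    then have st: "0 \<le> 1 + (s - 1) * t" using t by linarith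
    have main: "(1 - t) * t\<^sup>2 * e\<^sup>2 \<le> K * D\<^sup>2"
    proof -
      have "(1 - t) * t\<^sup>2 * e\<^sup>2 \<le> K * (1 - (cmod (k n))\<^sup>2) * D\<^sup>2"
        using bd[rule_format, of n] unfolding b t_def e_def D_def by simp
      also have "\<dots> \<le> K * 1 * D\<^sup>2" using K by (intro mult_right_mono mult_left_mono) auto
      finally show ?thesis by simp
    qed
    have "((1 - t) * y\<^sup>2) * (t ^ 4 * g\<^sup>2 * (1 + (s - 1) * t)\<^sup>2) = (1 - t) * t ^ 4 * g\<^sup>2 * (y * (1 + (s - 1) * t))\<^sup>2"
      by (simp add: power_mult_distrib)
    also have "\<dots> \<le> (1 - t) * t ^ 4 * g\<^sup>2 * (6 * e)\<^sup>2"
      using t y st ye by (intro mult_left_mono power_mono mult_nonneg_nonneg) auto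
    also have "\<dots> = 36 * t\<^sup>2 * g\<^sup>2 * ((1 - t) * t\<^sup>2 * e\<^sup>2)"
      by (simp add: power_mult_distrib power2_eq_square power4_eq_xxxx)
    also have "\<dots> \<le> 36 * t\<^sup>2 * g\<^sup>2 * (K * D\<^sup>2)" by (rule mult_left_mono[OF main]) simp
    also have "\<dots> = 36 * K * (t * g * D)\<^sup>2" by (simp add: power_mult_distrib)
    also have "\<dots> \<le> 36 * K * ((1 - t) * y)\<^sup>2"
      using K t g e0 gD by (intro mult_left_mono power_mono mult_nonneg_nonneg) auto
    also have "\<dots> = ((1 - t) * y\<^sup>2) * (36 * K * (1 - t))" by (simp add: power2_eq_square)
    finally show ?thesis unfolding t_def[symmetric]
      by (rule mult_left_le_imp_le) (use t y in simp)
  qed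
  moreover have "(\<lambda>n. tseq n ^ 4 * g\<^sup>2 * (1 + (s - 1) * tseq n)\<^sup>2) \<longlonglongrightarrow> 1 ^ 4 * g\<^sup>2 * (1 + (s - 1) * 1)\<^sup>2"
    by (intro tendsto_intros tseq_tendsto)
  moreover have "0 < (1::real) ^ 4 * g\<^sup>2 * (1 + (s - 1) * 1)\<^sup>2" using g s by simp
  ultimately show False by (rule no_limit_zero[OF _ _ one_minus_tseq_tendsto])
qed

text \<open>The numerator \<open>1 + k w\<close> tends to \<open>1 + cc / cb > 0\<close>. A
  denominator of order \<open>1 - t\<close> already contradicts the estimate, which allows only
  order \<open>sqrt (1 - t)\<close>.\<close>

lemma not_est_inflow:
  assumes s: "0 < s" "s \<le> 2" and C: "0 < C" "C \<le> 1" and sC: "C = 1 \<Longrightarrow> s < 2" and lam: "lam > 0"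
    and b: "\<And>t k w. 0 < t \<Longrightarrow> t < 1 \<Longrightarrow> on_branch s C (of_real t) k w \<Longrightarrow>
        t * cmod (1 - bsym b C k w) \<le> L * (1 - t)"
  shows "\<not> est 1 s C b lam"
proof
  assume est: "est 1 s C b lam"
  have C': "\<bar>C\<bar> \<le> 1" using C by auto
  obtain K k w where K: "K > 0" and bs: "branch_seq s C k w"
    and bd: "\<forall>n. (1 - tseq n) * (tseq n)\<^sup>2 * (cmod (1 + of_real 1 * (k n * w n)))\<^sup>2
      \<le> K * (1 - (cmod (k n))\<^sup>2) * (cmod (1 - bsym b C (of_real 1 * k n) (of_real 1 * w n)))\<^sup>2"
    using est_imp_branch_seq[OF s C' sC lam est, of 1] by fastforce
  have "tseq n ^ 4 * (cmod (1 + k n * w n))\<^sup>2 \<le> K * L\<^sup>2 * (1 - tseq n)" for n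
  proof -
    note ob = branch_seq_on_branch[OF bs, of n]
    define t where "t = tseq n"
    define e where "e = cmod (1 + k n * w n)"
    define D where "D = cmod (1 - bsym b C (k n) (w n))"
    have t: "0 < t" "t < 1" using tseq[of n] by (simp_all add: t_def)
    have main: "(1 - t) * t\<^sup>2 * e\<^sup>2 \<le> K * D\<^sup>2"
    proof -
      have "(1 - t) * t\<^sup>2 * e\<^sup>2 \<le> K * (1 - (cmod (k n))\<^sup>2) * D\<^sup>2"
        using bd[rule_format, of n] unfolding t_def e_def D_def by simp
      also have "\<dots> \<le> K * 1 * D\<^sup>2" using K by (intro mult_right_mono mult_left_mono) auto
      finally show ?thesis by simp
    qed
    have tD: "t * D \<le> L * (1 - t)" unfolding t_def D_def by (rule b[OF tseq ob])
    have "(1 - t) * (t ^ 4 * e\<^sup>2) = t\<^sup>2 * ((1 - t) * t\<^sup>2 * e\<^sup>2)" by (simp add: power2_eq_square power4_eq_xxxx)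
    also have "\<dots> \<le> t\<^sup>2 * (K * D\<^sup>2)" by (rule mult_left_mono[OF main]) simp
    also have "\<dots> = K * (t * D)\<^sup>2" by (simp add: power_mult_distrib)
    also have "\<dots> \<le> K * (L * (1 - t))\<^sup>2"
      using K t tD by (intro mult_left_mono power_mono) (auto simp: D_def)
    also have "\<dots> = (1 - t) * (K * L\<^sup>2 * (1 - t))" by (simp add: power2_eq_square)
    finally show ?thesis unfolding t_def[symmetric] e_def[symmetric]
      by (rule mult_left_le_imp_le) (use t in simp)
  qed
  moreover have "(\<lambda>n. tseq n ^ 4 * (cmod (1 + k n * w n))\<^sup>2) \<longlonglongrightarrow> 1 ^ 4 * (cmod (1 + 1 * of_real (cc s C / cb s C)))\<^sup>2"
    by (intro tendsto_intros tseq_tendsto inflow_limits[OF s C bs])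
  moreover have "0 < (1::real) ^ 4 * (cmod (1 + 1 * of_real (cc s C / cb s C)))\<^sup>2"
  proof -
    have "0 \<le> cc s C / cb s C" using s C by (simp add: cc_def cb_def)
    then have "0 < \<bar>1 + cc s C / cb s C\<bar>" by linarith
    moreover have "cmod (1 + 1 * of_real (cc s C / cb s C)) = \<bar>1 + cc s C / cb s C\<bar>"
      by (metis mult_1 norm_of_real of_real_1 of_real_add)
    ultimately show ?thesis by (simp only:) simp
  qed
  ultimately show False by (rule no_limit_zero[OF _ _ one_minus_tseq_tendsto])
qed

text \<open>With \<open>q = |1 + k| = O(1 - t)\<close>, the estimate compares a left side of order
  at least \<open>(1 - t)^3\<close> with \<open>q ^ (2 \<sigma> + 1)\<close>. The exponents agree
  for \<open>\<sigma> = 1\<close> and contradict each other from \<open>\<sigma> = 2\<close>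
  on.\<close>

lemma not_est_leapfrog_extrapolation:
  assumes C: "-1 < C" "C < 0" and lam: "lam > 0" and \<sigma>: "2 \<le> \<sigma>"
  shows "\<not> est 1 2 C (Extrapolation \<sigma>) lam"
proof
  assume est: "est 1 2 C (Extrapolation \<sigma>) lam"
  have C': "\<bar>C\<bar> \<le> 1" "C = 1 \<Longrightarrow> (2::real) < 2" using C by auto
  obtain K k w where K: "K > 0" and bs: "branch_seq 2 C k w"
    and bd: "\<forall>n. (1 - tseq n) * (tseq n)\<^sup>2 * (cmod (1 + of_real 1 * (k n * w n)))\<^sup>2
      \<le> K * (1 - (cmod (k n))\<^sup>2) * (cmod (1 - bsym (Extrapolation \<sigma>) C (of_real (-1) * k n) (of_real (-1) * w n)))\<^sup>2"
    using est_imp_branch_seq[OF _ _ C' lam est, of "-1"] by fastforce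
  define h where "h = 2 / (- C)"
  \<comment> \<open>Factor 2 from \<open>1 - |k|^2 \<le> 2 q\<close>,
    \<open>4 ^ (\<sigma> - 2)\<close> from reducing \<open>q ^ \<sigma>\<close> to
    \<open>q\<^sup>2\<close> by \<open>q \<le> 2\<close>, 36 from \<open>1 - t \<le> 6 e\<close>,
    and \<open>h ^ 5\<close> from the rate of \<open>q\<close>.\<close>
  define A where "A = 2 * 4 ^ (\<sigma> - 2) * K * 36 * h ^ 5"
  have "tseq n ^ 7 \<le> A * (1 - tseq n) * (1 - tseq n)" for n
  proof -
    note ob = branch_seq_on_branch[OF bs, of n]
    define t where "t = tseq n"
    define e where "e = cmod (1 + k n * w n)"
    define q where "q = cmod (1 + k n)"
    have t: "0 < t" "t < 1" using tseq[of n] by (simp_all add: t_def)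
    have q: "0 \<le> q" "q \<le> 2" using norm_triangle_ineq[of 1 "k n"] on_branch_D(4)[OF ob] by (simp_all add: q_def)
    have tq: "t * q \<le> h * (1 - t)" unfolding t_def q_def h_def by (rule leapfrog_k_near_minus_1[OF C bs])
    have e: "(1 - t) \<le> 6 * e"
    proof -
      have "1 - t\<^sup>2 \<le> 6 * e"
        using one_plus_product_lower[OF _ _ C'(1) on_branch_D(1,3)[OF ob]] t by (simp add: e_def t_def)
      moreover have "t\<^sup>2 \<le> t" using t by (simp add: power2_eq_square)
      ultimately show ?thesis by linarith
    qed
    have k2: "1 - (cmod (k n))\<^sup>2 \<le> 2 * q"
    proof -
      have "1 - cmod (k n) \<le> q" using norm_triangle_ineq2[of 1 "- k n"] by (simp add: q_def)
      moreover have "1 - (cmod (k n))\<^sup>2 = (1 - cmod (k n)) * (1 + cmod (k n))" by (simp add: algebra_simps power2_eq_square)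
      moreover have "(1 - cmod (k n)) * (1 + cmod (k n)) \<le> q * 2"
        using on_branch_D(4)[OF ob] q calculation(1) by (intro mult_mono) auto
      ultimately show ?thesis by linarith
    qed
    have "q ^ \<sigma> = q ^ (\<sigma> - 2) * q\<^sup>2" using \<sigma> by (metis le_add_diff_inverse2 power_add)
    also have "\<dots> \<le> 2 ^ (\<sigma> - 2) * q\<^sup>2" using q by (intro mult_right_mono power_mono) auto
    finally have q\<sigma>: "q ^ \<sigma> \<le> 2 ^ (\<sigma> - 2) * q\<^sup>2" .
    have "(q ^ \<sigma>)\<^sup>2 \<le> (2 ^ (\<sigma> - 2) * q\<^sup>2)\<^sup>2" using q q\<sigma> by (intro power_mono) auto
    also have "\<dots> = 4 ^ (\<sigma> - 2) * q ^ 4"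
      by (simp add: power_mult_distrib power_mult[symmetric] mult.commute[of "\<sigma> - 2"]) (simp add: power_mult)
    finally have q\<sigma>2: "(q ^ \<sigma>)\<^sup>2 \<le> 4 ^ (\<sigma> - 2) * q ^ 4" .
    have "cmod (1 - bsym (Extrapolation \<sigma>) C (of_real (-1) * k n) (of_real (-1) * w n)) = q ^ \<sigma>"
      by (simp add: bsym_simps norm_power q_def)
    then have "(1 - t) * t\<^sup>2 * e\<^sup>2 \<le> K * (1 - (cmod (k n))\<^sup>2) * (q ^ \<sigma>)\<^sup>2"
      using bd[rule_format, of n] unfolding t_def e_def by simp
    also have "\<dots> \<le> K * (2 * q) * (4 ^ (\<sigma> - 2) * q ^ 4)"
      using K k2 q q\<sigma>2 by (intro mult_mono mult_left_mono mult_nonneg_nonneg) auto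
    also have "\<dots> = 2 * 4 ^ (\<sigma> - 2) * K * q ^ 5" by (simp add: eval_nat_numeral)
    finally have main: "(1 - t) * t\<^sup>2 * e\<^sup>2 \<le> 2 * 4 ^ (\<sigma> - 2) * K * q ^ 5" .
    have "(1 - t) ^ 3 * t ^ 7 = (1 - t) * t ^ 7 * (1 - t)\<^sup>2" by (simp add: eval_nat_numeral)
    also have "\<dots> \<le> (1 - t) * t ^ 7 * (6 * e)\<^sup>2" using t e by (intro mult_left_mono power_mono) auto
    also have "\<dots> = 36 * t ^ 5 * ((1 - t) * t\<^sup>2 * e\<^sup>2)" by (simp add: eval_nat_numeral)
    also have "\<dots> \<le> 36 * t ^ 5 * (2 * 4 ^ (\<sigma> - 2) * K * q ^ 5)" using t by (intro mult_left_mono[OF main]) simp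
    also have "\<dots> = 2 * 4 ^ (\<sigma> - 2) * K * 36 * (t * q) ^ 5" by (simp add: power_mult_distrib)
    also have "\<dots> \<le> 2 * 4 ^ (\<sigma> - 2) * K * 36 * (h * (1 - t)) ^ 5"
      using K t q tq by (intro mult_left_mono power_mono) auto
    also have "\<dots> = (1 - t) ^ 3 * (A * (1 - t) * (1 - t))" by (simp add: A_def power_mult_distrib eval_nat_numeral)
    finally show ?thesis unfolding t_def[symmetric] by (rule mult_left_le_imp_le) (use t in simp)
  qed
  moreover have "(\<lambda>n. tseq n ^ 7) \<longlonglongrightarrow> 1 ^ 7" by (intro tendsto_intros tseq_tendsto)
  moreover have "(\<lambda>n. A * (1 - tseq n) * (1 - tseq n)) \<longlonglongrightarrow> 0 * (1 - 1)"
    by (intro tendsto_mult one_minus_tseq_tendsto tendsto_diff tendsto_const tseq_tendsto)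
  ultimately show False using no_limit_zero[of "\<lambda>n. tseq n ^ 7" "\<lambda>n. A * (1 - tseq n) * (1 - tseq n)" 1] by simp
qed

text \<open>For \<open>m2\<close> the numerator \<open>1 - k w\<close> tends to 2. The factor
  \<open>1 - |k|^2 = O(1 - t)\<close> cancels the weight \<open>1 - t\<close>, so that mere
  convergence of the symbol to 1, without a rate, is a contradiction.\<close>

lemma not_est_leapfrog_second_moment:
  assumes C: "-1 < C" "C < 0" and lam: "lam > 0" and sg: "\<bar>sg\<bar> = 1"
    and lim: "\<And>k w. k \<longlonglongrightarrow> -1 \<Longrightarrow> w \<longlonglongrightarrow> 1 \<Longrightarrow> (\<lambda>n. bsym b C (of_real sg * k n) (of_real sg * w n)) \<longlonglongrightarrow> 1"
  shows "\<not> est (-1) 2 C b lam"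
proof
  assume est: "est (-1) 2 C b lam"
  have C': "\<bar>C\<bar> \<le> 1" "C = 1 \<Longrightarrow> (2::real) < 2" using C by auto
  obtain K k w where K: "K > 0" and bs: "branch_seq 2 C k w"
    and bd: "\<forall>n. (1 - tseq n) * (tseq n)\<^sup>2 * (cmod (1 + of_real (-1) * (k n * w n)))\<^sup>2
      \<le> K * (1 - (cmod (k n))\<^sup>2) * (cmod (1 - bsym b C (of_real sg * k n) (of_real sg * w n)))\<^sup>2"
    using est_imp_branch_seq[OF _ _ C' lam est sg] by fastforce
  define h where "h = 2 / (- C)"
  define D where "D = (\<lambda>n. cmod (1 - bsym b C (of_real sg * k n) (of_real sg * w n)))"
  have "tseq n ^ 3 * (cmod (1 - k n * w n))\<^sup>2 \<le> 2 * K * h * (D n)\<^sup>2" for n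
  proof -
    note ob = branch_seq_on_branch[OF bs, of n]
    define t where "t = tseq n"
    define e where "e = cmod (1 - k n * w n)"
    define q where "q = cmod (1 + k n)"
    have t: "0 < t" "t < 1" using tseq[of n] by (simp_all add: t_def)
    have q: "0 \<le> q" by (simp add: q_def)
    have tq: "t * q \<le> h * (1 - t)" unfolding t_def q_def h_def by (rule leapfrog_k_near_minus_1[OF C bs])
    have k2: "1 - (cmod (k n))\<^sup>2 \<le> 2 * q"
    proof -
      have "1 - cmod (k n) \<le> q" using norm_triangle_ineq2[of 1 "- k n"] by (simp add: q_def)
      moreover have "1 - (cmod (k n))\<^sup>2 = (1 - cmod (k n)) * (1 + cmod (k n))" by (simp add: algebra_simps power2_eq_square)
      moreover have "(1 - cmod (k n)) * (1 + cmod (k n)) \<le> q * 2"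
        using on_branch_D(4)[OF ob] q calculation(1) by (intro mult_mono) auto
      ultimately show ?thesis by linarith
    qed
    have "(1 - t) * t\<^sup>2 * e\<^sup>2 \<le> K * (1 - (cmod (k n))\<^sup>2) * (D n)\<^sup>2"
      using bd[rule_format, of n] unfolding t_def e_def D_def by simp
    also have "\<dots> \<le> K * (2 * q) * (D n)\<^sup>2" using K k2 by (intro mult_right_mono mult_left_mono) auto
    finally have main: "(1 - t) * t\<^sup>2 * e\<^sup>2 \<le> K * (2 * q) * (D n)\<^sup>2" .
    have "(1 - t) * (t ^ 3 * e\<^sup>2) = t * ((1 - t) * t\<^sup>2 * e\<^sup>2)" by (simp add: eval_nat_numeral)
    also have "\<dots> \<le> t * (K * (2 * q) * (D n)\<^sup>2)" using t by (intro mult_left_mono[OF main]) simp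
    also have "\<dots> = K * 2 * (D n)\<^sup>2 * (t * q)" by simp
    also have "\<dots> \<le> K * 2 * (D n)\<^sup>2 * (h * (1 - t))" using K tq by (intro mult_left_mono) auto
    also have "\<dots> = (1 - t) * (2 * K * h * (D n)\<^sup>2)" by simp
    finally show ?thesis unfolding t_def[symmetric] e_def[symmetric] by (rule mult_left_le_imp_le) (use t in simp)
  qed
  moreover have kw: "k \<longlonglongrightarrow> -1" "w \<longlonglongrightarrow> 1" using leapfrog_limits[OF C bs] by auto
  have "(\<lambda>n. tseq n ^ 3 * (cmod (1 - k n * w n))\<^sup>2) \<longlonglongrightarrow> 1 ^ 3 * (cmod (1 - (-1) * 1))\<^sup>2"
    by (intro tendsto_intros tseq_tendsto kw)
  moreover have "(\<lambda>n. 2 * K * h * (D n)\<^sup>2) \<longlonglongrightarrow> 2 * K * h * (cmod (1 - 1))\<^sup>2"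
    unfolding D_def by (intro tendsto_intros lim kw)
  ultimately show False
    using no_limit_zero[of "\<lambda>n. tseq n ^ 3 * (cmod (1 - k n * w n))\<^sup>2" "\<lambda>n. 2 * K * h * (D n)\<^sup>2" 4] by simp
qed

lemma no_unstable_mode:
  assumes s: "0 < s" "s \<le> 2" and C: "\<bar>C\<bar> \<le> 1"
    and b: "\<And>x k w. on_branch s C x k w \<Longrightarrow> bsym b C k w \<noteq> 1"
  shows "\<not> (\<exists>z \<kappa>. critical_mode s C b z \<kappa> \<and> norm z > 1)"
proof
  assume "\<exists>z \<kappa>. critical_mode s C b z \<kappa> \<and> norm z > 1"
  then obtain z \<kappa> where cm: "critical_mode s C b z \<kappa>" and z: "1 < cmod z" by blast
  obtain w where k: "cmod \<kappa> < 1" and br: "branch s C (1 / z) \<kappa> w" and sy: "bsym b C \<kappa> w = 1"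
    using critical_mode_imp_branch[OF s(1) C cm z] by blast
  have x: "cmod (1 / z) < 1" using z by (simp add: norm_divide divide_less_eq_1)
  have "cmod (1 / z * \<kappa>) < 1"
    unfolding norm_mult using x k mult_strict_mono[of "cmod (1 / z)" 1 "cmod \<kappa>" 1] by simp
  then have "on_branch s C (1 / z) \<kappa> w"
    unfolding on_branch_def using x br branch_k_le[OF s C br] by simp
  then show False using b sy by blast
qed

lemma label_MU_L:
  assumes "lam > 0" "\<not> est 1 s C b lam" "\<not> (\<exists>z \<kappa>. critical_mode s C b z \<kappa> \<and> norm z > 1)"
    and "critical_mode s C b z \<kappa>" "norm z = 1" "norm \<kappa> < 1"
  shows "has_label lam s C b L_MU_L"
  unfolding has_label.simps SSOO_est_iff SS_est_iff[OF assms(1)] using assms(2-) by blast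

lemma label_MU_E:
  assumes "lam > 0" "\<not> est 1 s C b lam" "\<not> (\<exists>z \<kappa>. critical_mode s C b z \<kappa> \<and> norm z > 1)"
    and "critical_mode s C b z \<kappa>" "norm z = 1" "norm \<kappa> = 1"
  shows "has_label lam s C b L_MU_E"
  unfolding has_label.simps SSOO_est_iff SS_est_iff[OF assms(1)] using assms(2-) by blast

lemma label_GR_L:
  assumes s: "0 < s" "s \<le> 2" and C: "\<bar>C\<bar> < 1" and lam: "lam > 0"
    and x: "x \<noteq> 0" "cmod x < 1" and br: "branch s C x k w" and k: "cmod k < 1"
    and sy: "bsym b C k w = 1" and p: "k * w \<noteq> -1"
  shows "has_label lam s C b L_GR_L"
proof -
  have "\<not> est 1 s C b lam"
    using est_imp_no_zero[OF s C lam _ x(2) br k sy, of 1] x p by (auto simp: add_eq_0_iff)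
  moreover have "critical_mode s C b (1 / x) k" "1 < cmod (1 / x)"
    using critical_mode_unstable[OF x br k sy] by auto
  ultimately show ?thesis using k lam by (auto simp: SSOO_est_iff SS_est_iff)
qed

text \<open>Putting \<open>w = 1\<close> into its quadratic gives
  \<open>(1 - x) (1 - (s - 1) x) = 0\<close>, which has no solution in the open disc. The case
  \<open>w = -1\<close> follows by \<open>branch_minus\<close>.\<close>

lemma reflection_symbol_ne_1:
  assumes s: "0 < s" "s \<le> 2" and ob: "on_branch s C x k w"
  shows "w \<noteq> 1" "- w \<noteq> 1"
proof -
  have *: "v \<noteq> 1" if o: "on_branch s C y l v" for y l v
  proof
    assume "v = 1"
    have "cb s C + cc s C = s" by (simp add: coef_defs field_simps)
    then have "complex_of_real (cb s C) + of_real (cc s C) = of_real s" by (metis of_real_add)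
    moreover have "1 + of_real (s - 1) * y\<^sup>2 = y * (of_real (cb s C) + of_real (cc s C))"
      using branch_w_quad[OF on_branch_D(3)[OF o]] \<open>v = 1\<close> by (simp add: algebra_simps)
    ultimately have "(1 - y) * (1 - of_real (s - 1) * y) = 0" by (simp add: algebra_simps power2_eq_square)
    then have "y = 1 \<or> of_real (s - 1) * y = 1" by auto
    moreover have "cmod (of_real (s - 1) * y) \<le> 1 * cmod y"
      unfolding norm_mult norm_of_real using s by (intro mult_right_mono) auto
    ultimately have "1 \<le> cmod y" by auto
    then show False using on_branch_D(1)[OF o] by simp
  qed
  show "w \<noteq> 1" by (rule *[OF ob])
  have "on_branch s C (- x) (- k) (- w)" using ob branch_minus[of s C x k w] by (simp add: on_branch_def)
  then show "- w \<noteq> 1" by (rule *)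
qed

lemma critical_outflow_reflection:
  assumes s: "0 < s" "s \<le> 2" and C: "-1 \<le> C" "C < 0" and sg: "\<bar>sg\<bar> = 1"
    and b: "\<And>k w. bsym b C (of_real sg * k) (of_real sg * w) = w"
  shows "critical_mode s C b (of_real sg) (of_real sg * of_real (ca s C / cd s C))"
proof -
  have C': "\<bar>C\<bar> \<le> 1" "C = 1 \<Longrightarrow> s < 2" using C by auto
  obtain k w where bs: "branch_seq s C k w" using branch_seq_exists[OF s C'] by blast
  show ?thesis by (rule critical_mode_limit[OF bs outflow_limits(2,1)[OF s C bs] sg b])
qed

lemma outflow_reflection_label:
  assumes s: "0 < s" "s \<le> 2" and C: "-1 \<le> C" "C < 0" and sC: "C = -1 \<Longrightarrow> s < 2" and lam: "lam > 0"
    and b: "b = BounceBack \<or> b = AntiBounceBack"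
  shows "has_label lam s C b (if s < 2 then L_MU_L else L_MU_E)"
proof -
  define sg :: real where "sg = (if b = BounceBack then 1 else -1)"
  have sg: "\<bar>sg\<bar> = 1" by (simp add: sg_def)
  have sy: "bsym b C (of_real sg * k) (of_real sg * w) = w" for k w
    using b by (auto simp: sg_def bsym_simps)
  have C': "\<bar>C\<bar> \<le> 1" using C by simp
  have ne: "\<not> est 1 s C b lam" by (rule not_est_outflow_reflection[OF s C lam sg sy])
  have no: "\<not> (\<exists>z \<kappa>. critical_mode s C b z \<kappa> \<and> norm z > 1)"
    by (rule no_unstable_mode[OF s C']) (use b reflection_symbol_ne_1[OF s] in \<open>auto simp: bsym_simps\<close>)
  have cm: "critical_mode s C b (of_real sg) (of_real sg * of_real (ca s C / cd s C))"
    by (rule critical_outflow_reflection[OF s C sg sy])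
  have nz: "norm (complex_of_real sg) = 1" using sg by simp
  have nk: "norm (complex_of_real sg * of_real (ca s C / cd s C)) = \<bar>ca s C / cd s C\<bar>"
    unfolding norm_mult norm_of_real using sg by simp
  show ?thesis
  proof (cases "s < 2")
    case True
    have "0 < s * (- C)" using s C by (intro mult_pos_pos) auto
    \<comment> \<open>From \<open>cd - ca = - s C\<close> and \<open>cd + ca = 2 - s\<close>: the
      mode is localized when \<open>s < 2\<close> and extended when \<open>s = 2\<close>.\<close>
    then have "\<bar>ca s C\<bar> < cd s C" using True by (auto simp: abs_less_iff coef_defs field_simps)
    then have "\<bar>ca s C / cd s C\<bar> < 1" by simp
    then have "norm (complex_of_real sg * of_real (ca s C / cd s C)) < 1" unfolding nk .
    then show ?thesis using label_MU_L[OF lam ne no cm nz] True by presburger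
  next
    case False
    then have s2: "s = 2" using s by simp
    have "\<bar>ca s C / cd s C\<bar> = 1" using C unfolding s2 leapfrog_coefs by simp
    then have "norm (complex_of_real sg * of_real (ca s C / cd s C)) = 1" unfolding nk .
    then show ?thesis using label_MU_E[OF lam ne no cm nz] False by presburger
  qed
qed

lemma leapfrog_extrapolation_label:
  assumes C: "-1 < C" "C < 0" and lam: "lam > 0" and \<sigma>: "2 \<le> \<sigma>"
  shows "has_label lam 2 C (Extrapolation \<sigma>) L_MU_E"
proof (rule label_MU_E[OF lam not_est_leapfrog_extrapolation[OF C lam \<sigma>]])
  have C': "\<bar>C\<bar> \<le> 1" using C by simp
  show "\<not> (\<exists>z \<kappa>. critical_mode 2 C (Extrapolation \<sigma>) z \<kappa> \<and> norm z > 1)"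
    by (rule no_unstable_mode[OF _ _ C']) (auto simp: bsym_simps dest: on_branch_D(4))
  obtain k w where bs: "branch_seq 2 C k w" using branch_seq_exists[OF _ _ C'] C by fastforce
  \<comment> \<open>Time factor -1 with spatial factor 1: the sign carries the limit -1 of the
    branch to the zero of \<open>(1 - k) ^ \<sigma>\<close>.\<close>
  show "critical_mode 2 C (Extrapolation \<sigma>) (of_real (-1)) (of_real (-1) * (-1))"
    by (rule critical_mode_limit[OF bs leapfrog_limits(2,1)[OF C bs]]) (use \<sigma> in \<open>auto simp: bsym_simps\<close>)
qed auto

lemma leapfrog_SSOO_label:
  assumes C: "-1 < C" "C < 0" and lam: "lam > 0" and b: "b = TwoStepsAntiBounceBack \<or> b = Extrapolation 1"
  shows "has_label lam 2 C b L_SSOO"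
proof -
  have "est 1 2 C b lam"
    using b SSOO_two_steps[of 2 C lam] SSOO_outflow_extrapolation_1[OF C lam] C lam by auto
  moreover have "\<not> est (-1) 2 C b lam"
    using b
  proof
    assume b: "b = TwoStepsAntiBounceBack"
    show ?thesis
    proof (rule not_est_leapfrog_second_moment[OF C lam, of 1])
      fix k w :: "nat \<Rightarrow> complex" assume "k \<longlonglongrightarrow> -1" "w \<longlonglongrightarrow> 1"
      then have "(\<lambda>n. - (k n * w n)) \<longlonglongrightarrow> - ((-1) * 1)" by (intro tendsto_intros)
      then show "(\<lambda>n. bsym b C (of_real 1 * k n) (of_real 1 * w n)) \<longlonglongrightarrow> 1" by (simp add: b bsym_simps)
    qed simp
  next
    assume b: "b = Extrapolation 1"
    show ?thesis
    proof (rule not_est_leapfrog_second_moment[OF C lam, of "-1"])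
      fix k w :: "nat \<Rightarrow> complex" assume "k \<longlonglongrightarrow> -1" "w \<longlonglongrightarrow> 1"
      then have "(\<lambda>n. - k n) \<longlonglongrightarrow> - (-1)" by (intro tendsto_intros)
      then show "(\<lambda>n. bsym b C (of_real (-1) * k n) (of_real (-1) * w n)) \<longlonglongrightarrow> 1" by (simp add: b bsym_simps)
    qed simp
  qed
  ultimately show ?thesis using lam by (simp add: SSOO_est_iff SS_est_iff)
qed

text \<open>The culprit is always the consistent mode \<open>z = k = 1\<close>, which for
  \<open>C > 0\<close> is a limit of stable modes.\<close>

lemma inflow_label_MU_E:
  assumes s: "0 < s" "s \<le> 2" and C: "0 < C" "C \<le> 1" and sC: "C = 1 \<Longrightarrow> s < 2" and lam: "lam > 0"
    and ne1: "\<And>x k w. on_branch s C x k w \<Longrightarrow> bsym b C k w \<noteq> 1"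
    and crit: "bsym b C 1 (of_real (cc s C / cb s C)) = 1"
    and near: "\<And>t k w. 0 < t \<Longrightarrow> t < 1 \<Longrightarrow> on_branch s C (of_real t) k w \<Longrightarrow>
        t * cmod (1 - bsym b C k w) \<le> L * (1 - t)"
  shows "has_label lam s C b L_MU_E"
proof (rule label_MU_E[OF lam not_est_inflow[OF s C sC lam near]])
  have C': "\<bar>C\<bar> \<le> 1" using C by simp
  show "\<not> (\<exists>z \<kappa>. critical_mode s C b z \<kappa> \<and> norm z > 1)"
    by (rule no_unstable_mode[OF s C' ne1])
  obtain k w where bs: "branch_seq s C k w" using branch_seq_exists[OF s C' sC] by blast
  show "critical_mode s C b (of_real 1) (of_real 1 * 1)"
    by (rule critical_mode_limit[OF bs inflow_limits(2,1)[OF s C bs]]) (use crit in auto)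
qed auto

lemma inflow_extrapolation_label:
  assumes s: "0 < s" "s \<le> 2" and C: "0 < C" "C \<le> 1" and sC: "C = 1 \<Longrightarrow> s < 2" and lam: "lam > 0" and \<sigma>: "1 \<le> \<sigma>"
  shows "has_label lam s C (Extrapolation \<sigma>) L_MU_E"
proof -
  obtain M where M: "0 < M" "\<And>t k w. 0 < t \<Longrightarrow> t < 1 \<Longrightarrow> branch s C (of_real t) k w \<Longrightarrow> cmod k \<le> t \<Longrightarrow>
     cmod (1 - k) \<le> M * (1 - t) \<and> t * cmod (w - of_real (cc s C / cb s C)) \<le> M * (1 - t)"
    using inflow_near_1[OF s C] by blast
  show ?thesis
  proof (rule inflow_label_MU_E[OF s C sC lam, where L = "2 ^ (\<sigma> - 1) * M"])
    show "bsym (Extrapolation \<sigma>) C k w \<noteq> 1" if "on_branch s C x k w" for x k w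
      using on_branch_D(4)[OF that] by (auto simp: bsym_simps)
    show "bsym (Extrapolation \<sigma>) C 1 (of_real (cc s C / cb s C)) = 1" using \<sigma> by (simp add: bsym_simps)
    fix t :: real and k w assume t: "0 < t" "t < 1" and ob: "on_branch s C (of_real t) k w"
    have k: "cmod (1 - k) \<le> M * (1 - t)" using M(2)[OF t on_branch_D(3)[OF ob]] on_branch_D(2)[OF ob] t by simp
    have k2: "cmod (1 - k) \<le> 2" using norm_triangle_ineq4[of 1 k] on_branch_D(4)[OF ob] by simp
    have "t * cmod (1 - bsym (Extrapolation \<sigma>) C k w) \<le> 1 * cmod (1 - k) ^ \<sigma>"
      using t by (simp add: bsym_simps norm_power mult_left_le_one_le)
    also have "\<dots> = cmod (1 - k) ^ (\<sigma> - 1) * cmod (1 - k)" using \<sigma> by (simp flip: power_Suc2)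
    also have "\<dots> \<le> 2 ^ (\<sigma> - 1) * (M * (1 - t))" using k k2 by (intro mult_mono power_mono) auto
    finally show "t * cmod (1 - bsym (Extrapolation \<sigma>) C k w) \<le> 2 ^ (\<sigma> - 1) * M * (1 - t)" by simp
  qed
qed

section \<open>The parameters of part (B)\<close>

lemma coefs_half:
  "ca (3/2) (1/2) = 5/8" "cb (3/2) (1/2) = 9/8" "cc (3/2) (1/2) = 3/8" "cd (3/2) (1/2) = -1/8"
  "ca (3/2) (-1/2) = -1/8" "cb (3/2) (-1/2) = 3/8" "cc (3/2) (-1/2) = 9/8" "cd (3/2) (-1/2) = 5/8"
  "ca 2 (1/2) = 1/2" "cb 2 (1/2) = 3/2" "cc 2 (1/2) = 1/2" "cd 2 (1/2) = -1/2"
  "ca 2 (-1/2) = -1/2" "cb 2 (-1/2) = 1/2" "cc 2 (-1/2) = 3/2" "cd 2 (-1/2) = 1/2"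
  by (simp_all add: coef_defs)

lemma bsym_extrapolated_equilibrium_1:
  "bsym (ExtrapolatedEquilibrium (Suc 0)) C k w = of_real ((1 + C) / 2) * (k + w)"
  using bsym_simps(6) by simp

text \<open>Sum of the two branch equations; the columns of the collision matrix add up to 1, so
  this is conservation of \<open>m1\<close>.\<close>

lemma branch_mass: "branch s C x k w \<Longrightarrow> k + w = x * (1 + k * w)"
proof -
  assume br: "branch s C x k w"
  define p where "p = k * w"
  have e: "complex_of_real (ca s C) = 1 - of_real (cc s C)" "complex_of_real (cb s C) = 1 - of_real (cd s C)"
    by (simp_all add: coef_defs)
  have "k = x * (of_real (ca s C) + of_real (cb s C) * p)" "w = x * (of_real (cc s C) + of_real (cd s C) * p)"
    using br unfolding branch_def p_def by blast+
  then have "k + w = x * (of_real (ca s C) + of_real (cb s C) * p) + x * (of_real (cc s C) + of_real (cd s C) * p)" by simp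
  also have "\<dots> = x * (1 + p)" unfolding e by (simp add: algebra_simps)
  finally show ?thesis by (simp add: p_def)
qed

text \<open>The factor \<open>(1 + C) / 2 = 1/4\<close> is small enough for the triangle inequality:
  \<open>|w| \<le> sqrt 3 < 9/5\<close> gives
  \<open>|bsym| \<le> (1 + 9/5) / 4 = 7/10\<close>.\<close>

lemma SS_outflow_half:
  assumes s: "s = 3/2 \<or> s = 2" and lam: "lam > 0" and b: "b = ExtrapolatedEquilibrium 1 \<or> b = Future"
  shows "SS_est s (-1/2) b lam"
proof (rule SS_est_if_symbol_away_from_1[OF _ _ _ _ lam, where \<delta> = "3/10"])
  fix x k w assume ob: "on_branch s (-1/2) x k w"
  have "cmod w \<le> sqrt 3" using on_branch_w_le[OF _ _ _ _ ob] s by auto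
  also have "\<dots> \<le> 9/5" by (rule real_le_lsqrt) (simp_all add: power2_eq_square)
  finally have w: "cmod w \<le> 9/5" .
  have k: "cmod k \<le> 1" using on_branch_D(4)[OF ob] by simp
  have "cmod (k\<^sup>2 * w) \<le> 1 * (9/5)" unfolding norm_mult norm_power using w k by (intro mult_mono power_le_one) auto
  then have "cmod (k + k\<^sup>2 * w) \<le> 14/5" "cmod (k + w) \<le> 14/5" using w k by (intro norm_triangle_le; simp)+
  then have "cmod (bsym b (-1/2) k w) \<le> 7/10" using b by (auto simp: bsym_simps bsym_extrapolated_equilibrium_1 norm_mult)
  then show "3/10 \<le> cmod (1 - bsym b (-1/2) k w)" using norm_triangle_ineq2[of 1 "bsym b (-1/2) k w"] by simp
qed (use s in auto)

lemma half_product_bound: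
  assumes s: "0 < s" "s \<le> 2" and ob: "on_branch s (1/2) x k w"
  shows "(cmod w)\<^sup>2 \<le> 1/3" "(cmod (k * w))\<^sup>2 \<le> 1/3"
proof -
  show w: "(cmod w)\<^sup>2 \<le> 1/3" using on_branch_w_sq[OF s _ ob] by simp
  have "(cmod (k * w))\<^sup>2 \<le> 1 * (1/3)"
    unfolding norm_mult power_mult_distrib using on_branch_D(4)[OF ob] w by (intro mult_mono power_le_one) auto
  then show "(cmod (k * w))\<^sup>2 \<le> 1/3" by simp
qed

text \<open>The disc for \<open>p\<close> and the exterior of a disc about -1 meet in a small lens
  in the right half plane.\<close>

lemma Re_product_bound:
  fixes p :: complex
  assumes p: "(cmod p)\<^sup>2 \<le> 1/3" and l: "4/3 \<le> cmod (1 + p)"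
  shows "2/9 \<le> Re p" "Re p \<le> 1" "(Im p)\<^sup>2 \<le> 1/3" "(Re p)\<^sup>2 + (Im p)\<^sup>2 \<le> 1/3"
proof -
  have n: "(Re p)\<^sup>2 + (Im p)\<^sup>2 \<le> 1/3" using p by (simp add: cmod_power2)
  have "(4/3)\<^sup>2 \<le> (cmod (1 + p))\<^sup>2" using l by (intro power_mono) auto
  also have "\<dots> = 1 + 2 * Re p + ((Re p)\<^sup>2 + (Im p)\<^sup>2)" unfolding cmod_power2 by (simp add: power2_eq_square algebra_simps)
  finally show "2/9 \<le> Re p" using n by (simp add: power2_eq_square)
  show "(Re p)\<^sup>2 + (Im p)\<^sup>2 \<le> 1/3" by (rule n)
  have "(Re p)\<^sup>2 \<le> 1\<^sup>2" unfolding one_power2 using n zero_le_power2[of "Im p"] by linarith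
  then show "Re p \<le> 1" by (rule power2_le_imp_le) simp
  show "(Im p)\<^sup>2 \<le> 1/3" using n zero_le_power2[of "Re p"] by linarith
qed

text \<open>These are the cofactors of \<open>3 p - 1\<close> in the eliminated boundary equations:
  \<open>ExtrapolatedEquilibrium 1\<close> with \<open>s = 2\<close> and \<open>s = 3/2\<close>,
  then \<open>Future\<close> with \<open>s = 2\<close> and \<open>s = 3/2\<close>.\<close>

lemma half_cofactors_nonzero:
  fixes p :: complex
  assumes p: "(cmod p)\<^sup>2 \<le> 1/3" and l: "4/3 \<le> cmod (1 + p)"
  shows "3 * p\<^sup>2 + 11 * p + 4 \<noteq> 0" "12 * p\<^sup>2 + 31 * p + 15 \<noteq> 0"
    "9 * p ^ 3 + 24 * p\<^sup>2 + 23 * p + 16 \<noteq> 0" "27 * p ^ 3 + 78 * p\<^sup>2 + 83 * p + 48 \<noteq> 0"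
proof -
  note B = Re_product_bound[OF p l]
  have r2: "Re (p\<^sup>2) = (Re p)\<^sup>2 - (Im p)\<^sup>2" by (simp add: power2_eq_square)
  have "Re (p ^ 3) = (Re p) ^ 3 - 3 * (Re p * (Im p)\<^sup>2)" by (simp add: power3_eq_cube power2_eq_square algebra_simps)
  moreover have "Re p * (Im p)\<^sup>2 \<le> 1 * (1/3)" using B by (intro mult_mono) auto
  moreover have "0 \<le> (Re p) ^ 3" using B by simp
  ultimately have r3: "-1 \<le> Re (p ^ 3)" by linarith
  have q2: "-1/3 \<le> Re (p\<^sup>2)" using B zero_le_power2[of "Re p"] unfolding r2 by linarith
  have "0 < Re (3 * p\<^sup>2 + 11 * p + 4)" using q2 B(1) by (simp del: Re_power2)
  then show "3 * p\<^sup>2 + 11 * p + 4 \<noteq> 0" by (metis less_irrefl zero_complex.sel(1))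
  have "0 < Re (12 * p\<^sup>2 + 31 * p + 15)" using q2 B(1) by (simp del: Re_power2)
  then show "12 * p\<^sup>2 + 31 * p + 15 \<noteq> 0" by (metis less_irrefl zero_complex.sel(1))
  have "0 < Re (9 * p ^ 3 + 24 * p\<^sup>2 + 23 * p + 16)" using q2 r3 B(1) by (simp del: Re_power2)
  then show "9 * p ^ 3 + 24 * p\<^sup>2 + 23 * p + 16 \<noteq> 0" by (metis less_irrefl zero_complex.sel(1))
  have "0 < Re (27 * p ^ 3 + 78 * p\<^sup>2 + 83 * p + 48)" using q2 r3 B(1) by (simp del: Re_power2)
  then show "27 * p ^ 3 + 78 * p\<^sup>2 + 83 * p + 48 \<noteq> 0" by (metis less_irrefl zero_complex.sel(1))
qed

lemma half_branch_scaled: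
  assumes s: "s = 3/2 \<or> s = 2" and br: "branch s (1/2) x k w"
  shows "(s = 3/2 \<and> 8 * k = x * (5 + 9 * (k * w)) \<and> 8 * w = x * (3 - k * w)) \<or>
         (s = 2 \<and> 2 * k = x * (1 + 3 * (k * w)) \<and> 2 * w = x * (1 - k * w))"
  using s
proof
  assume s: "s = 3/2"
  have "k = x * (5/8 + 9/8 * (k * w))" "w = x * (3/8 + -1/8 * (k * w))"
    using br unfolding s branch_def coefs_half by simp_all
  then have "8 * k = 8 * (x * (5/8 + 9/8 * (k * w)))" "8 * w = 8 * (x * (3/8 + -1/8 * (k * w)))" by metis+
  then show ?thesis using s by (simp add: algebra_simps)
next
  assume s: "s = 2"
  have "k = x * (1/2 + 3/2 * (k * w))" "w = x * (1/2 + -1/2 * (k * w))"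
    using br unfolding s branch_def coefs_half by simp_all
  then have "2 * k = 2 * (x * (1/2 + 3/2 * (k * w)))" "2 * w = 2 * (x * (1/2 + -1/2 * (k * w)))" by metis+
  then show ?thesis using s by (simp add: algebra_simps)
qed

text \<open>Eliminating \<open>x\<close> and \<open>k\<close> turns the boundary condition into a polynomial equation for
  \<open>p = k w\<close> with the root \<open>p = 1/3\<close> (the consistent mode \<open>x = k = 1\<close>); the cofactor has positive
  real part on the admissible set.\<close>

lemma half_symbol_ne_1:
  assumes s: "s = 3/2 \<or> s = 2" and ob: "on_branch s (1/2) x k w"
    and b: "b = ExtrapolatedEquilibrium 1 \<or> b = Future"
  shows "bsym b (1/2) k w \<noteq> 1"
proof
  assume one: "bsym b (1/2) k w = 1"
  define p where "p = k * w"
  have s': "0 < s" "s \<le> 2" using s by auto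
  have pb: "(cmod p)\<^sup>2 \<le> 1/3" unfolding p_def by (rule half_product_bound(2)[OF s' ob])
  note br = on_branch_D(3)[OF ob]
  note sc = half_branch_scaled[OF s br, folded p_def]
  from b show False
  proof
    assume b: "b = ExtrapolatedEquilibrium 1"
    have "3 * (k + w) = 4" using one by (simp add: b bsym_simps bsym_extrapolated_equilibrium_1 field_simps)
    then have xp: "3 * (x * (1 + p)) = 4" using branch_mass[OF br] by (simp add: p_def)
    have "cmod (3 * (x * (1 + p))) = 4" unfolding xp by simp
    then have "4/3 = cmod x * cmod (1 + p)" by (simp add: norm_mult)
    also have "\<dots> \<le> 1 * cmod (1 + p)" using on_branch_D(1)[OF ob] by (intro mult_right_mono) auto
    \<comment> \<open>The boundary condition and \<open>|x| < 1\<close> push \<open>p\<close> to the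
      right, into the set on which the cofactors do not vanish. For \<open>Future\<close> the factor
      \<open>k\<close> plays the part of \<open>x\<close>.\<close>
    finally have l: "4/3 \<le> cmod (1 + p)" by simp
    have "3 * p = 1"
      using sc
    proof (elim disjE conjE)
      assume kw: "8 * k = x * (5 + 9 * p)" "8 * w = x * (3 - p)"
      have "64 * p = x\<^sup>2 * ((5 + 9 * p) * (3 - p))" using kw unfolding p_def by algebra
      then have "(3 * p - 1) * (12 * p\<^sup>2 + 31 * p + 15) = 0" using xp by algebra
      then show ?thesis using half_cofactors_nonzero(2)[OF pb l] by simp
    next
      assume kw: "2 * k = x * (1 + 3 * p)" "2 * w = x * (1 - p)"
      have "4 * p = x\<^sup>2 * ((1 + 3 * p) * (1 - p))" using kw unfolding p_def by algebra
      then have "(3 * p - 1) * (3 * p\<^sup>2 + 11 * p + 4) = 0" using xp by algebra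
      then show ?thesis using half_cofactors_nonzero(1)[OF pb l] by simp
    qed
    then have "x = 1" using xp by algebra
    then show False using on_branch_D(1)[OF ob] by simp
  next
    assume b: "b = Future"
    have "3 * (k + k\<^sup>2 * w) = 4" using one by (simp add: b bsym_simps bsym_extrapolated_equilibrium_1 field_simps)
    then have kp: "3 * (k * (1 + p)) = 4" unfolding p_def by (simp add: algebra_simps power2_eq_square)
    have "cmod (3 * (k * (1 + p))) = 4" unfolding kp by simp
    then have "4/3 = cmod k * cmod (1 + p)" by (simp add: norm_mult)
    also have "\<dots> \<le> 1 * cmod (1 + p)" using on_branch_D(4)[OF ob] by (intro mult_right_mono) auto
    finally have l: "4/3 \<le> cmod (1 + p)" by simp
    have pw: "3 * (p * (1 + p)) = 4 * w"
    proof -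
      have "3 * (p * (1 + p)) = 3 * (k * (1 + p)) * w" by (simp add: p_def mult_ac)
      then show ?thesis unfolding kp .
    qed
    have "3 * p = 1"
      using sc
    proof (elim disjE conjE)
      assume kw: "8 * k = x * (5 + 9 * p)" "8 * w = x * (3 - p)"
      have px: "6 * (p * (1 + p)) = x * (3 - p)" using pw kw(2) by algebra
      have "3 * ((8 * k) * (1 + p)) = 8 * (3 * (k * (1 + p)))" by simp
      then have xk: "3 * (x * (5 + 9 * p) * (1 + p)) = 32" unfolding kp kw(1) by simp
      have "2 * (9 * p * (1 + p)\<^sup>2 * (5 + 9 * p)) = 3 * ((5 + 9 * p) * (1 + p)) * (6 * (p * (1 + p)))"
        by (simp add: power2_eq_square algebra_simps)
      also have "\<dots> = 3 * (x * (5 + 9 * p) * (1 + p)) * (3 - p)" unfolding px by (simp add: algebra_simps)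
      finally have "2 * (9 * p * (1 + p)\<^sup>2 * (5 + 9 * p)) = 2 * (16 * (3 - p))" unfolding xk by simp
      then have "9 * p * (1 + p)\<^sup>2 * (5 + 9 * p) = 16 * (3 - p)" unfolding mult_cancel_left by simp
      then have "(3 * p - 1) * (27 * p ^ 3 + 78 * p\<^sup>2 + 83 * p + 48) = 0" by algebra
      then show ?thesis using half_cofactors_nonzero(4)[OF pb l] by simp
    next
      assume kw: "2 * k = x * (1 + 3 * p)" "2 * w = x * (1 - p)"
      have px: "3 * (p * (1 + p)) = 2 * (x * (1 - p))" using pw kw(2) by algebra
      have "3 * ((2 * k) * (1 + p)) = 2 * (3 * (k * (1 + p)))" by simp
      then have xk: "3 * (x * (1 + 3 * p) * (1 + p)) = 8" unfolding kp kw(1) by simp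
      have "9 * p * (1 + p)\<^sup>2 * (1 + 3 * p) = 3 * ((1 + 3 * p) * (1 + p)) * (3 * (p * (1 + p)))"
        by (simp add: power2_eq_square algebra_simps)
      also have "\<dots> = 2 * (3 * (x * (1 + 3 * p) * (1 + p))) * (1 - p)" unfolding px by (simp add: algebra_simps)
      finally have "9 * p * (1 + p)\<^sup>2 * (1 + 3 * p) = 16 * (1 - p)" unfolding xk by simp
      then have "(3 * p - 1) * (9 * p ^ 3 + 24 * p\<^sup>2 + 23 * p + 16) = 0" by algebra
      then show ?thesis using half_cofactors_nonzero(3)[OF pb l] by simp
    qed
    then have "1 + p = 4/3" by (simp add: field_simps)
    with kp have "3 * (k * (4/3)) = 4" by (simp only:)
    then have "k = 1" by simp
    then show False using on_branch_D(4)[OF ob] by simp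
  qed
qed

text \<open>Both symbols equal 1 at the consistent mode \<open>k = 1\<close>, \<open>w = 1/3\<close>
  and are Lipschitz around it, so the rates of \<open>inflow_near_1\<close> carry over.\<close>

lemma inflow_half_label:
  assumes s: "s = 3/2 \<or> s = 2" and lam: "lam > 0" and b: "b = ExtrapolatedEquilibrium 1 \<or> b = Future"
  shows "has_label lam s (1/2) b L_MU_E"
proof -
  have s': "0 < s" "s \<le> 2" using s by auto
  obtain M where M: "0 < M" "\<And>t k w. 0 < t \<Longrightarrow> t < 1 \<Longrightarrow> branch s (1/2) (of_real t) k w \<Longrightarrow> cmod k \<le> t \<Longrightarrow>
     cmod (1 - k) \<le> M * (1 - t) \<and> t * cmod (w - of_real (cc s (1/2) / cb s (1/2))) \<le> M * (1 - t)"
    using inflow_near_1[OF s', of "1/2"] by auto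
  have r: "cc s (1/2) / cb s (1/2) = 1/3" using s by (elim disjE; simp only: coefs_half; simp)
  show ?thesis
  proof (rule inflow_label_MU_E[OF s' _ _ _ lam half_symbol_ne_1[OF s _ b], where L = "4 * M"])
    show "bsym b (1/2) 1 (of_real (cc s (1/2) / cb s (1/2))) = 1"
      unfolding r using b by (auto simp: bsym_simps bsym_extrapolated_equilibrium_1)
    fix t :: real and k w assume t: "0 < t" "t < 1" and ob: "on_branch s (1/2) (of_real t) k w"
    have k: "cmod (1 - k) \<le> M * (1 - t)" and w: "t * cmod (w - 1/3) \<le> M * (1 - t)"
      using M(2)[OF t on_branch_D(3)[OF ob]] on_branch_D(2)[OF ob] t unfolding r by simp_all
    have tk: "t * cmod (1 - k) \<le> M * (1 - t)" using k t mult_left_le_one_le[of "cmod (1 - k)" t] by simp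
    have w1: "cmod w \<le> 1"
    proof (rule power2_le_imp_le)
      show "(cmod w)\<^sup>2 \<le> 1\<^sup>2" using half_product_bound(1)[OF s' ob] by simp
    qed simp
    have "t * cmod (1 - bsym b (1/2) k w) \<le> t * (3/4 * (3 * cmod (1 - k) + cmod (w - 1/3)))"
    proof (intro mult_left_mono)
      from b show "cmod (1 - bsym b (1/2) k w) \<le> 3/4 * (3 * cmod (1 - k) + cmod (w - 1/3))"
      proof
        assume b: "b = ExtrapolatedEquilibrium 1"
        have "1 - bsym b (1/2) k w = 3/4 * ((1 - k) - (w - 1/3))" by (simp add: b bsym_simps bsym_extrapolated_equilibrium_1 field_simps)
        then have "cmod (1 - bsym b (1/2) k w) = 3/4 * cmod ((1 - k) - (w - 1/3))" by (simp only: norm_mult[of "3/4"]) simp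
        also have "\<dots> \<le> 3/4 * (3 * cmod (1 - k) + cmod (w - 1/3))"
        proof (intro mult_left_mono)
          show "cmod ((1 - k) - (w - 1/3)) \<le> 3 * cmod (1 - k) + cmod (w - 1/3)"
            using norm_triangle_ineq4[of "1 - k" "w - 1/3"] norm_ge_zero[of "1 - k"] by linarith
        qed simp
        finally show ?thesis .
      next
        assume b: "b = Future"
        have "1 - bsym b (1/2) k w = 3/4 * (((1 - k) + w * (1 + k) * (1 - k)) - (w - 1/3))"
          by (simp add: b bsym_simps bsym_extrapolated_equilibrium_1 field_simps power2_eq_square)
        then have "cmod (1 - bsym b (1/2) k w) = 3/4 * cmod (((1 - k) + w * (1 + k) * (1 - k)) - (w - 1/3))" by (simp only: norm_mult[of "3/4"]) simp
        also have "\<dots> \<le> 3/4 * (3 * cmod (1 - k) + cmod (w - 1/3))"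
        proof (intro mult_left_mono)
          have "cmod (w * (1 + k) * (1 - k)) \<le> 1 * 2 * cmod (1 - k)"
            unfolding norm_mult using w1 norm_triangle_ineq[of 1 k] on_branch_D(4)[OF ob] by (intro mult_mono mult_nonneg_nonneg) auto
          then have "cmod ((1 - k) + w * (1 + k) * (1 - k)) \<le> 3 * cmod (1 - k)" by (intro norm_triangle_le) simp
          then show "cmod (((1 - k) + w * (1 + k) * (1 - k)) - (w - 1/3)) \<le> 3 * cmod (1 - k) + cmod (w - 1/3)"
            by (intro order_trans[OF norm_triangle_ineq4]) simp
        qed simp
        finally show ?thesis .
      qed
    qed (use t in simp)
    also have "\<dots> = 3/4 * (3 * (t * cmod (1 - k)) + t * cmod (w - 1/3))" by (simp add: algebra_simps)
    also have "\<dots> \<le> 3/4 * (3 * (M * (1 - t)) + M * (1 - t))" using tk w by (intro mult_left_mono add_mono) auto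
    also have "\<dots> \<le> 4 * M * (1 - t)" using M t by simp
    finally show "t * cmod (1 - bsym b (1/2) k w) \<le> 4 * M * (1 - t)" .
  qed auto
qed

text \<open>The symbol is \<open>(3 - 3 k + k^2) (k + w) / 4\<close>, with
  \<open>|k + w| \<le> A\<close> by \<open>branch_mass\<close> and \<open>|k| \<le> H / 8\<close>.
  Bounding \<open>A\<close> and \<open>H\<close> separately loses too much. They are tied by
  \<open>H^2 + 3 A^2 = 4 + 12 t^2\<close>, so a large \<open>A\<close> forces a small
  \<open>H\<close>; the target \<open>19/5 < 4\<close> leaves the gap \<open>1/20\<close>.\<close>

lemma SS_extrapolated_equilibrium_3:
  assumes lam: "lam > 0"
  shows "SS_est (3/2) (-1/2) (ExtrapolatedEquilibrium 3) lam"
proof (rule SS_est_if_symbol_away_from_1[OF _ _ _ _ lam, where \<delta> = "1/20"])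
  fix x k w assume ob: "on_branch (3/2) (-1/2) x k w"
  note br = on_branch_D(3)[OF ob] and x1 = on_branch_D(1)[OF ob]
  define p where "p = k * w"
  define t H A u where "t = cmod p" and "H = cmod (3 * p - 1)" and "A = cmod (1 + p)" and "u = Re p"
  have t0: "0 \<le> t" and H0: "0 \<le> H" and A0: "0 \<le> A" by (simp_all add: t_def H_def A_def)
  have "k = x * (-1/8 + 3/8 * p)" "w = x * (9/8 + 5/8 * p)"
    using br unfolding branch_def coefs_half p_def by simp_all
  then have e: "8 * k = x * (3 * p - 1)" "8 * w = x * (9 + 5 * p)" by (simp_all add: field_simps)
  have "8 * cmod k = cmod x * H" unfolding H_def norm_mult[symmetric] e(1)[symmetric] by (simp add: norm_mult)
  also have "\<dots> \<le> 1 * H" using x1 H0 by (intro mult_right_mono) auto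
  finally have k: "cmod k \<le> H / 8" by simp
  have "8 * cmod w = cmod x * cmod (9 + 5 * p)" unfolding norm_mult[symmetric] e(2)[symmetric] by (simp add: norm_mult)
  also have "\<dots> \<le> 1 * (9 + 5 * t)"
    using x1 norm_triangle_ineq[of 9 "5 * p"] by (intro mult_mono) (auto simp: t_def norm_mult)
  finally have w: "cmod w \<le> (9 + 5 * t) / 8" by simp
  have tH: "64 * t \<le> H * (9 + 5 * t)"
  proof -
    have "t = cmod k * cmod w" by (simp add: t_def p_def norm_mult)
    also have "\<dots> \<le> H / 8 * ((9 + 5 * t) / 8)" using k w H0 by (intro mult_mono) auto
    finally show ?thesis by simp
  qed
  have H1: "H \<le> 1 + 3 * t" unfolding H_def t_def using norm_triangle_ineq4[of "3 * p" 1] by (simp add: norm_mult)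
  have "cmod w \<le> sqrt 3" using on_branch_w_le[OF _ _ _ _ ob] by simp
  also have "\<dots> \<le> 7/4" by (rule real_le_lsqrt) (simp_all add: power2_eq_square)
  finally have w2: "cmod w \<le> 7/4" .
  have "t \<le> (1 + 3 * t) / 8 * (7/4)"
  proof -
    have "t = cmod k * cmod w" by (simp add: t_def p_def norm_mult)
    also have "\<dots> \<le> (1 + 3 * t) / 8 * (7/4)" using k H1 w2 t0 by (intro mult_mono) auto
    finally show ?thesis .
  qed
  then have t1: "t \<le> 7/10" by simp
  \<comment> \<open>\<open>64 t \<le> (1 + 3 t) (9 + 5 t)\<close> says
    \<open>(3 t - 1) (5 t - 9) \<ge> 0\<close>; the crude bound \<open>7/10\<close> excludes
    \<open>t \<ge> 9/5\<close>.\<close>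
  have t2: "t \<le> 1/3"
  proof (rule ccontr)
    assume "\<not> t \<le> 1/3"
    then have "(3 * t - 1) * (5 * t - 9) < 0" using t1 by (intro mult_pos_neg) auto
    moreover have "64 * t \<le> (1 + 3 * t) * (9 + 5 * t)"
      using order_trans[OF tH mult_right_mono[OF H1, of "9 + 5 * t"]] t0 by simp
    ultimately show False by (simp add: algebra_simps)
  qed
  have A2: "A\<^sup>2 = 1 + 2 * u + t\<^sup>2" and H2: "H\<^sup>2 = 1 - 6 * u + 9 * t\<^sup>2"
    unfolding A_def H_def t_def u_def cmod_power2 by (simp_all add: power2_eq_square algebra_simps)
  have tt: "t\<^sup>2 \<le> 1/9" using power_mono[OF t2 t0, of 2] by (simp add: power2_eq_square)
  have main: "A * (3 + 3 * (H / 8) + (H / 8)\<^sup>2) \<le> 19/5"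
  proof (cases "0 \<le> u")
    case True
    \<comment> \<open>For \<open>u \<ge> 0\<close> the bound on \<open>H\<close> improves to
      \<open>1 + 9/2 t^2\<close>. Between \<open>18/100\<close> and \<open>1/3\<close> the sign of
      \<open>(t - 18/100) (t - 1/3)\<close> reduces \<open>t^2\<close> and \<open>t^3\<close> to
      linear terms.\<close>
    have t18: "t \<le> 18/100"
    proof (rule ccontr)
      assume "\<not> t \<le> 18/100"
      then have q: "(t - 18/100) * (t - 1/3) \<le> 0" using t2 by (intro mult_nonneg_nonpos) auto
      then have q3: "t * ((t - 18/100) * (t - 1/3)) \<le> 0" by (rule mult_nonneg_nonpos[OF t0])
      have "H\<^sup>2 \<le> 1 + 9 * t\<^sup>2" unfolding H2 using True by simp
      also have "\<dots> \<le> (1 + 9/2 * t\<^sup>2)\<^sup>2" using zero_le_power2[of "9/2 * t\<^sup>2"] unfolding power2_sum by simp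
      finally have "H \<le> 1 + 9/2 * t\<^sup>2" by (rule power2_le_imp_le) simp
      then have "H * (9 + 5 * t) \<le> (1 + 9/2 * t\<^sup>2) * (9 + 5 * t)" using t0 by (intro mult_right_mono) auto
      then have "64 * t \<le> (1 + 9/2 * t\<^sup>2) * (9 + 5 * t)" by (rule order_trans[OF tH])
      moreover have "(1 + 9/2 * t\<^sup>2) * (9 + 5 * t) = 9 + 5 * t + 81/2 * (t * t) + 45/2 * (t * (t * t))"
        by (simp add: field_simps power2_eq_square)
      moreover have "t * t \<le> 77/150 * t - 3/50" using q by (simp add: field_simps)
      moreover have "t * (t * t) \<le> 77/150 * (t * t) - 3/50 * t" using q3 by (simp add: field_simps)
      ultimately show False using \<open>\<not> t \<le> 18/100\<close> by linarith
    qed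
    have "t\<^sup>2 \<le> (18/100)\<^sup>2" using t18 t0 by (intro power_mono) auto
    then have HA: "H\<^sup>2 \<le> 439/100 - 3 * A\<^sup>2" unfolding A2 H2 by (simp add: power2_eq_square)
    \<comment> \<open>A tangent replaces \<open>H\<close> by \<open>H^2\<close>, for which the tie
      with \<open>A^2\<close> is linear; \<open>1/2\<close> is close to the worst \<open>H\<close>
      of this case.\<close>
    have "0 \<le> (H - 1/2)\<^sup>2" by simp
    then have "H \<le> H\<^sup>2 + 1/4" by (simp add: power2_eq_square algebra_simps)
    then have "3 + 3 * (H / 8) + (H / 8)\<^sup>2 \<le> 3 + 3/8 * (H\<^sup>2 + 1/4) + H\<^sup>2 / 64" by (simp add: power_divide)
    also have "\<dots> \<le> 481/100 - 117/100 * A\<^sup>2"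
    proof -
      have "Y \<le> 439/100 - 3 * X \<Longrightarrow> 0 \<le> X \<Longrightarrow> 3 + 3/8 * (Y + 1/4) + Y / 64 \<le> 481/100 - 117/100 * X" for X Y :: real
        by (simp add: field_simps)
      then show ?thesis using HA by simp
    qed
    finally have "A * (3 + 3 * (H / 8) + (H / 8)\<^sup>2) \<le> A * (481/100 - 117/100 * A\<^sup>2)" by (rule mult_left_mono) (rule A0)
    also have "\<dots> \<le> 19/5"
    proof -
      have "A \<le> 4/3" unfolding A_def using norm_triangle_ineq[of 1 p] t2 by (simp add: t_def)
      \<comment> \<open>Bounds the cubic in \<open>A\<close> near its maximum:
        \<open>(A - m)^2 (A + 2 m) = A^3 - 3 m^2 A + 2 m^3\<close> with \<open>m\<close> close to
        the maximiser.\<close>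
      moreover have "0 \<le> (A - 117/100)\<^sup>2 * (A + 234/100)" using A0 by (intro mult_nonneg_nonneg) auto
      ultimately show ?thesis by (simp add: field_simps power2_eq_square)
    qed
    finally show ?thesis .
  next
    case False
    have HA: "H\<^sup>2 \<le> 16/3 - 3 * A\<^sup>2" using tt unfolding A2 H2 by simp
    have "A\<^sup>2 \<le> 10/9" using False tt unfolding A2 by simp
    have "A\<^sup>2 \<le> (106/100)\<^sup>2" using \<open>A\<^sup>2 \<le> 10/9\<close> by (simp add: power2_eq_square)
    then have A1: "A \<le> 106/100" by (rule power2_le_imp_le) simp
    \<comment> \<open>The same tangent device, now at the value of \<open>H\<close> that belongs to
      the largest admissible \<open>A\<close>, about \<open>106/100\<close>.\<close>
    have "0 \<le> (H - 7/5)\<^sup>2" by simp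
    then have "H \<le> 5/14 * H\<^sup>2 + 7/10" by (simp add: power2_eq_square algebra_simps)
    then have "3 + 3 * (H / 8) + (H / 8)\<^sup>2 \<le> 3 + 3/8 * (5/14 * H\<^sup>2 + 7/10) + H\<^sup>2 / 64" by (simp add: power_divide)
    also have "\<dots> \<le> 407/100 - 44/100 * A\<^sup>2"
    proof -
      have "Y \<le> 16/3 - 3 * X \<Longrightarrow> 0 \<le> X \<Longrightarrow> 3 + 3/8 * (5/14 * Y + 7/10) + Y / 64 \<le> 407/100 - 44/100 * X" for X Y :: real
        by (simp add: field_simps)
      then show ?thesis using HA by simp
    qed
    finally have "A * (3 + 3 * (H / 8) + (H / 8)\<^sup>2) \<le> A * (407/100 - 44/100 * A\<^sup>2)" by (rule mult_left_mono) (rule A0)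
    also have "\<dots> \<le> 19/5"
    proof -
      have "0 \<le> (A - 1)\<^sup>2 * (A + 2)" using A0 by (intro mult_nonneg_nonneg) auto
      then show ?thesis using A1 by (simp add: field_simps power2_eq_square)
    qed
    finally show ?thesis .
  qed
  have "cmod ((3 - 3 * k + k\<^sup>2) * (k + w)) \<le> (3 + 3 * (H / 8) + (H / 8)\<^sup>2) * A"
    unfolding norm_mult
  proof (rule mult_mono)
    have "cmod (k\<^sup>2) \<le> (H / 8)\<^sup>2" unfolding norm_power using k by (intro power_mono) auto
    moreover have "cmod (3 - 3 * k) \<le> 3 + 3 * (H / 8)" using norm_triangle_ineq4[of 3 "3 * k"] k by (simp add: norm_mult)
    ultimately show "cmod (3 - 3 * k + k\<^sup>2) \<le> 3 + 3 * (H / 8) + (H / 8)\<^sup>2" by (intro norm_triangle_le) simp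
    show "cmod (k + w) \<le> A" unfolding branch_mass[OF br] norm_mult A_def p_def
      using x1 by (intro mult_left_le_one_le) auto
  qed (use H0 in simp_all)
  then have "cmod (bsym (ExtrapolatedEquilibrium 3) (-1/2) k w) \<le> 19/20"
    using main unfolding bsym_simps norm_mult norm_of_real by (simp add: mult.commute)
  then show "1/20 \<le> cmod (1 - bsym (ExtrapolatedEquilibrium 3) (-1/2) k w)"
    using norm_triangle_ineq2[of 1 "bsym (ExtrapolatedEquilibrium 3) (-1/2) k w"] by simp
qed auto

lemma branch_from_product:
  assumes "p = x\<^sup>2 * (of_real (ca s C) + of_real (cb s C) * p) * (of_real (cc s C) + of_real (cd s C) * p)"
    and k: "k = x * (of_real (ca s C) + of_real (cb s C) * p)"
    and w: "w = x * (of_real (cc s C) + of_real (cd s C) * p)"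
  shows "branch s C x k w" "k * w = p"
proof -
  show kw: "k * w = p" unfolding k w using assms(1) by (simp add: power2_eq_square mult_ac)
  show "branch s C x k w" unfolding branch_def kw using k w by simp
qed

text \<open>As \<open>a + c = b + d = 1\<close>, the condition \<open>k + 2 w = 1\<close> reads
  \<open>x D = 1\<close>: the time factor is \<open>z = D\<close>, and only a cubic for the real
  number \<open>p\<close> remains.\<close>

lemma Invented_GR_L:
  fixes a b c d p D :: real
  assumes s: "0 < s" "s \<le> 2" and C: "\<bar>C\<bar> < 1" and lam: "lam > 0"
    and abcd: "ca s C = a" "cb s C = b" "cc s C = c" "cd s C = d"
    and D0: "D = 1 + c + (1 + d) * p" and D1: "1 < D"
    and eq0: "p * D\<^sup>2 = (a + b * p) * (c + d * p)"
    and k0: "\<bar>a + b * p\<bar> < D" and p: "p \<noteq> -1"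
  shows "has_label lam s C Invented L_GR_L"
proof -
  note D = D0[folded abcd] D1 and eq = eq0[folded abcd] and k = k0[folded abcd]
  define x k w where "x = complex_of_real (1 / D)" and "k = x * (of_real (ca s C) + of_real (cb s C) * of_real p)"
    and "w = x * (of_real (cc s C) + of_real (cd s C) * of_real p)"
  have kr: "k = of_real ((ca s C + cb s C * p) / D)" and wr: "w = of_real ((cc s C + cd s C * p) / D)"
    by (simp_all add: k_def w_def x_def)
  have "p = (1 / D)\<^sup>2 * (ca s C + cb s C * p) * (cc s C + cd s C * p)"
    using D(2) eq by (simp add: field_simps)
  then have "complex_of_real p = of_real ((1 / D)\<^sup>2 * (ca s C + cb s C * p) * (cc s C + cd s C * p))" by (simp only: of_real_eq_iff)
  then have pe: "complex_of_real p = x\<^sup>2 * (of_real (ca s C) + of_real (cb s C) * of_real p) * (of_real (cc s C) + of_real (cd s C) * of_real p)"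
    unfolding x_def by (simp only: of_real_mult of_real_add of_real_power)
  have br: "branch s C x k w" "k * w = of_real p"
    using branch_from_product[OF pe k_def w_def] by auto
  show ?thesis
  proof (rule label_GR_L[OF s C lam _ _ br(1)])
    show "x \<noteq> 0" "cmod x < 1" using D(2) by (simp_all add: x_def norm_divide)
    show "cmod k < 1" unfolding kr norm_of_real using D(2) k by (simp add: abs_divide)
    have "(ca s C + cb s C * p) + 2 * (cc s C + cd s C * p) = D"
      unfolding D(1) by (simp add: coef_defs field_simps)
    moreover have "(ca s C + cb s C * p) / D + 2 * ((cc s C + cd s C * p) / D)
        = ((ca s C + cb s C * p) + 2 * (cc s C + cd s C * p)) / D"
      by (simp add: add_divide_distrib)
    ultimately have "(ca s C + cb s C * p) / D + 2 * ((cc s C + cd s C * p) / D) = 1"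
      using D(2) by simp
    then have "complex_of_real ((ca s C + cb s C * p) / D + 2 * ((cc s C + cd s C * p) / D)) = 1" by (simp only: of_real_1)
    then show "bsym Invented C k w = 1" unfolding bsym_simps kr wr by simp
    show "k * w \<noteq> -1" unfolding br(2) using p by (metis of_real_1 of_real_eq_iff of_real_minus)
  qed
qed

lemma quadratic_root_between:
  fixes a b c l u :: real
  assumes "l \<le> u" "a * l\<^sup>2 + b * l + c \<le> 0" "0 \<le> a * u\<^sup>2 + b * u + c"
  shows "\<exists>p. l \<le> p \<and> p \<le> u \<and> a * p\<^sup>2 + b * p + c = 0"
  using assms by (intro IVT'[of "\<lambda>p. a * p\<^sup>2 + b * p + c"]) (auto intro!: continuous_intros)

text \<open>The cubic always has the spurious root \<open>p = -1\<close>. The quadratic cofactor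
  changes sign on a short interval, on which \<open>D > 1\<close> and \<open>|k| < 1\<close> are
  evident.\<close>

lemma Invented_label:
  assumes C: "C = 1/2 \<or> C = -1/2" and s: "s = 3/2 \<or> s = 2" and lam: "lam > 0"
  shows "has_label lam s C Invented L_GR_L"
proof -
  consider "C = -1/2" "s = 3/2" | "C = -1/2" "s = 2" | "C = 1/2" "s = 3/2" | "C = 1/2" "s = 2" using C s by blast
  then show ?thesis
  proof cases
    case 1
    obtain p :: real where p: "-4/100 \<le> p" "p \<le> -3/100" "169 * p\<^sup>2 + 258 * p + 9 = 0"
      using quadratic_root_between[of "-4/100" "-3/100" 169 258 9] by (auto simp: power2_eq_square)
    have "(p + 1) * (169 * p\<^sup>2 + 258 * p + 9) = 0" using p(3) by simp
    then have "p * (17 + 13 * p)\<^sup>2 = (3 * p - 1) * (9 + 5 * p)" by (simp add: algebra_simps power2_eq_square)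
    then have "p * ((17 + 13 * p) / 8)\<^sup>2 = ((3 * p - 1) / 8) * ((9 + 5 * p) / 8)" by (simp add: power_divide)
    also have "((3 * p - 1) / 8) * ((9 + 5 * p) / 8) = (-1/8 + 3/8 * p) * (9/8 + 5/8 * p)"
      by (simp add: diff_divide_distrib add_divide_distrib)
    finally have eq: "p * ((17 + 13 * p) / 8)\<^sup>2 = (-1/8 + 3/8 * p) * (9/8 + 5/8 * p)" .
    show ?thesis unfolding 1
      by (rule Invented_GR_L[where p = p and D = "(17 + 13 * p) / 8", OF _ _ _ lam coefs_half(5-8) _ _ eq])
        (use p(1,2) in \<open>simp_all add: abs_less_iff field_simps\<close>)
  next
    case 2
    obtain p :: real where p: "-2/10 \<le> p" "p \<le> -1/10" "9 * p\<^sup>2 + 20 * p + 3 = 0"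
      using quadratic_root_between[of "-2/10" "-1/10" 9 20 3] by (auto simp: power2_eq_square)
    have "(p + 1) * (9 * p\<^sup>2 + 20 * p + 3) = 0" using p(3) by simp
    then have "p * (5 + 3 * p)\<^sup>2 = (p - 1) * (3 + p)" by (simp add: algebra_simps power2_eq_square)
    then have "p * ((5 + 3 * p) / 2)\<^sup>2 = ((p - 1) / 2) * ((3 + p) / 2)" by (simp add: power_divide)
    also have "((p - 1) / 2) * ((3 + p) / 2) = (-1/2 + 1/2 * p) * (3/2 + 1/2 * p)"
      by (simp add: diff_divide_distrib add_divide_distrib)
    finally have eq: "p * ((5 + 3 * p) / 2)\<^sup>2 = (-1/2 + 1/2 * p) * (3/2 + 1/2 * p)" .
    show ?thesis unfolding 2
      by (rule Invented_GR_L[where p = p and D = "(5 + 3 * p) / 2", OF _ _ _ lam coefs_half(13-16) _ _ eq])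
        (use p(1,2) in \<open>simp_all add: abs_less_iff field_simps\<close>)
  next
    case 3
    obtain p :: real where p: "1/10 \<le> p" "p \<le> 2/10" "49 * p\<^sup>2 + 114 * p + (-15) = 0"
      using quadratic_root_between[of "1/10" "2/10" 49 114 "-15"] by (auto simp: power2_eq_square)
    have "(p + 1) * (49 * p\<^sup>2 + 114 * p + (-15)) = 0" using p(3) by simp
    then have "p * (11 + 7 * p)\<^sup>2 = (5 + 9 * p) * (3 - p)" by (simp add: algebra_simps power2_eq_square)
    then have "p * ((11 + 7 * p) / 8)\<^sup>2 = ((5 + 9 * p) / 8) * ((3 - p) / 8)" by (simp add: power_divide)
    also have "((5 + 9 * p) / 8) * ((3 - p) / 8) = (5/8 + 9/8 * p) * (3/8 + -1/8 * p)"
      by (simp add: diff_divide_distrib add_divide_distrib)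
    finally have eq: "p * ((11 + 7 * p) / 8)\<^sup>2 = (5/8 + 9/8 * p) * (3/8 + -1/8 * p)" .
    show ?thesis unfolding 3
      by (rule Invented_GR_L[where p = p and D = "(11 + 7 * p) / 8", OF _ _ _ lam coefs_half(1-4) _ _ eq])
        (use p(1,2) in \<open>simp_all add: abs_less_iff field_simps\<close>)
  next
    case 4
    obtain p :: real where p: "1/10 \<le> p" "p \<le> 2/10" "1 * p\<^sup>2 + 8 * p + (-1) = 0"
      using quadratic_root_between[of "1/10" "2/10" 1 8 "-1"] by (auto simp: power2_eq_square)
    have "(p + 1) * (1 * p\<^sup>2 + 8 * p + (-1)) = 0" using p(3) by simp
    then have "p * (3 + p)\<^sup>2 = (1 + 3 * p) * (1 - p)" by (simp add: algebra_simps power2_eq_square)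
    then have "p * ((3 + p) / 2)\<^sup>2 = ((1 + 3 * p) / 2) * ((1 - p) / 2)" by (simp add: power_divide)
    also have "((1 + 3 * p) / 2) * ((1 - p) / 2) = (1/2 + 3/2 * p) * (1/2 + -1/2 * p)"
      by (simp add: diff_divide_distrib add_divide_distrib)
    finally have eq: "p * ((3 + p) / 2)\<^sup>2 = (1/2 + 3/2 * p) * (1/2 + -1/2 * p)" .
    show ?thesis unfolding 4
      by (rule Invented_GR_L[where p = p and D = "(3 + p) / 2", OF _ _ _ lam coefs_half(9-12) _ _ eq])
        (use p(1,2) in \<open>simp_all add: abs_less_iff field_simps\<close>)
  qed
qed

text \<open>On the segment of real modes \<open>0 < p < 1/5\<close> the branch is parametrised by \<open>p\<close>, with
  \<open>x = sqrt (p / ((a + b p) (c + d p)))\<close>.\<close>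

lemma extrapolated_equilibrium_3_inflow:
  assumes s: "s = 3/2 \<or> s = 2" and lam: "lam > 0"
  shows "has_label lam s (1/2) (ExtrapolatedEquilibrium 3) L_GR_L"
proof -
  define a b c d where "a = ca s (1/2)" and "b = cb s (1/2)" and "c = cc s (1/2)" and "d = cd s (1/2)"
  have abcd: "(s = 3/2 \<and> a = 5/8 \<and> b = 9/8 \<and> c = 3/8 \<and> d = -1/8) \<or> (s = 2 \<and> a = 1/2 \<and> b = 3/2 \<and> c = 1/2 \<and> d = -1/2)"
    using s unfolding a_def b_def c_def d_def by (elim disjE; simp only: coefs_half; simp)
  define Q where "Q = (\<lambda>p. (a + b * p) * (c + d * p))"
  define X where "X = (\<lambda>p. sqrt (p / Q p))"
  define \<kappa> where "\<kappa> = (\<lambda>p. X p * (a + b * p))"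
  \<comment> \<open>The boundary symbol along the segment. It is 0 at \<open>p = 0\<close> and at
    least 1 at \<open>p = 1/5\<close>, so it takes the value 1 in between.\<close>
  define F where "F = (\<lambda>p. 3/4 * ((3 - 3 * \<kappa> p + (\<kappa> p)\<^sup>2) * (X p * (1 + p))))"
  have Qlow: "15/64 \<le> Q p" "0 < Q p" if "0 \<le> p" "p \<le> 1/5" for p
  proof -
    have "0 \<le> p * (1/5 - p)" using that by simp
    then have pp: "p * p \<le> p / 5" by (simp add: algebra_simps)
    show "15/64 \<le> Q p"
      using abcd
    proof (elim disjE conjE)
      assume v: "a = 5/8" "b = 9/8" "c = 3/8" "d = -1/8"
      have "Q p = (15 + 22 * p - 9 * (p * p)) / 64" unfolding Q_def v by (simp add: field_simps)
      then show ?thesis using pp that by simp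
    next
      assume v: "a = 1/2" "b = 3/2" "c = 1/2" "d = -1/2"
      have "Q p = (1 + 2 * p - 3 * (p * p)) / 4" unfolding Q_def v by (simp add: field_simps)
      then show ?thesis using pp that by simp
    qed
    then show "0 < Q p" by simp
  qed
  have Qcont: "continuous_on {0..1/5} Q" unfolding Q_def by (intro continuous_intros)
  have "\<forall>p\<in>{0..1/5}. Q p \<noteq> 0" using Qlow(2) by fastforce
  then have cont: "continuous_on {0..1/5} F"
    unfolding F_def \<kappa>_def X_def by (intro continuous_intros Qcont)
  have F0: "F 0 \<le> 1" by (simp add: F_def X_def)
  have F1: "1 \<le> F (1/5)"
    using abcd
  proof (elim disjE conjE)
    assume v: "a = 5/8" "b = 9/8" "c = 3/8" "d = -1/8"
    define y where "y = X (1/5)"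
    have y: "y = sqrt (80/119)" unfolding y_def X_def Q_def v by simp
    have y1: "81/100 \<le> y" "y \<le> 83/100"
      unfolding y by (rule real_le_rsqrt, simp add: power2_eq_square) (rule real_le_lsqrt, simp_all add: power2_eq_square)
    have k: "\<kappa> (1/5) = 17/20 * y" by (simp add: \<kappa>_def y_def v)
    have "0 \<le> (83/100 - y) * (3 - 17/20 * (83/100 + y))" using y1 by (intro mult_nonneg_nonneg) auto
    then have "138/100 \<le> 3 - 3 * \<kappa> (1/5) + (\<kappa> (1/5))\<^sup>2" unfolding k by (simp add: field_simps power2_eq_square)
    then have "138/100 * (81/100 * (6/5)) \<le> (3 - 3 * \<kappa> (1/5) + (\<kappa> (1/5))\<^sup>2) * (y * (6/5))"
      using y1 by (intro mult_mono) auto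
    then show ?thesis unfolding F_def y_def by simp
  next
    assume v: "a = 1/2" "b = 3/2" "c = 1/2" "d = -1/2"
    define y where "y = X (1/5)"
    have y: "y = sqrt (5/8)" unfolding y_def X_def Q_def v by simp
    have y1: "79/100 \<le> y" "y \<le> 80/100"
      unfolding y by (rule real_le_rsqrt, simp add: power2_eq_square) (rule real_le_lsqrt, simp_all add: power2_eq_square)
    have k: "\<kappa> (1/5) = 4/5 * y" by (simp add: \<kappa>_def y_def v)
    have "0 \<le> (80/100 - y) * (3 - 4/5 * (80/100 + y))" using y1 by (intro mult_nonneg_nonneg) auto
    then have "148/100 \<le> 3 - 3 * \<kappa> (1/5) + (\<kappa> (1/5))\<^sup>2" unfolding k by (simp add: field_simps power2_eq_square)
    then have "148/100 * (79/100 * (6/5)) \<le> (3 - 3 * \<kappa> (1/5) + (\<kappa> (1/5))\<^sup>2) * (y * (6/5))"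
      using y1 by (intro mult_mono) auto
    then show ?thesis unfolding F_def y_def by simp
  qed
  obtain p where p: "0 \<le> p" "p \<le> 1/5" "F p = 1" using IVT'[of F 0 1 "1/5", OF F0 F1 _ cont] by auto
  have p0: "0 < p" using p by (cases "p = 0") (auto simp: F_def X_def)
  have X2: "(X p)\<^sup>2 = p / Q p" using p0 Qlow(2)[OF p(1,2)] by (simp add: X_def)
  have X0: "0 < X p" using p0 Qlow(2)[OF p(1,2)] by (simp add: X_def)
  \<comment> \<open>\<open>64/75 < 1\<close>: the end point \<open>1/5\<close> is small enough for
    the whole segment to have \<open>|x| < 1\<close>.\<close>
  have "p / Q p \<le> (1/5) / (15/64)" using p Qlow[OF p(1,2)] by (intro frac_le) auto
  also have "\<dots> < 1\<^sup>2" by simp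
  finally have "(X p)\<^sup>2 < 1\<^sup>2" unfolding X2 .
  then have X1: "X p < 1" by (rule power_less_imp_less_base) simp
  define x k w where "x = complex_of_real (X p)" and "k = x * (of_real (ca s (1/2)) + of_real (cb s (1/2)) * of_real p)"
    and "w = x * (of_real (cc s (1/2)) + of_real (cd s (1/2)) * of_real p)"
  have "p = (X p)\<^sup>2 * (a + b * p) * (c + d * p)"
  proof -
    have "p = (X p)\<^sup>2 * Q p" unfolding X2 using Qlow(2)[OF p(1,2)] by simp
    then show ?thesis by (simp only: Q_def mult.assoc)
  qed
  then have "complex_of_real p = of_real ((X p)\<^sup>2 * (a + b * p) * (c + d * p))" by (simp only: of_real_eq_iff)
  then have pe: "complex_of_real p = x\<^sup>2 * (of_real (ca s (1/2)) + of_real (cb s (1/2)) * of_real p) * (of_real (cc s (1/2)) + of_real (cd s (1/2)) * of_real p)"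
    unfolding x_def a_def b_def c_def d_def by (simp only: of_real_mult of_real_add of_real_power)
  have br: "branch s (1/2) x k w" "k * w = of_real p"
    using branch_from_product[OF pe k_def w_def] by auto
  have kr: "k = of_real (\<kappa> p)" by (simp add: k_def x_def \<kappa>_def a_def b_def)
  have kp: "0 \<le> a + b * p" "a + b * p \<le> 1"
    using abcd p(1,2) by (elim disjE conjE; simp only:; simp)+
  show ?thesis
  proof (rule label_GR_L[OF _ _ _ lam _ _ br(1)])
    show "x \<noteq> 0" "cmod x < 1" using X0 X1 by (simp_all add: x_def)
    have "X p * (a + b * p) \<le> X p * 1" using X0 kp by (intro mult_left_mono) auto
    moreover have "0 \<le> X p * (a + b * p)" using X0 kp by simp
    ultimately show "cmod k < 1" using X1 unfolding kr norm_of_real \<kappa>_def abs_less_iff by linarith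
    have "bsym (ExtrapolatedEquilibrium 3) (1/2) k w = of_real (F p)"
      unfolding bsym_simps branch_mass[OF br(1)] br(2) unfolding kr x_def F_def by simp
    then show "bsym (ExtrapolatedEquilibrium 3) (1/2) k w = 1" by (simp add: p(3))
    show "k * w \<noteq> -1" unfolding br(2) using p0 by (auto simp: complex_eq_iff)
  qed (use s in auto)
qed

text \<open>If every root were at distance at least \<open>r\<close> from \<open>z\<close>, the
  product of the distances would be at least \<open>r ^ degree q\<close>.\<close>

lemma monic_poly_root_near:
  fixes q :: "complex poly"
  assumes q: "lead_coeff q = 1" "0 < degree q" and small: "cmod (poly q z) < r ^ degree q" and r: "0 < r"
  shows "\<exists>y. poly q y = 0 \<and> cmod (z - y) < r"
proof (rule ccontr)
  assume no: "\<nexists>y. poly q y = 0 \<and> cmod (z - y) < r"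
  have "q \<noteq> 0" using q by auto
  then obtain A where A: "size A = degree q" "q = smult (lead_coeff q) (\<Prod>x\<in>#A. [:-x, 1:])"
    using alg_closed_imp_factorization[of q] by metis
  have qA: "q = (\<Prod>x\<in>#A. [:-x, 1:])" by (rule A(2)[unfolded q(1) smult_1_left])
  have far: "r \<le> cmod (z - y)" if "y \<in># A" for y
  proof -
    have "poly q y = 0" unfolding qA poly_prod_mset prod_mset_zero_iff using that by force
    then show ?thesis using no not_le_imp_less by blast
  qed
  have "r ^ size B \<le> cmod (poly (\<Prod>x\<in>#B. [:-x, 1:]) z)" if "B \<subseteq># A" for B
    using that
  proof (induction B)
    case (add y B)
    have "B \<subseteq># A" "y \<in># A" using add.prems by (auto dest: mset_subset_eq_insertD subset_mset.less_imp_le)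
    then have "r * r ^ size B \<le> cmod (z - y) * cmod (poly (\<Prod>x\<in>#B. [:-x, 1:]) z)"
      using add.IH far r by (intro mult_mono) auto
    then show ?case by (simp add: norm_mult flip: left_diff_distrib)
  qed simp
  from this[OF subset_mset.order_refl] show False using small unfolding A(1) qA[symmetric] by linarith
qed

text \<open>The unstable mode used here is not real, so an intermediate value argument does not
  reach it. Instead a ten digit approximate root makes the residual smaller than
  \<open>(1/20) ^ 6\<close>.\<close>

lemma sextic_root:
  "\<exists>p::complex. p ^ 6 - 17 * p ^ 4 - 61 * p ^ 3 - 100 * p\<^sup>2 - 75 * p - 36 = 0 \<and>
     cmod (Complex (-4205611627/10000000000) (7502481718/10000000000) - p) < 1/20"
proof -
  define z where "z = Complex (-4205611627/10000000000) (7502481718/10000000000)"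
  define q where "q = [:-36, -75, -100, -61, -17, 0, 1 :: complex:]"
  have q: "lead_coeff q = 1" "degree q = 6" by (simp_all add: q_def)
  have "cmod (poly q z) \<le> \<bar>Re (poly q z)\<bar> + \<bar>Im (poly q z)\<bar>" by (rule cmod_le)
  also have "\<dots> < 1 / 64000000" by (simp add: q_def z_def)
  also have "\<dots> = (1/20) ^ 6" by (simp add: power_divide)
  finally have "cmod (poly q z) < (1/20) ^ degree q" unfolding q(2) .
  then obtain y where "poly q y = 0" "cmod (z - y) < 1/20"
    using monic_poly_root_near[of q z "1/20"] q by auto
  then show ?thesis unfolding z_def q_def by (intro exI[of _ y]) (simp add: algebra_simps eval_nat_numeral)
qed

lemma extrapolated_equilibrium_3_leapfrog_outflow:
  assumes lam: "lam > 0"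
  shows "has_label lam 2 (-1/2) (ExtrapolatedEquilibrium 3) L_GR_L"
proof -
  obtain p :: complex where sx: "p ^ 6 - 17 * p ^ 4 - 61 * p ^ 3 - 100 * p\<^sup>2 - 75 * p - 36 = 0"
    and near: "cmod (Complex (-4205611627/10000000000) (7502481718/10000000000) - p) < 1/20"
    using sextic_root by blast
  define z where "z = Complex (-4205611627/10000000000) (7502481718/10000000000)"
  have zp: "cmod (z - p) < 1/20" using near by (simp add: z_def)
  have z0: "cmod z \<le> 87/100" unfolding z_def complex_norm by (rule real_le_lsqrt) (simp_all add: power2_eq_square)
  have z1: "cmod (z - 1) \<le> 161/100" unfolding z_def cmod_def by (rule real_le_lsqrt) (simp_all add: power2_eq_square)
  have z1': "160/100 \<le> cmod (z - 1)" unfolding z_def cmod_def by (rule real_le_rsqrt) (simp add: power2_eq_square)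
  have z3: "268/100 \<le> cmod (z + 3)" unfolding z_def cmod_def by (rule real_le_rsqrt) (simp add: power2_eq_square)
  have z4: "cmod (z + 1) \<le> 1" unfolding z_def cmod_def by (rule real_le_lsqrt) (simp_all add: power2_eq_square)
  have z4': "1/2 \<le> cmod (z + 1)" unfolding z_def cmod_def by (rule real_le_rsqrt) (simp add: power2_eq_square)
  \<comment> \<open>Passing from the approximate to the true root changes each modulus by at most
    \<open>1/20\<close>; the inequalities needed below leave room for that.\<close>
  have tri: "cmod (u + p) \<le> cmod (u + z) + 1/20" "cmod (u + z) \<le> cmod (u + p) + 1/20" for u
    using zp norm_triangle_ineq4[of "u + z" "z - p"] norm_triangle_ineq[of "u + p" "z - p"] by simp_all
  have pz: "cmod p \<le> 92/100" "cmod (p - 1) \<le> 166/100" "155/100 \<le> cmod (p - 1)" "263/100 \<le> cmod (p + 3)"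
    "cmod (p + 1) \<le> 105/100" "45/100 \<le> cmod (p + 1)"
    using z0 z1 z1' z3 z4 z4' tri[of 0] tri[of "-1"] tri[of 3] tri[of 1] by (simp_all add: add.commute)
  \<comment> \<open>With \<open>2 k = x (p - 1)\<close> and
    \<open>x^2 (p - 1) (p + 3) = 4 p\<close>, every \<open>x^2\<close> can be removed from the
    boundary condition, which becomes the linear equation \<open>x E = N\<close>.\<close>
  define E where "E = (1 + p) * (p\<^sup>2 + 2 * p + 9)"
  define N where "N = 6 * p\<^sup>2 + 10 * p + 12"
  have p1: "1 + p \<noteq> 0" using pz(6) by (auto simp: add.commute)
  have pm: "p - 1 \<noteq> 0" and p3: "p + 3 \<noteq> 0" using pz(3,4) by auto
  have "p\<^sup>2 + 2 * p + 9 \<noteq> 0"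
  proof
    assume "p\<^sup>2 + 2 * p + 9 = 0"
    then have "(p + 1)\<^sup>2 = -8" by (simp add: power2_eq_square algebra_simps add_eq_0_iff)
    then have "(cmod (p + 1))\<^sup>2 = 8" by (metis norm_power norm_minus_cancel norm_numeral)
    moreover have "(cmod (p + 1))\<^sup>2 \<le> (105/100)\<^sup>2" using pz(5) by (intro power_mono) auto
    ultimately show False by (simp add: power2_eq_square)
  qed
  then have E0: "E \<noteq> 0" using p1 by (simp add: E_def)
  have pne: "p \<noteq> 0" using sx by auto
  define x where "x = N / E"
  \<comment> \<open>Inserting \<open>x = N / E\<close> into the mode equation yields
    \<open>p - 3\<close> times the sextic.\<close>
  have main: "4 * p * E\<^sup>2 = N\<^sup>2 * (p - 1) * (p + 3)"
  proof -
    have "4 * p * E\<^sup>2 - N\<^sup>2 * (p - 1) * (p + 3) = 4 * (p - 3) * (p ^ 6 - 17 * p ^ 4 - 61 * p ^ 3 - 100 * p\<^sup>2 - 75 * p - 36)"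
      unfolding E_def N_def by algebra
    then show ?thesis unfolding sx by simp
  qed
  have x2: "x\<^sup>2 * ((p - 1) * (p + 3)) = 4 * p"
    using main E0 by (simp add: x_def power_divide field_simps)
  have x0: "x \<noteq> 0" using x2 pne by auto
  have pe: "p = x\<^sup>2 * (of_real (ca 2 (-1/2)) + of_real (cb 2 (-1/2)) * p) * (of_real (cc 2 (-1/2)) + of_real (cd 2 (-1/2)) * p)"
  proof -
    have "x\<^sup>2 * (of_real (ca 2 (-1/2)) + of_real (cb 2 (-1/2)) * p) * (of_real (cc 2 (-1/2)) + of_real (cd 2 (-1/2)) * p)
       = x\<^sup>2 * ((p - 1) * (p + 3)) / 4"
      unfolding coefs_half by (simp add: field_simps)
    then show ?thesis unfolding x2 by simp
  qed
  define k w where "k = x * (of_real (ca 2 (-1/2)) + of_real (cb 2 (-1/2)) * p)"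
    and "w = x * (of_real (cc 2 (-1/2)) + of_real (cd 2 (-1/2)) * p)"
  have br: "branch 2 (-1/2) x k w" "k * w = p"
    using branch_from_product[OF pe k_def w_def] by auto
  have k2: "2 * k = x * (p - 1)" unfolding k_def coefs_half by (simp add: algebra_simps)
  have xn: "(cmod x)\<^sup>2 * (cmod (p - 1) * cmod (p + 3)) = 4 * cmod p"
    using arg_cong[OF x2, of cmod] by (simp add: norm_mult norm_power)
  show ?thesis
  proof (rule label_GR_L[OF _ _ _ lam x0 _ br(1)])
    show "cmod x < 1"
    proof (rule ccontr)
      assume "\<not> cmod x < 1"
      then have "1 \<le> (cmod x)\<^sup>2" by (simp add: one_le_power)
      moreover have "155/100 * (263/100) \<le> cmod (p - 1) * cmod (p + 3)" using pz by (intro mult_mono) auto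
      ultimately have "1 * (155/100 * (263/100)) \<le> (cmod x)\<^sup>2 * (cmod (p - 1) * cmod (p + 3))" by (rule mult_mono) auto
      then show False unfolding xn using pz(1) by simp
    qed
    show "cmod k < 1"
    proof (rule ccontr)
      assume "\<not> cmod k < 1"
      then have "1 \<le> (cmod k)\<^sup>2" by (simp add: one_le_power)
      \<comment> \<open>Eliminating \<open>x\<close> expresses \<open>|k|\<close> through
        \<open>p\<close> alone, so the bounds on \<open>p\<close> decide.\<close>
      have "k\<^sup>2 * (p + 3) = p * (p - 1)"
      proof -
        have "4 * (k\<^sup>2 * (p + 3)) = (2 * k)\<^sup>2 * (p + 3)" by (simp add: power_mult_distrib)
        also have "\<dots> = (x\<^sup>2 * ((p - 1) * (p + 3))) * (p - 1)" unfolding k2 by (simp add: power2_eq_square mult_ac)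
        finally show ?thesis unfolding x2 by simp
      qed
      then have "(cmod k)\<^sup>2 * cmod (p + 3) = cmod p * cmod (p - 1)" by (metis norm_mult norm_power)
      moreover have "cmod p * cmod (p - 1) \<le> 92/100 * (166/100)" using pz by (intro mult_mono) auto
      moreover have "1 * (263/100) \<le> (cmod k)\<^sup>2 * cmod (p + 3)" using pz \<open>1 \<le> (cmod k)\<^sup>2\<close> by (intro mult_mono) auto
      ultimately show False by simp
    qed
    have "x * E = N" using E0 by (simp add: x_def)
    have boundary: "(3 - 3 * k + k\<^sup>2) * (x * (1 + p)) = 4"
    proof -
      have "4 * (p + 3) * ((x * (1 + p)) * (3 - 3 * k + k\<^sup>2)) = (x * (1 + p)) * (p + 3) * (12 - 6 * (2 * k) + (2 * k)\<^sup>2)"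
        by (simp add: algebra_simps power2_eq_square)
      also have "\<dots> = 12 * (x * (1 + p) * (p + 3)) - 6 * (1 + p) * ((x\<^sup>2 * ((p - 1) * (p + 3))))
          + x * (1 + p) * (p - 1) * ((x\<^sup>2 * ((p - 1) * (p + 3))))"
        unfolding k2 by (simp add: algebra_simps power2_eq_square)
      also have "\<dots> = 4 * (x * E) - 24 * p * (1 + p)"
        unfolding x2 E_def by (simp add: algebra_simps power2_eq_square)
      also have "\<dots> = 4 * (p + 3) * 4" unfolding \<open>x * E = N\<close> N_def by (simp add: algebra_simps power2_eq_square)
      finally have "(p + 3) * ((x * (1 + p)) * (3 - 3 * k + k\<^sup>2)) = (p + 3) * 4"
        by (simp only: mult.assoc mult_cancel_left mult.left_commute[of "p + 3" 4]) simp
      then have "(x * (1 + p)) * (3 - 3 * k + k\<^sup>2) = 4" using p3 by (simp only: mult_cancel_left) simp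
      then show ?thesis by (simp only: mult.commute)
    qed
    show "bsym (ExtrapolatedEquilibrium 3) (-1/2) k w = 1"
      unfolding bsym_simps branch_mass[OF br(1)] br(2) boundary by simp
    show "k * w \<noteq> -1" unfolding br(2) using p1 by (auto simp: add_eq_0_iff)
  qed auto
qed

theorem mainTheorem6:
  fixes lam s2 C :: real
  assumes lam: "lam > 0"
    and C0: "C \<noteq> 0"
    and par: "(0 < s2 \<and> s2 < 2 \<and> \<bar>C\<bar> \<le> 1) \<or> (s2 = 2 \<and> \<bar>C\<bar> < 1)"
  shows
    "(C < 0 \<and> s2 < 2 \<longrightarrow>
        has_label lam s2 C BounceBack L_MU_L \<and>
        has_label lam s2 C AntiBounceBack L_MU_L \<and>
        has_label lam s2 C TwoStepsAntiBounceBack L_SS \<and>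
        has_label lam s2 C (Extrapolation 1) L_SS \<and>
        (\<forall>\<sigma>. 2 \<le> \<sigma> \<and> \<sigma> \<le> 4 \<longrightarrow> has_label lam s2 C (Extrapolation \<sigma>) L_SS) \<and>
        has_label lam s2 C KineticDirichlet L_SS)
   \<and> (C < 0 \<and> s2 = 2 \<longrightarrow>
        has_label lam s2 C BounceBack L_MU_E \<and>
        has_label lam s2 C AntiBounceBack L_MU_E \<and>
        has_label lam s2 C TwoStepsAntiBounceBack L_SSOO \<and>
        has_label lam s2 C (Extrapolation 1) L_SSOO \<and>
        (\<forall>\<sigma>. 2 \<le> \<sigma> \<and> \<sigma> \<le> 4 \<longrightarrow> has_label lam s2 C (Extrapolation \<sigma>) L_MU_E) \<and>
        has_label lam s2 C KineticDirichlet L_SS)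
   \<and> (C > 0 \<longrightarrow>
        has_label lam s2 C BounceBack L_SS \<and>
        has_label lam s2 C AntiBounceBack L_SS \<and>
        has_label lam s2 C TwoStepsAntiBounceBack L_SS \<and>
        has_label lam s2 C (Extrapolation 1) L_MU_E \<and>
        (\<forall>\<sigma>. 2 \<le> \<sigma> \<and> \<sigma> \<le> 4 \<longrightarrow> has_label lam s2 C (Extrapolation \<sigma>) L_MU_E) \<and>
        has_label lam s2 C KineticDirichlet L_SS)
   \<and> (C = -1/2 \<and> s2 = 3/2 \<longrightarrow>
        has_label lam s2 C (ExtrapolatedEquilibrium 1) L_SS \<and>
        has_label lam s2 C (ExtrapolatedEquilibrium 3) L_SS \<and>
        has_label lam s2 C Future L_SS \<and>
        has_label lam s2 C Invented L_GR_L)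
   \<and> (C = -1/2 \<and> s2 = 2 \<longrightarrow>
        has_label lam s2 C (ExtrapolatedEquilibrium 1) L_SS \<and>
        has_label lam s2 C (ExtrapolatedEquilibrium 3) L_GR_L \<and>
        has_label lam s2 C Future L_SS \<and>
        has_label lam s2 C Invented L_GR_L)
   \<and> (C = 1/2 \<and> (s2 = 3/2 \<or> s2 = 2) \<longrightarrow>
        has_label lam s2 C (ExtrapolatedEquilibrium 1) L_MU_E \<and>
        has_label lam s2 C (ExtrapolatedEquilibrium 3) L_GR_L \<and>
        has_label lam s2 C Future L_MU_E \<and>
        has_label lam s2 C Invented L_GR_L)"
proof -
  have s: "0 < s2" "s2 \<le> 2" and C: "\<bar>C\<bar> \<le> 1" "-1 \<le> C" "C \<le> 1"
    and tight: "\<bar>C\<bar> = 1 \<Longrightarrow> s2 < 2" "C = 1 \<Longrightarrow> s2 < 2" "C = -1 \<Longrightarrow> s2 < 2"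
    and leapfrog: "s2 = 2 \<Longrightarrow> -1 < C"
    using par by auto
  have SS: "SS_est s' C' b lam \<Longrightarrow> has_label lam s' C' b L_SS" for s' C' b by simp
  have dirichlet: "has_label lam s2 C KineticDirichlet L_SS"
    using SS_KineticDirichlet[OF s C(1) tight(1) lam] by (rule SS)
  have out_reflection: "s2 < 2 \<Longrightarrow> has_label lam s2 C b L_MU_L" "s2 = 2 \<Longrightarrow> has_label lam s2 C b L_MU_E"
    if "C < 0" "b = BounceBack \<or> b = AntiBounceBack" for b
    using outflow_reflection_label[OF s C(2) that(1) tight(3) lam that(2)] by (simp_all only: if_True if_False less_irrefl)
  have out_two_steps: "has_label lam s2 C TwoStepsAntiBounceBack L_SS" if "s2 < 2"
    by (rule SS[OF SS_outflow_two_steps[OF s(1) that C(1) lam]])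
  have out_extrapolation: "has_label lam s2 C (Extrapolation \<sigma>) L_SS" if "C < 0" "s2 < 2" for \<sigma>
    by (rule SS[OF SS_outflow_extrapolation[OF s(1) that(2) C(2) that(1) lam]])
  have leapfrog_ssoo: "has_label lam s2 C b L_SSOO"
    if "C < 0" "s2 = 2" "b = TwoStepsAntiBounceBack \<or> b = Extrapolation 1" for b
    unfolding that(2) by (rule leapfrog_SSOO_label[OF leapfrog[OF that(2)] that(1) lam that(3)])
  have leapfrog_extrapolation: "has_label lam s2 C (Extrapolation \<sigma>) L_MU_E" if "C < 0" "s2 = 2" "2 \<le> \<sigma>" for \<sigma>
    unfolding that(2) by (rule leapfrog_extrapolation_label[OF leapfrog[OF that(2)] that(1) lam that(3)])
  have in_reflection: "has_label lam s2 C b L_SS"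
    if "0 < C" "b \<in> {BounceBack, AntiBounceBack, TwoStepsAntiBounceBack}" for b
    by (rule SS[OF SS_inflow_reflection[OF s that(1) C(3) tight(1) lam that(2)]])
  have in_extrapolation: "has_label lam s2 C (Extrapolation 1) L_MU_E"
    "2 \<le> \<sigma> \<Longrightarrow> has_label lam s2 C (Extrapolation \<sigma>) L_MU_E" if "0 < C" for \<sigma>
    by (rule inflow_extrapolation_label[OF s that C(3) tight(2) lam]; linarith)+
  have out_half: "has_label lam s2 C b L_SS"
    if "C = -1/2" "s2 = 3/2 \<or> s2 = 2" "b = ExtrapolatedEquilibrium 1 \<or> b = Future" for b
    unfolding that(1) by (rule SS[OF SS_outflow_half[OF that(2) lam that(3)]])
  have in_half: "has_label lam s2 C b L_MU_E"
    if "C = 1/2" "s2 = 3/2 \<or> s2 = 2" "b = ExtrapolatedEquilibrium 1 \<or> b = Future" for b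
    unfolding that(1) by (rule inflow_half_label[OF that(2) lam that(3)])
  have third_order: "C = -1/2 \<Longrightarrow> s2 = 3/2 \<Longrightarrow> has_label lam s2 C (ExtrapolatedEquilibrium 3) L_SS"
    "C = -1/2 \<Longrightarrow> s2 = 2 \<Longrightarrow> has_label lam s2 C (ExtrapolatedEquilibrium 3) L_GR_L"
    "C = 1/2 \<Longrightarrow> s2 = 3/2 \<or> s2 = 2 \<Longrightarrow> has_label lam s2 C (ExtrapolatedEquilibrium 3) L_GR_L"
    using SS[OF SS_extrapolated_equilibrium_3[OF lam]] extrapolated_equilibrium_3_leapfrog_outflow[OF lam]
      extrapolated_equilibrium_3_inflow[OF _ lam] by (simp_all only:)
  have invented: "has_label lam s2 C Invented L_GR_L" if "C = 1/2 \<or> C = -1/2" "s2 = 3/2 \<or> s2 = 2"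
    by (rule Invented_label[OF that lam])
  show ?thesis
    by (intro conjI allI impI; (elim conjE)?;
        metis dirichlet out_reflection out_two_steps out_extrapolation leapfrog_ssoo leapfrog_extrapolation
          in_reflection in_extrapolation out_half in_half third_order invented insert_iff)
qed

end
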